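(* Fix $\sigma>0$, $N\ge1$, $\beta>0$ and $\eta>0$. Assume that the noise distribution $\Psi$ satisfies [Shape] and [Decay]. Then, in dimension $d=1$, the optimally tuned worst-case risk of two-scale median filtering over $\mathrm{SEP\text{-}PLIP}=\mathrm{SEP\text{-}PLIP}(\eta,\beta,N)$ satisfies $$\inf_{0<h_1<h_2}\mathcal{R}_n(M^{h_1,h_2};\mathrm{SEP\text{-}PLIP})\asymp n^{-2/3},\qquad n\to\infty .$$
   Context: Model ($d=1$): let $\mathbb{I}_n=\{1,\dots,n\}$. One observes $Y_n(i)=f(i/n)+\sigma Z_n(i)$, $i\in\mathbb{I}_n$, where $f:[0,1]\to[0,1]$ is unknown, $\sigma>0$ is a fixed noise level and $(Z_n(i))_{i\in\mathbb{I}_n}$ is white noise, i.e. i.i.d. random variables with distribution $\Psi$. Conditions on $\Psi$. [Shape]: $\Psi$ has a density $\psi$ with respect to Lebesgue measure on $\mathbb{R}$, with $\psi$ unimodal, continuous and symmetric about $0$. [Decay]: $\zeta(\Psi):=\sup\{s>0:\psi(x)(|x|+1)^s\text{ is bounded in }x\}>1$. Two-scale median filter: let $0<h_1<h_2<1$. For integers $k$ with $0\le k<1/h_1$ let $B_k^{h_1}=[knh_1+1,(k+1)nh_1]\cap\mathbb{I}_n$ and $Y_n^{h_1}(k)=\mathrm{Median}\{Y_n(i):i\in B_k^{h_1}\}$ (empirical median); $Y_n^{h_1}$ is a coarsened version of $Y_n$, on a grid of $1/h_1$ points. For $i\in B_k^{h_1}$ put $M^{h_1,h_2}[Y_n](i)=M_{h_2}[Y_n^{h_1}](k)$,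 where $M_{h_2}$ is the median filter of window size $h_2$ applied to the coarse signal, i.e. $M_{h_2}[Y_n^{h_1}](k)=\mathrm{Median}\{Y_n^{h_1}(k'):0\le k'<1/h_1,\ |k'-k|\le h_2/h_1\}$. The infimum is over those pairs $0<h_1<h_2<1$ for which $M^{h_1,h_2}[Y_n](i)$ is defined for every $i\in\mathbb{I}_n$ (equivalently, $nh_1$ is a positive integer, so that the blocks $B_k^{h_1}$ cover $\mathbb{I}_n$). Risk: for an estimator $T$, $\mathcal{R}_n(T;f)=\frac1n\sum_{i\in\mathbb{I}_n}\mathbb{E}[(T[Y_n](i)-f(i/n))^2]$, and for a class $\mathcal{F}$ of functions, $\mathcal{R}_n(T;\mathcal{F})=\sup_{f\in\mathcal{F}}\mathcal{R}_n(T;f)$. Function class: the local Lipschitz constant of $f$ at $x$ is $\mathrm{Lip}_x(f)=\limsup_{\varepsilon\to0}\sup_{|y-x|\le\varepsilon,\,y\ne x}\frac{|f(y)-f(x)|}{|y-x|}$. A finite point set $(x_i)_{i=1}^N\subset[0,1]$ is $\eta$-well-separated if $\min(x_i,1-x_i)\ge\eta$ for all $i$ and $|x_j-x_i|\ge\eta$ for all $i\ne j$. $\mathrm{SEP\text{-}PLIP}(\eta,\beta,N)$ is the class of functions $f:[0,1]\to[0,1]$ which have local Lipschitz constant $\le\beta$ at every point of the complement of some $\eta$-well-separated set $(x_i)_{i=1}^N$ (the set may depend on $f$). The parameters are such that this class is nonempty, i.e. an $\eta$-well-separated set of $N$ points exists. $a_n\asymp b_n$ means that the ratio $a_n/b_n$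 is bounded away from $0$ and $\infty$ as $n$ becomes large (constants may depend on $\sigma,\eta,\beta,N,\Psi$). *)

theory Defs
  imports "HOL-Probability.Probability"
begin

section \<open>Noise distribution\<close>

definition unimodal :: "(real \<Rightarrow> real) \<Rightarrow> bool" where
  "unimodal \<psi> \<longleftrightarrow> (\<exists>m. mono_on {..m} \<psi> \<and> antimono_on {m..} \<psi>)"

definition shape_condition :: "real measure \<Rightarrow> (real \<Rightarrow> real) \<Rightarrow> bool" where
  "shape_condition \<Psi> \<psi> \<longleftrightarrow>
     \<Psi> = density lborel (\<lambda>x. ennreal (\<psi> x)) \<and> (\<forall>x. 0 \<le> \<psi> x) \<and>
     unimodal \<psi> \<and> continuous_on UNIV \<psi> \<and> (\<forall>x. \<psi> (- x) = \<psi> x)"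

text \<open>The supremum is taken in the extended reals: it is infinite e.g. for Gaussian noise.
  A continuous density is determined by the distribution, so this is a function of
  the latter.\<close>

definition decay_exponent :: "(real \<Rightarrow> real) \<Rightarrow> ereal" where
  "decay_exponent \<psi> =
     Sup (ereal ` {s. 0 < s \<and> bounded (range (\<lambda>x. \<psi> x * (\<bar>x\<bar> + 1) powr s))})"

section \<open>Medians and the two-scale median filter\<close>

text \<open>Empirical median of the family \<open>(y a)\<close> with \<open>a \<in> A\<close>, counting multiplicities. For an even
  number of observations it is the midpoint of the two central order statistics. The value is
  meaningful only for finite nonempty \<open>A\<close>.\<close>

definition Median :: "'a set \<Rightarrow> ('a \<Rightarrow> real) \<Rightarrow> real" where
  "Median A y =
     (let ys = sorted_list_of_multiset (image_mset y (mset_set A)); m = length ys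
      in (ys ! ((m - 1) div 2) + ys ! (m div 2)) / 2)"

definition coarse_grid :: "real \<Rightarrow> nat set" where
  "coarse_grid h\<^sub>1 = {k. real k < 1 / h\<^sub>1}"

definition block :: "nat \<Rightarrow> real \<Rightarrow> nat \<Rightarrow> nat set" where
  "block n h\<^sub>1 k =
     {i \<in> {1..n}. real k * (real n * h\<^sub>1) + 1 \<le> real i \<and> real i \<le> (real k + 1) * (real n * h\<^sub>1)}"

definition coarse_signal :: "nat \<Rightarrow> real \<Rightarrow> (nat \<Rightarrow> real) \<Rightarrow> nat \<Rightarrow> real" where
  "coarse_signal n h\<^sub>1 Y k = Median (block n h\<^sub>1 k) Y"

definition coarse_window :: "real \<Rightarrow> real \<Rightarrow> nat \<Rightarrow> nat set" where
  "coarse_window h\<^sub>1 h\<^sub>2 k = {k' \<in> coarse_grid h\<^sub>1. \<bar>real k' - real k\<bar> \<le> h\<^sub>2 / h\<^sub>1}"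

definition block_index :: "nat \<Rightarrow> real \<Rightarrow> nat \<Rightarrow> nat" where
  "block_index n h\<^sub>1 i = (THE k. k \<in> coarse_grid h\<^sub>1 \<and> i \<in> block n h\<^sub>1 k)"

definition two_scale_median :: "nat \<Rightarrow> real \<Rightarrow> real \<Rightarrow> (nat \<Rightarrow> real) \<Rightarrow> nat \<Rightarrow> real" where
  "two_scale_median n h\<^sub>1 h\<^sub>2 Y i =
     Median (coarse_window h\<^sub>1 h\<^sub>2 (block_index n h\<^sub>1 i)) (coarse_signal n h\<^sub>1 Y)"

text \<open>The filter is defined at \<open>i\<close> if \<open>i\<close> lies in some block and no median of an empty family
  is taken (the window itself always contains its centre).\<close>

definition two_scale_defined :: "nat \<Rightarrow> real \<Rightarrow> real \<Rightarrow> nat \<Rightarrow> bool" where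
  "two_scale_defined n h\<^sub>1 h\<^sub>2 i \<longleftrightarrow>
     (\<exists>k\<in>coarse_grid h\<^sub>1. i \<in> block n h\<^sub>1 k \<and> (\<forall>k'\<in>coarse_window h\<^sub>1 h\<^sub>2 k. block n h\<^sub>1 k' \<noteq> {}))"

definition admissible_scales :: "nat \<Rightarrow> (real \<times> real) set" where
  "admissible_scales n =
     {(h\<^sub>1, h\<^sub>2). 0 < h\<^sub>1 \<and> h\<^sub>1 < h\<^sub>2 \<and> h\<^sub>2 < 1 \<and> (\<forall>i\<in>{1..n}. two_scale_defined n h\<^sub>1 h\<^sub>2 i)}"

lemma two_scale_defined_iff:
  assumes h: "0 < h\<^sub>1" "h\<^sub>1 < h\<^sub>2" "h\<^sub>2 < 1" and n: "1 \<le> n"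
  shows "(\<forall>i\<in>{1..n}. two_scale_defined n h\<^sub>1 h\<^sub>2 i) \<longleftrightarrow> (\<exists>m::nat. 1 \<le> m \<and> real n * h\<^sub>1 = real m)"
proof
  assume D: "\<forall>i\<in>{1..n}. two_scale_defined n h\<^sub>1 h\<^sub>2 i"
  define x where "x = real n * h\<^sub>1"
  have x0: "0 < x" using h n by (simp add: x_def)
  have xn: "x < real n" using h n by (simp add: x_def)
  define i where "i = nat \<lceil>x\<rceil>"
  have i: "x \<le> real i" "real i < x + 1" "1 \<le> i" "i \<le> n"
    using x0 xn unfolding i_def by linarith+
  then obtain k where k: "i \<in> block n h\<^sub>1 k" using D unfolding two_scale_defined_def by fastforce
  have kb: "real k * x + 1 \<le> real i" "real i \<le> (real k + 1) * x"
    using k by (auto simp: block_def x_def)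
  have "k = 0"
  proof (rule ccontr)
    assume "k \<noteq> 0"
    then have "1 * x \<le> real k * x" using x0 by (intro mult_right_mono) auto
    then show False using kb i by linarith
  qed
  then have "real i = x" using kb i by simp
  then show "\<exists>m::nat. 1 \<le> m \<and> real n * h\<^sub>1 = real m" using i x_def by metis
next
  assume "\<exists>m::nat. 1 \<le> m \<and> real n * h\<^sub>1 = real m"
  then obtain m :: nat where m: "1 \<le> m" "real n * h\<^sub>1 = real m" by blast
  have grid: "k \<in> coarse_grid h\<^sub>1 \<longleftrightarrow> k * m < n" for k
  proof -
    have "k \<in> coarse_grid h\<^sub>1 \<longleftrightarrow> real k * h\<^sub>1 < 1"
      using h by (simp add: coarse_grid_def field_simps)
    also have "\<dots> \<longleftrightarrow> real n * (real k * h\<^sub>1) < real n * 1"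
      using n by (subst mult_less_cancel_left_pos) auto
    also have "real n * (real k * h\<^sub>1) = real (k * m)"
      using m(2) by (metis mult.left_commute of_nat_mult)
    finally show ?thesis by (simp del: of_nat_mult)
  qed
  have blk: "block n h\<^sub>1 k = {i \<in> {1..n}. k * m + 1 \<le> i \<and> i \<le> (k + 1) * m}" for k
  proof -
    have "real k * real m + 1 = real (k * m + 1)" "(real k + 1) * real m = real ((k + 1) * m)"
      by (simp_all add: algebra_simps)
    then show ?thesis unfolding block_def m(2) by (simp only: of_nat_le_iff)
  qed
  have ne: "block n h\<^sub>1 k \<noteq> {}" if "k \<in> coarse_grid h\<^sub>1" for k
  proof -
    have "k * m + 1 \<in> block n h\<^sub>1 k" using that m(1) by (auto simp: grid blk)
    then show ?thesis by blast
  qed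
  show "\<forall>i\<in>{1..n}. two_scale_defined n h\<^sub>1 h\<^sub>2 i"
  proof
    fix i assume i: "i \<in> {1..n}"
    define k where "k = (i - 1) div m"
    have e: "k * m + (i - 1) mod m = i - 1" unfolding k_def by simp
    have "(i - 1) mod m < m" using m(1) by simp
    then have "k * m < n" "k * m + 1 \<le> i" "i \<le> (k + 1) * m" using e i by auto
    then show "two_scale_defined n h\<^sub>1 h\<^sub>2 i"
      unfolding two_scale_defined_def
      using i ne by (intro bexI[of _ k]) (auto simp: grid blk coarse_window_def)
  qed
qed

section \<open>Risk\<close>

text \<open>The noise vector is the identity on the product space \<open>\<Psi>\<^sup>n\<close>, so its coordinates are
  i.i.d. with law \<open>\<Psi>\<close>. The expectation is a Lebesgue integral with values in \<open>[0,\<infinity>]\<close>: under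
  heavy-tailed noise the median of few observations can have infinite second moment, and a
  Bochner integral would then wrongly be zero.\<close>

definition observation :: "nat \<Rightarrow> real \<Rightarrow> (real \<Rightarrow> real) \<Rightarrow> (nat \<Rightarrow> real) \<Rightarrow> nat \<Rightarrow> real" where
  "observation n \<sigma> f z i = f (real i / real n) + \<sigma> * z i"

definition risk ::
  "nat \<Rightarrow> real \<Rightarrow> real measure \<Rightarrow> ((nat \<Rightarrow> real) \<Rightarrow> nat \<Rightarrow> real) \<Rightarrow> (real \<Rightarrow> real) \<Rightarrow> ennreal" where
  "risk n \<sigma> \<Psi> T f =
     (\<Sum>i\<in>{1..n}. \<integral>\<^sup>+ z. ennreal ((T (observation n \<sigma> f z) i - f (real i / real n))\<^sup>2)
        \<partial>(\<Pi>\<^sub>M j\<in>{1..n}. \<Psi>)) / of_nat n"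

definition class_risk ::
  "nat \<Rightarrow> real \<Rightarrow> real measure \<Rightarrow> ((nat \<Rightarrow> real) \<Rightarrow> nat \<Rightarrow> real) \<Rightarrow> (real \<Rightarrow> real) set \<Rightarrow> ennreal"
  where "class_risk n \<sigma> \<Psi> T F = (SUP f\<in>F. risk n \<sigma> \<Psi> T f)"

section \<open>Function class\<close>

text \<open>A function on \<open>[0,1]\<close> is represented by a function on the reals whose values outside
  \<open>[0,1]\<close> are irrelevant; in particular only \<open>y \<in> [0,1]\<close> enter the local Lipschitz constant.\<close>

definition local_lip :: "(real \<Rightarrow> real) \<Rightarrow> real \<Rightarrow> ereal" where
  "local_lip f x =
     Limsup (at_right 0) (\<lambda>\<epsilon>. SUP y\<in>{y \<in> {0..1}. \<bar>y - x\<bar> \<le> \<epsilon> \<and> y \<noteq> x}.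
       ereal (\<bar>f y - f x\<bar> / \<bar>y - x\<bar>))"

definition well_separated :: "real \<Rightarrow> nat \<Rightarrow> (nat \<Rightarrow> real) \<Rightarrow> bool" where
  "well_separated \<eta> N x \<longleftrightarrow>
     (\<forall>i\<in>{1..N}. x i \<in> {0..1} \<and> \<eta> \<le> min (x i) (1 - x i)) \<and>
     (\<forall>i\<in>{1..N}. \<forall>j\<in>{1..N}. i \<noteq> j \<longrightarrow> \<eta> \<le> \<bar>x j - x i\<bar>)"

definition SEP_PLIP :: "real \<Rightarrow> real \<Rightarrow> nat \<Rightarrow> (real \<Rightarrow> real) set" where
  "SEP_PLIP \<eta> \<beta> N =
     {f. (\<forall>t\<in>{0..1}. f t \<in> {0..1}) \<and>
         (\<exists>x. well_separated \<eta> N x \<and> (\<forall>t\<in>{0..1} - x ` {1..N}. local_lip f t \<le> ereal \<beta>))}"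

section \<open>Order of magnitude\<close>

definition same_order :: "(nat \<Rightarrow> ennreal) \<Rightarrow> (nat \<Rightarrow> ennreal) \<Rightarrow> bool" where
  "same_order a b \<longleftrightarrow>
     (\<exists>c C::real. 0 < c \<and> 0 < C \<and>
       (\<forall>\<^sub>F n in sequentially. ennreal c \<le> a n / b n \<and> a n / b n \<le> ennreal C))"

end

theory Submission imports Defs begin

text \<open>
  Let \<open>m\<close> be the number of pixels in a block and \<open>w\<close> the number of blocks on either side of the centre of a
  window, so that a window has about \<open>m w\<close> pixels.

  For the upper bound, note that where the signal is Lipschitz, the squared error is of order \<open>1 / (m w) + (m w / n)\<^sup>2\<close>, variance
  and squared bias, and \<open>m w\<close> of order \<open>n\<^sup>2\<^sup>/\<^sup>3\<close> balances the two. What the first median buys is robustness next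
  to a jump. In the window of a block at distance \<open>j\<close> from the jump, the blocks beyond the jump are a minority. The
  output is then an order statistic, somewhat off the middle, of the medians of the remaining blocks, and these
  medians are already of size \<open>1 / \<surd>m\<close>; the squared error is at most of order \<open>\<surd>(w / j) / m\<close>. Summed over
  \<open>j \<le> w\<close> and over the \<open>m\<close> pixels of each block, this adds \<open>w / n\<close> to the risk. Only the block that contains the
  jump has an error of constant order, and it adds \<open>m / n\<close>. With \<open>m\<close> and \<open>w\<close> both of order \<open>n\<^sup>1\<^sup>/\<^sup>3\<close> every
  contribution is of order \<open>n\<^sup>-\<^sup>2\<^sup>/\<^sup>3\<close>.

  The two scales are treated by one argument used twice. If \<open>p u\<close> is the probability that a symmetric observation
  exceeds \<open>u\<close>, the Chernoff bound for the median of \<open>M\<close> independent observations is a power of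
  \<open>4 p u (1 - p u)\<close>, and polynomial decay of this expression (\<open>polynomial_profile\<close>) gives a fourth moment of order
  \<open>1 / M\<^sup>2\<close> (\<open>fourth_moment_Median\<close>). By \<open>half_tail_scaled_median\<close> the medians of blocks of \<open>m\<close> pixels, multiplied by
  \<open>\<surd>m\<close>, have such a profile again, with constants independent of \<open>m\<close>; hence window medians have fourth
  moments of order \<open>1 / (m w)\<^sup>2\<close>. Contaminated windows are covered by \<open>contaminated_window_error\<close>: a large
  error of the output requires many large medians among the good blocks.

  For the lower bound, put \<open>L = m w\<close>. Since \<open>max (1 / L) ((L / n)\<^sup>2) \<ge> n\<^sup>-\<^sup>2\<^sup>/\<^sup>3\<close>, it is enough to bound the worst-case risk
  from below by the variance and by the squared bias. For the variance the signal is constant, and a bounded density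
  keeps the window median from concentrating faster than \<open>1 / \<surd>L\<close> (\<open>constant_signal_risk\<close>). For the bias, the
  output of the filter is compared with its reflection: if a permutation of the pixels that respects blocks
  exchanges values of the signal above and below \<open>c\<close>, the symmetry of the noise makes the law of the output symmetric
  about \<open>c\<close>, whatever the density (\<open>reflected_window_risk\<close>). A sine wave whose period is the length of the window has
  this property at every interior pixel, with \<open>c\<close> the mean of the wave (\<open>small_window_risk\<close>). If the window is
  comparable to the whole interval, a linear signal near the border serves instead (\<open>large_window_risk\<close>).
\<close>

section \<open>Order statistics and empirical medians\<close>

definition order_stat :: "'a set \<Rightarrow> ('a \<Rightarrow> real) \<Rightarrow> nat \<Rightarrow> real" where
  "order_stat A y j = sorted_list_of_multiset (image_mset y (mset_set A)) ! j"

lemma sorted_nth_le_iff: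
  fixes xs :: "real list"
  assumes "sorted xs" "j < length xs"
  shows "xs ! j \<le> t \<longleftrightarrow> j < length (filter (\<lambda>x. x \<le> t) xs)"
  using assms
proof (induction xs arbitrary: j)
  case (Cons x xs)
  have e: "filter (\<lambda>x. x \<le> t) xs = []" if "\<not> x \<le> t"
    using Cons.prems that by (fastforce simp: filter_empty_conv)
  show ?case
  proof (cases j)
    case 0 then show ?thesis using e by auto
  next
    case (Suc i)
    have "x \<le> xs ! i" using Cons.prems Suc by auto
    then show ?thesis using Cons Suc e by auto
  qed
qed simp

lemma sorted_nth_less_iff:
  fixes xs :: "real list"
  assumes "sorted xs" "j < length xs"
  shows "xs ! j < t \<longleftrightarrow> j < length (filter (\<lambda>x. x < t) xs)"
  using assms
proof (induction xs arbitrary: j)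
  case (Cons x xs)
  have e: "filter (\<lambda>x. x < t) xs = []" if "\<not> x < t"
    using Cons.prems that by (fastforce simp: filter_empty_conv)
  show ?case
  proof (cases j)
    case 0 then show ?thesis using e by auto
  next
    case (Suc i)
    have "x \<le> xs ! i" using Cons.prems Suc by auto
    then show ?thesis using Cons Suc e by auto
  qed
qed simp

lemma length_filter_sample:
  assumes "finite A"
  shows "length (filter P (sorted_list_of_multiset (image_mset y (mset_set A)))) = card {a \<in> A. P (y a)}"
proof -
  have "length (filter P (sorted_list_of_multiset (image_mset y (mset_set A))))
      = size (mset (filter P (sorted_list_of_multiset (image_mset y (mset_set A)))))" by (simp only: size_mset)
  also have "\<dots> = size (filter_mset P (image_mset y (mset_set A)))" by (simp only: mset_filter mset_sorted_list_of_multiset)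
  also have "\<dots> = card {a \<in> A. P (y a)}"
    by (simp add: filter_mset_image_mset size_mset_set filter_mset_mset_set assms)
  finally show ?thesis .
qed

lemma length_sample: "finite A \<Longrightarrow> length (sorted_list_of_multiset (image_mset y (mset_set A))) = card A"
  using length_filter_sample[of A "\<lambda>_. True" y] by simp

lemma Median_order_stat:
  "finite A \<Longrightarrow> Median A y = (order_stat A y ((card A - 1) div 2) + order_stat A y (card A div 2)) / 2"
  by (simp add: Median_def order_stat_def Let_def length_sample)

text \<open>All facts about medians below are derived from this equivalence: it turns sorting into counting the observations
  on one side of a threshold.\<close>

lemma order_stat_le_iff:
  assumes "finite A" "j < card A"
  shows "order_stat A y j \<le> t \<longleftrightarrow> j < card {a \<in> A. y a \<le> t}"
  unfolding order_stat_def using assms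
  by (subst sorted_nth_le_iff) (auto simp: length_sample length_filter_sample)

lemma order_stat_less_iff:
  assumes "finite A" "j < card A"
  shows "order_stat A y j < t \<longleftrightarrow> j < card {a \<in> A. y a < t}"
  unfolding order_stat_def using assms
  by (subst sorted_nth_less_iff) (auto simp: length_sample length_filter_sample)

lemma order_stat_mono_index:
  assumes "finite A" "i \<le> j" "j < card A"
  shows "order_stat A y i \<le> order_stat A y j"
  unfolding order_stat_def using assms
  by (intro sorted_nth_mono) (auto simp: length_sample)

lemma order_stat_mono:
  assumes "finite A" "j < card A" "\<And>a. a \<in> A \<Longrightarrow> y a \<le> y' a"
  shows "order_stat A y j \<le> order_stat A y' j"
proof -
  have "j < card {a \<in> A. y' a \<le> order_stat A y' j}"
    using order_stat_le_iff[OF assms(1,2), of y' "order_stat A y' j"] by simp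
  also have "\<dots> \<le> card {a \<in> A. y a \<le> order_stat A y' j}"
    using assms by (intro card_mono) (auto intro: order_trans)
  finally show ?thesis using order_stat_le_iff[OF assms(1,2)] by blast
qed

lemma card_split: "finite A \<Longrightarrow> card {a \<in> A. P a} + card {a \<in> A. \<not> P a} = card A"
  using card_Int_Diff[of A "{a. P a}"] by (simp add: Int_def Diff_eq Collect_neg_eq[symmetric])

lemma card_ge_eq: "finite A \<Longrightarrow> card {a \<in> A. (t::real) \<le> y a} = card A - card {a \<in> A. y a < t}"
  using card_split[of A "\<lambda>a. y a < t"] by (simp add: not_less)

lemma card_gt_eq: "finite A \<Longrightarrow> card {a \<in> A. (t::real) < y a} = card A - card {a \<in> A. y a \<le> t}"
  using card_split[of A "\<lambda>a. y a \<le> t"] by (simp add: not_le)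

lemma order_stat_uminus:
  assumes "finite A" "j < card A"
  shows "order_stat A (\<lambda>a. - y a) j = - order_stat A y (card A - 1 - j)"
proof -
  have j': "card A - 1 - j < card A" using assms by auto
  have "order_stat A (\<lambda>a. - y a) j \<le> t \<longleftrightarrow> - order_stat A y (card A - 1 - j) \<le> t" for t
  proof -
    have c: "card {a \<in> A. y a < - t} \<le> card A" using assms by (intro card_mono) auto
    have "order_stat A (\<lambda>a. - y a) j \<le> t \<longleftrightarrow> j < card {a \<in> A. - t \<le> y a}"
      by (subst order_stat_le_iff[OF assms]) (simp add: minus_le_iff)
    also have "\<dots> \<longleftrightarrow> \<not> (card A - 1 - j < card {a \<in> A. y a < - t})"
      using assms c by (auto simp: card_ge_eq)
    also have "\<dots> \<longleftrightarrow> \<not> (order_stat A y (card A - 1 - j) < - t)"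
      by (simp only: order_stat_less_iff[OF assms(1) j'])
    finally show ?thesis by linarith
  qed
  then show ?thesis by (meson antisym order_refl)
qed

lemma Median_cong: "(\<And>a. a \<in> A \<Longrightarrow> y a = y' a) \<Longrightarrow> Median A y = Median A y'"
proof -
  assume "\<And>a. a \<in> A \<Longrightarrow> y a = y' a"
  then have "image_mset y (mset_set A) = image_mset y' (mset_set A)"
    by (intro image_mset_cong) (metis elem_mset_set empty_iff infinite_set_mset_mset_set)
  then show ?thesis by (simp add: Median_def)
qed

lemma Median_reindex:
  assumes "bij_betw \<pi> A B"
  shows "Median A (\<lambda>a. y (\<pi> a)) = Median B y"
proof -
  have "image_mset (\<lambda>a. y (\<pi> a)) (mset_set A) = image_mset y (image_mset \<pi> (mset_set A))"
    by (simp add: multiset.map_comp o_def)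
  also have "image_mset \<pi> (mset_set A) = mset_set B"
    using assms by (metis bij_betw_def image_mset_mset_set)
  finally show ?thesis by (simp add: Median_def)
qed

text \<open>Negation exchanges the two central order statistics. With the midpoint convention the median is therefore odd
  for samples of even size as well, which the reflection arguments rely on.\<close>

lemma Median_uminus:
  assumes "finite A" "A \<noteq> {}"
  shows "Median A (\<lambda>a. - y a) = - Median A y"
proof -
  have c: "0 < card A" using assms by (simp add: card_gt_0_iff)
  have e: "card A - 1 - (card A - 1) div 2 = card A div 2" "card A - 1 - card A div 2 = (card A - 1) div 2"
    using c by linarith+
  have l: "(card A - 1) div 2 < card A" "card A div 2 < card A" using c by auto
  show ?thesis
    unfolding Median_order_stat[OF assms(1)] order_stat_uminus[OF assms(1) l(1)]
      order_stat_uminus[OF assms(1) l(2)] e by argo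
qed

lemma Median_mono:
  assumes "finite A" "A \<noteq> {}" "\<And>a. a \<in> A \<Longrightarrow> y a \<le> y' a"
  shows "Median A y \<le> Median A y'"
proof -
  have c: "0 < card A" using assms by (simp add: card_gt_0_iff)
  have l: "(card A - 1) div 2 < card A" "card A div 2 < card A" using c by auto
  show ?thesis
    unfolding Median_order_stat[OF assms(1)]
    by (intro divide_right_mono add_mono order_stat_mono[OF assms(1) l(1)] order_stat_mono[OF assms(1) l(2)] assms(3)) auto
qed

lemma order_stat_affine:
  assumes "finite A" "j < card A" "0 < s"
  shows "order_stat A (\<lambda>a. c + s * y a) j = c + s * order_stat A y j"
proof -
  have "order_stat A (\<lambda>a. c + s * y a) j \<le> t \<longleftrightarrow> c + s * order_stat A y j \<le> t" for t
  proof -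
    have i: "c + s * u \<le> t \<longleftrightarrow> u \<le> (t - c) / s" for u using assms(3) by (auto simp: field_simps)
    show ?thesis unfolding order_stat_le_iff[OF assms(1,2)] i ..
  qed
  then show ?thesis by (meson antisym order_refl)
qed

lemma Median_affine:
  assumes "finite A" "A \<noteq> {}" "0 < s"
  shows "Median A (\<lambda>a. c + s * y a) = c + s * Median A y"
proof -
  have c: "0 < card A" using assms by (simp add: card_gt_0_iff)
  have l: "(card A - 1) div 2 < card A" "card A div 2 < card A" using c by auto
  show ?thesis
    unfolding Median_order_stat[OF assms(1)] order_stat_affine[OF assms(1) l(1) assms(3)]
      order_stat_affine[OF assms(1) l(2) assms(3)] by (simp add: field_simps)
qed

lemma order_stat_le_Median:
  assumes "finite A" "A \<noteq> {}"
  shows "order_stat A y ((card A - 1) div 2) \<le> Median A y" "Median A y \<le> order_stat A y (card A div 2)"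
proof -
  have "order_stat A y ((card A - 1) div 2) \<le> order_stat A y (card A div 2)"
    using assms by (intro order_stat_mono_index) (auto simp: card_gt_0_iff div_le_mono)
  then show "order_stat A y ((card A - 1) div 2) \<le> Median A y" "Median A y \<le> order_stat A y (card A div 2)"
    using assms by (auto simp: Median_order_stat)
qed

text \<open>A median above \<open>t\<close> needs at least half of the sample above \<open>t\<close>, whereas only a strict majority guarantees
  it (\<open>le_MedianI\<close>). The gap is the case of exactly half of an even sample, where the midpoint decides.\<close>

lemma card_ge_of_le_Median:
  assumes "finite A" "A \<noteq> {}" "t \<le> Median A y"
  shows "card A \<le> 2 * card {a \<in> A. t \<le> y a}"
proof -
  have c: "0 < card A" using assms by (simp add: card_gt_0_iff)
  have "\<not> order_stat A y (card A div 2) < t" using order_stat_le_Median(2)[OF assms(1,2), of y] assms(3) by linarith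
  then have "card {a \<in> A. y a < t} \<le> card A div 2"
    using order_stat_less_iff[OF assms(1), of "card A div 2" y t] c by auto
  then show ?thesis using card_ge_eq[OF assms(1), of t y] by linarith
qed

lemma le_MedianI:
  assumes "finite A" "card A < 2 * card {a \<in> A. t \<le> y a}"
  shows "t \<le> Median A y"
proof -
  have ne: "A \<noteq> {}" using assms by auto
  have c: "0 < card A" using ne assms by (simp add: card_gt_0_iff)
  have "\<not> (card A - 1) div 2 < card {a \<in> A. y a < t}"
    using assms card_ge_eq[OF assms(1), of t y] by linarith
  then have "\<not> order_stat A y ((card A - 1) div 2) < t"
    using order_stat_less_iff[OF assms(1), of "(card A - 1) div 2" y t] c by auto
  then show ?thesis using order_stat_le_Median(1)[OF assms(1) ne, of y] by linarith
qed

lemma card_le_of_Median_le: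
  assumes "finite A" "A \<noteq> {}" "Median A y \<le> t"
  shows "card A \<le> 2 * card {a \<in> A. y a \<le> t}"
  using card_ge_of_le_Median[of A "- t" "\<lambda>a. - y a"] assms by (simp add: Median_uminus)

lemma Median_leI:
  assumes "finite A" "card A < 2 * card {a \<in> A. y a \<le> t}"
  shows "Median A y \<le> t"
proof -
  have "A \<noteq> {}" using assms by auto
  then show ?thesis using le_MedianI[of A "- t" "\<lambda>a. - y a"] assms by (simp add: Median_uminus)
qed

lemma less_Median_iff_odd:
  assumes "finite A" "odd (card A)"
  shows "t < Median A y \<longleftrightarrow> card A < 2 * card {a \<in> A. t < y a}"
proof -
  have ne: "A \<noteq> {}" using assms by auto
  have c: "0 < card A" using ne assms by (simp add: card_gt_0_iff)
  have e: "(card A - 1) div 2 = card A div 2" using assms by (elim oddE) simp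
  have "Median A y = order_stat A y (card A div 2)" 
    unfolding Median_order_stat[OF assms(1)] e by simp
  then have "t < Median A y \<longleftrightarrow> \<not> (order_stat A y (card A div 2) \<le> t)" by (simp add: not_le)
  also have "order_stat A y (card A div 2) \<le> t \<longleftrightarrow> card A div 2 < card {a \<in> A. y a \<le> t}"
    using c by (intro order_stat_le_iff assms) auto
  finally have "t < Median A y \<longleftrightarrow> \<not> (card A div 2 < card {a \<in> A. y a \<le> t})" .
  moreover have "card {a \<in> A. y a \<le> t} \<le> card A" using assms by (intro card_mono) auto
  moreover have "card A = 2 * (card A div 2) + 1" using assms(2) by (elim oddE) simp
  ultimately show ?thesis using card_gt_eq[OF assms(1), of t y] by linarith
qed

lemma borel_measurable_card:
  assumes "finite A" "\<And>a. a \<in> A \<Longrightarrow> {\<omega> \<in> space M. P a \<omega>} \<in> sets M"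
  shows "(\<lambda>\<omega>. real (card {a \<in> A. P a \<omega>})) \<in> borel_measurable M"
proof -
  have "real (card {a \<in> A. P a \<omega>}) = (\<Sum>a\<in>A. indicator {\<omega> \<in> space M. P a \<omega>} \<omega>)" if "\<omega> \<in> space M" for \<omega>
    using assms(1) that by (simp add: indicator_def sum.If_cases Int_def)
  then show ?thesis using assms by (subst measurable_cong) auto
qed

lemma borel_measurable_order_stat:
  assumes "finite A" "j < card A" "\<And>a. a \<in> A \<Longrightarrow> (\<lambda>\<omega>. y a \<omega>) \<in> borel_measurable M"
  shows "(\<lambda>\<omega>. order_stat A (\<lambda>a. y a \<omega>) j) \<in> borel_measurable M"
proof (subst borel_measurable_iff_le, intro allI)
  fix t
  have [measurable]: "(\<lambda>\<omega>. real (card {a \<in> A. y a \<omega> \<le> t})) \<in> borel_measurable M"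
    using assms by (intro borel_measurable_card) measurable
  have "{\<omega> \<in> space M. order_stat A (\<lambda>a. y a \<omega>) j \<le> t}
      = {\<omega> \<in> space M. real j < real (card {a \<in> A. y a \<omega> \<le> t})}"
    using order_stat_le_iff[OF assms(1,2)] by auto
  also have "\<dots> \<in> sets M" by measurable
  finally show "{\<omega> \<in> space M. order_stat A (\<lambda>a. y a \<omega>) j \<le> t} \<in> sets M" .
qed

lemma borel_measurable_Median:
  assumes "finite A" "A \<noteq> {}" "\<And>a. a \<in> A \<Longrightarrow> (\<lambda>\<omega>. y a \<omega>) \<in> borel_measurable M"
  shows "(\<lambda>\<omega>. Median A (\<lambda>a. y a \<omega>)) \<in> borel_measurable M"
proof -
  have c: "0 < card A" using assms by (simp add: card_gt_0_iff)
  have [measurable]: "(\<lambda>\<omega>. order_stat A (\<lambda>a. y a \<omega>) ((card A - 1) div 2)) \<in> borel_measurable M"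
    "(\<lambda>\<omega>. order_stat A (\<lambda>a. y a \<omega>) (card A div 2)) \<in> borel_measurable M"
    using assms c by (auto intro!: borel_measurable_order_stat)
  show ?thesis unfolding Median_order_stat[OF assms(1)] by measurable
qed

section \<open>Binomial tails\<close>

lemma central_binomial_Suc:
  "real (Suc r) * real ((2 * Suc r) choose Suc r) = 2 * (2 * real r + 1) * real ((2 * r) choose r)"
proof -
  have "(2 * Suc r) choose Suc r = (Suc (2 * r) choose r) + (Suc (2 * r) choose Suc r)"
    by (simp add: numeral_2_eq_2)
  also have "Suc (2 * r) choose r = Suc (2 * r) choose Suc r"
    by (subst binomial_symmetric) (auto simp: Suc_diff_le)
  finally have a: "(2 * Suc r) choose Suc r = 2 * (Suc (2 * r) choose Suc r)" by simp
  have "Suc (2 * r) * ((2 * r) choose r) = (Suc (2 * r) choose Suc r) * Suc r"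
    by (rule Suc_times_binomial_eq)
  then have "real (Suc (2 * r)) * real ((2 * r) choose r) = real (Suc (2 * r) choose Suc r) * real (Suc r)"
    by (metis of_nat_mult)
  then show ?thesis unfolding a by (simp add: algebra_simps)
qed

text \<open>Squaring removes the root from the usual bound \<open>4\<^sup>r / \<surd>(2 r + 1)\<close>; the induction step is then a polynomial
  inequality.\<close>

lemma central_binomial_sq_le: "(real ((2 * r) choose r))\<^sup>2 * (2 * real r + 1) \<le> 16 ^ r"
proof (induction r)
  case (Suc r)
  define a b where "a = real ((2 * r) choose r)" and "b = real ((2 * Suc r) choose Suc r)"
  have "(b\<^sup>2 * (2 * real (Suc r) + 1)) * (real (Suc r))\<^sup>2 = (real (Suc r) * b)\<^sup>2 * (2 * real (Suc r) + 1)"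
    by (simp add: power2_eq_square algebra_simps)
  also have "real (Suc r) * b = 2 * (2 * real r + 1) * a"
    unfolding a_def b_def by (rule central_binomial_Suc)
  also have "(2 * (2 * real r + 1) * a)\<^sup>2 * (2 * real (Suc r) + 1)
      = (a\<^sup>2 * (2 * real r + 1)) * (4 * (2 * real r + 1) * (2 * real r + 3))"
    by (simp add: power2_eq_square algebra_simps)
  also have "\<dots> \<le> 16 ^ r * (4 * (2 * real r + 1) * (2 * real r + 3))"
    using Suc.IH by (intro mult_right_mono) (auto simp: a_def)
  also have "\<dots> \<le> 16 ^ r * (16 * (real (Suc r))\<^sup>2)"
    by (intro mult_left_mono) (auto simp: power2_eq_square algebra_simps)
  finally have "(b\<^sup>2 * (2 * real (Suc r) + 1)) * (real (Suc r))\<^sup>2 \<le> 16 ^ Suc r * (real (Suc r))\<^sup>2"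
    by simp
  then show ?case unfolding b_def by (rule mult_right_le_imp_le) simp
qed simp

lemma central_binomial_sq_ge: "16 ^ r \<le> (real ((2 * r) choose r))\<^sup>2 * (4 * real r + 1)"
proof (induction r)
  case (Suc r)
  define a b where "a = real ((2 * r) choose r)" and "b = real ((2 * Suc r) choose Suc r)"
  have "16 ^ Suc r * (real (Suc r))\<^sup>2 * (4 * real r + 1) = 16 ^ r * (16 * (real r + 1)\<^sup>2 * (4 * real r + 1))"
    by (simp add: algebra_simps)
  also have "\<dots> \<le> 16 ^ r * (4 * (2 * real r + 1)\<^sup>2 * (4 * real r + 5))"
    by (intro mult_left_mono) (auto simp: power2_eq_square algebra_simps)
  also have "\<dots> \<le> (a\<^sup>2 * (4 * real r + 1)) * (4 * (2 * real r + 1)\<^sup>2 * (4 * real r + 5))"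
    using Suc.IH by (intro mult_right_mono) (auto simp: a_def)
  also have "\<dots> = (2 * (2 * real r + 1) * a)\<^sup>2 * (4 * real (Suc r) + 1) * (4 * real r + 1)"
    by (simp add: power2_eq_square algebra_simps)
  also have "2 * (2 * real r + 1) * a = real (Suc r) * b"
    unfolding a_def b_def by (rule central_binomial_Suc[symmetric])
  also have "(real (Suc r) * b)\<^sup>2 * (4 * real (Suc r) + 1) * (4 * real r + 1)
      = (b\<^sup>2 * (4 * real (Suc r) + 1)) * (real (Suc r))\<^sup>2 * (4 * real r + 1)"
    by (simp only: power_mult_distrib mult_ac)
  finally have "16 ^ Suc r * ((real (Suc r))\<^sup>2 * (4 * real r + 1))
      \<le> (b\<^sup>2 * (4 * real (Suc r) + 1)) * ((real (Suc r))\<^sup>2 * (4 * real r + 1))"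
    by (simp only: mult.assoc)
  then show ?case unfolding b_def by (rule mult_right_le_imp_le) (simp add: add_pos_pos)
qed simp

lemma binomial_sqrt_le: "real (n choose k) * sqrt (real n + 1) \<le> 2 ^ n"
proof -
  have e: "real ((2 * r) choose r) * sqrt (2 * real r + 1) \<le> 4 ^ r" for r
  proof (rule power2_le_imp_le)
    show "(real (2 * r choose r) * sqrt (2 * real r + 1))\<^sup>2 \<le> (4 ^ r)\<^sup>2"
      using central_binomial_sq_le[of r] by (simp add: power_mult_distrib power_mult[symmetric] mult.commute[of _ 2] power_mult[of "4::real" 2])
  qed simp
  show ?thesis
  proof (cases "even n")
    case True
    then obtain r where n: "n = 2 * r" by auto
    have "real (n choose k) * sqrt (real n + 1) \<le> real (n choose r) * sqrt (real n + 1)"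
      using binomial_maximum[of n k] n by (intro mult_right_mono) auto
    also have "\<dots> \<le> 2 ^ n" using e[of r] by (simp add: n power_mult)
    finally show ?thesis .
  next
    case False
    then obtain r where n: "n = Suc (2 * r)" by (metis oddE Suc_eq_plus1)
    have s: "n choose r = n choose Suc r"
      unfolding n by (subst binomial_symmetric) (auto simp: Suc_diff_le)
    have "(2 * Suc r) choose Suc r = (n choose r) + (n choose Suc r)"
      by (simp add: n numeral_2_eq_2)
    then have d: "real ((2 * Suc r) choose Suc r) = 2 * real (n choose r)" using s by simp
    have "n div 2 = r" using n by simp
    then have "real (n choose k) * sqrt (real n + 1) \<le> real (n choose r) * sqrt (2 * real (Suc r) + 1)"
      using binomial_maximum[of n k] n by (intro mult_mono) auto
    also have "\<dots> = real ((2 * Suc r) choose Suc r) * sqrt (2 * real (Suc r) + 1) / 2" using d by simp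
    also have "\<dots> \<le> 4 ^ Suc r / 2" using e[of "Suc r"] by (intro divide_right_mono) auto
    also have "\<dots> = 2 ^ n" by (simp add: n power_mult)
    finally show ?thesis .
  qed
qed

definition binom_tail :: "nat \<Rightarrow> nat \<Rightarrow> real \<Rightarrow> real" where
  "binom_tail n s p = (\<Sum>k=s..n. real (n choose k) * p ^ k * (1 - p) ^ (n - k))"

text \<open>The derivatives of the individual terms telescope.\<close>

lemma binom_tail_deriv:
  assumes "1 \<le> s" "s \<le> n"
  shows "(binom_tail n s has_real_derivative
           real n * real ((n - 1) choose (s - 1)) * p ^ (s - 1) * (1 - p) ^ (n - s)) (at p)"
proof -
  define b where "b = (\<lambda>k. real n * real ((n - 1) choose k) * p ^ k * (1 - p) ^ (n - 1 - k))"
  have "((\<lambda>p. real (n choose k) * p ^ k * (1 - p) ^ (n - k)) has_real_derivative b (k - 1) - b k) (at p)"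
    if k: "k \<in> {s..n}" for k
  proof -
    have k1: "1 \<le> k" "k \<le> n" using k assms by auto
    then obtain j where j: "k = Suc j" by (cases k) auto
    obtain n' where n': "n = Suc n'" using k1 by (cases n) auto
    have jn: "j \<le> n'" using k1 j n' by simp
    have c1: "real (n choose k) * real k = real n * real (n' choose j)"
      using Suc_times_binomial_eq[of n' j] unfolding j n' by (metis of_nat_mult)
    have c2: "real (n choose k) * real (n - k) = real n * real (n' choose k)"
    proof (cases "k \<le> n'")
      case True
      have "Suc n' * (n' choose (n' - k)) = (Suc n' choose Suc (n' - k)) * Suc (n' - k)"
        by (rule Suc_times_binomial_eq)
      moreover have "n' choose (n' - k) = n' choose k" using True by (rule binomial_symmetric[symmetric])
      moreover have "Suc n' choose Suc (n' - k) = Suc n' choose k"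
        using True by (subst binomial_symmetric) (auto simp: Suc_diff_le)
      ultimately have "n * (n' choose k) = (n choose k) * (n - k)" using True by (simp add: n' Suc_diff_le)
      then show ?thesis by (metis of_nat_mult)
    next
      case False
      then show ?thesis using k1 by (simp add: n')
    qed
    have "((\<lambda>p. real (n choose k) * p ^ k * (1 - p) ^ (n - k)) has_real_derivative
        (real (n choose k) * real k) * p ^ (k - 1) * (1 - p) ^ (n - k)
        - (real (n choose k) * real (n - k)) * p ^ k * (1 - p) ^ (n - k - 1)) (at p)"
      by (auto intro!: derivative_eq_intros simp: algebra_simps)
    also have "(real (n choose k) * real k) * p ^ (k - 1) * (1 - p) ^ (n - k)
        - (real (n choose k) * real (n - k)) * p ^ k * (1 - p) ^ (n - k - 1) = b (k - 1) - b k"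
      unfolding c1 c2 b_def by (simp add: j n')
    finally show ?thesis .
  qed
  then have "(binom_tail n s has_real_derivative (\<Sum>k=s..n. b (k - 1) - b k)) (at p)"
    unfolding binom_tail_def[abs_def] by (intro DERIV_sum) auto
  also have "(\<Sum>k=s..n. b (k - 1) - b k) = (\<Sum>k=s..n. (\<lambda>i. - b (i - 1)) (Suc k) - (\<lambda>i. - b (i - 1)) k)"
    by simp
  also have "\<dots> = b (s - 1) - b n"
    using assms by (subst sum_Suc_diff) auto
  also have "b n = 0" using assms by (simp add: b_def)
  finally show ?thesis using assms by (simp add: b_def)
qed

lemma binom_tail_mono:
  assumes "1 \<le> s" "s \<le> n" "0 \<le> p" "p \<le> q" "q \<le> 1"
  shows "binom_tail n s p \<le> binom_tail n s q"
proof (rule DERIV_nonneg_imp_nondecreasing[OF assms(4)])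
  fix x assume "p \<le> x" "x \<le> q"
  then have "0 \<le> real n * real ((n - 1) choose (s - 1)) * x ^ (s - 1) * (1 - x) ^ (n - s)"
    using assms by auto
  then show "\<exists>D. (binom_tail n s has_real_derivative D) (at x) \<and> 0 \<le> D"
    using binom_tail_deriv[OF assms(1,2)] by blast
qed

lemma binom_tail_majority_half: "binom_tail (2 * r + 1) (r + 1) (1 / 2) = 1 / 2"
proof -
  have "(\<Sum>k=r+1..2*r+1. real ((2 * r + 1) choose k)) = (\<Sum>k\<le>r. real ((2 * r + 1) choose k))"
    by (rule sum.reindex_bij_witness[of _ "\<lambda>k. 2 * r + 1 - k" "\<lambda>k. 2 * r + 1 - k"])
      (auto simp: binomial_symmetric[symmetric])
  also have "\<dots> = real (\<Sum>k\<le>r. (2 * r + 1) choose k)" by simp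
  also have "\<dots> = 2 ^ (2 * r)" by (subst binomial_r_part_sum) simp
  finally have s: "(\<Sum>k=r+1..2*r+1. real ((2 * r + 1) choose k)) = 2 ^ (2 * r)" .
  have "binom_tail (2 * r + 1) (r + 1) (1 / 2) = (\<Sum>k=r+1..2*r+1. real ((2 * r + 1) choose k) * (1/2) ^ (2 * r + 1))"
    unfolding binom_tail_def
  proof (intro sum.cong refl)
    fix k assume "k \<in> {r + 1..2 * r + 1}"
    then have "(1 / 2 :: real) ^ (2 * r + 1) = (1/2) ^ k * (1/2) ^ (2 * r + 1 - k)"
      by (subst power_add[symmetric]) simp
    then show "real ((2 * r + 1) choose k) * (1 / 2) ^ k * (1 - 1 / 2) ^ (2 * r + 1 - k)
        = real ((2 * r + 1) choose k) * (1 / 2) ^ (2 * r + 1)" by simp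
  qed
  also have "\<dots> = 2 ^ (2 * r) * (1/2) ^ (2 * r + 1)" by (simp only: sum_distrib_right[symmetric] s)
  also have "\<dots> = 1 / 2" by (simp add: power_divide)
  finally show ?thesis .
qed

text \<open>Majority voting amplifies a deviation \<open>x\<close> from one half by the square root of the number of votes: this is the
  order of the derivative of the tail at one half, and the derivative stays comparable while \<open>x\<close> is at most of order
  \<open>1 / \<surd>(2 r + 1)\<close>. The variance of the two-scale filter is of order \<open>1 / (m w)\<close> because of this.\<close>

lemma binom_tail_majority_below_half:
  assumes x: "0 \<le> x" "2 * x * sqrt (2 * real r + 1) \<le> 1"
  shows "binom_tail (2 * r + 1) (r + 1) (1 / 2 - x) \<le> 1 / 2 - x * sqrt (2 * real r + 1) / 4"
proof (cases "x = 0")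
  case True then show ?thesis using binom_tail_majority_half[of r] by simp
next
  case False
  define D where "D = (\<lambda>p. real (2 * r + 1) * real ((2 * r) choose r) * p ^ r * (1 - p) ^ r)"
  have dD: "(binom_tail (2 * r + 1) (r + 1) has_real_derivative D p) (at p)" for p
    using binom_tail_deriv[of "r + 1" "2 * r + 1" p] unfolding D_def by simp
  obtain z where z: "1 / 2 - x < z" "z < 1 / 2"
    "binom_tail (2 * r + 1) (r + 1) (1 / 2) - binom_tail (2 * r + 1) (r + 1) (1 / 2 - x)
      = (1 / 2 - (1 / 2 - x)) * D z"
    using MVT2[of "1 / 2 - x" "1 / 2" "binom_tail (2 * r + 1) (r + 1)" D] dD x False by auto
  define y where "y = 1 / 2 - z"
  have y: "0 < y" "y < x" using z by (auto simp: y_def)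
  define S where "S = sqrt (2 * real r + 1)"
  have S: "0 < S" "S\<^sup>2 = 2 * real r + 1" by (auto simp: S_def)
  have "(2 * x * S)\<^sup>2 \<le> 1" using x S by (intro power_le_one) (auto simp: S_def)
  then have "4 * x\<^sup>2 * (2 * real r + 1) \<le> 1" by (simp add: power_mult_distrib S)
  moreover have "y\<^sup>2 \<le> x\<^sup>2" using y by (intro power_mono) auto
  then have "4 * y\<^sup>2 * (2 * real r + 1) \<le> 4 * x\<^sup>2 * (2 * real r + 1)" by (intro mult_right_mono) auto
  ultimately have y2: "4 * y\<^sup>2 * (2 * real r + 1) \<le> 1" by linarith
  have "4 * y\<^sup>2 * 1 \<le> 4 * y\<^sup>2 * (2 * real r + 1)" by (intro mult_left_mono) auto
  then have y1: "4 * y\<^sup>2 \<le> 1" using y2 by linarith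
  have "1 / 2 \<le> 1 + real r * (- (4 * y\<^sup>2))"
  proof -
    have "4 * y\<^sup>2 * (2 * real r + 1) = 4 * y\<^sup>2 + 2 * (real r * (4 * y\<^sup>2))" by (simp add: algebra_simps)
    then have "2 * (real r * (4 * y\<^sup>2)) \<le> 1" using y2 zero_le_power2[of y] by linarith
    then show ?thesis by simp
  qed
  also have "\<dots> \<le> (1 + (- (4 * y\<^sup>2))) ^ r" using y1 by (intro Bernoulli_inequality) auto
  finally have h: "1 / 2 \<le> (1 - 4 * y\<^sup>2) ^ r" by simp
  have "z * (1 - z) = (1 - 4 * y\<^sup>2) / 4" by (simp add: y_def power2_eq_square field_simps)
  then have "z ^ r * (1 - z) ^ r = ((1 - 4 * y\<^sup>2) / 4) ^ r"
    by (simp only: power_mult_distrib[symmetric])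
  then have e: "z ^ r * (1 - z) ^ r = (1 - 4 * y\<^sup>2) ^ r / 4 ^ r" by (simp add: power_divide)
  have "4 ^ r \<le> real ((2 * r) choose r) * sqrt (4 * real r + 1)"
  proof (rule power2_le_imp_le)
    show "(4 ^ r)\<^sup>2 \<le> (real (2 * r choose r) * sqrt (4 * real r + 1))\<^sup>2"
      using central_binomial_sq_ge[of r]
      by (simp add: power_mult_distrib power_mult[symmetric] mult.commute[of _ 2] power_mult[of "4::real" 2])
  qed simp
  also have "\<dots> \<le> real ((2 * r) choose r) * (2 * S)"
  proof (intro mult_left_mono)
    show "sqrt (4 * real r + 1) \<le> 2 * S"
      using S by (intro real_le_lsqrt) (auto simp: power_mult_distrib)
  qed auto
  finally have c: "4 ^ r \<le> real ((2 * r) choose r) * (2 * S)" .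
  have "S * (4 ^ r) \<le> S * (real ((2 * r) choose r) * (2 * S))" using c S by (intro mult_left_mono) auto
  also have "\<dots> = 2 * real (2 * r + 1) * real ((2 * r) choose r)"
  proof -
    have "S * (real ((2 * r) choose r) * (2 * S)) = 2 * S\<^sup>2 * real ((2 * r) choose r)"
      by (simp only: power2_eq_square mult_ac)
    then show ?thesis unfolding S(2) by simp
  qed
  finally have d: "S / 2 * 4 ^ r \<le> real (2 * r + 1) * real ((2 * r) choose r)" by linarith
  have "S / 4 = (S / 2 * 4 ^ r) * ((1 / 2) / 4 ^ r)" by simp
  also have "\<dots> \<le> (real (2 * r + 1) * real ((2 * r) choose r)) * ((1 - 4 * y\<^sup>2) ^ r / 4 ^ r)"
    by (rule mult_mono[OF d divide_right_mono[OF h]]) (use y1 in auto)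
  also have "\<dots> = D z" unfolding D_def e[symmetric] by simp
  finally have "x * (S / 4) \<le> x * D z" using x by (intro mult_left_mono) auto
  then show ?thesis using z(3) binom_tail_majority_half[of r] by (simp add: S_def)
qed

text \<open>In the opposite direction, central binomial probabilities are at most of order \<open>1 / \<surd>n\<close>, so that the law of a
  sample median has a density at most of order \<open>\<surd>n\<close>.\<close>

lemma binom_tail_central_lipschitz:
  assumes s: "1 \<le> s" "s \<le> n" "n \<le> 2 * s" "2 * s \<le> n + 2" and p: "0 \<le> p" "p \<le> q" "q \<le> 1"
  shows "binom_tail n s q - binom_tail n s p \<le> 2 * sqrt (real n) * (q - p)"
proof (cases "p = q")
  case False
  define D where "D = (\<lambda>p. real n * real ((n - 1) choose (s - 1)) * p ^ (s - 1) * (1 - p) ^ (n - s))"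
  have dD: "(binom_tail n s has_real_derivative D x) (at x)" for x
    using binom_tail_deriv[of s n x] s unfolding D_def by simp
  obtain z where z: "p < z" "z < q" "binom_tail n s q - binom_tail n s p = (q - p) * D z"
    using MVT2[of p q "binom_tail n s" D] dD p False by auto
  define e where "e = min (s - 1) (n - s)"
  have z01: "0 \<le> z" "z \<le> 1" using z p by auto
  have "z ^ (s - 1) * (1 - z) ^ (n - s) \<le> z ^ e * (1 - z) ^ e"
    using z01 by (intro mult_mono power_decreasing) (auto simp: e_def)
  also have "\<dots> = (z * (1 - z)) ^ e" by (simp add: power_mult_distrib)
  also have "\<dots> \<le> (1 / 4) ^ e"
  proof (intro power_mono)
    have "0 \<le> (z - 1 / 2)\<^sup>2" by simp
    then show "z * (1 - z) \<le> 1 / 4" by (simp add: power2_eq_square algebra_simps)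
  qed (use z01 in auto)
  finally have 1: "z ^ (s - 1) * (1 - z) ^ (n - s) \<le> (1 / 4) ^ e" .
  have 2: "real ((n - 1) choose (s - 1)) * sqrt (real n) \<le> 2 ^ (n - 1)"
    using binomial_sqrt_le[of "n - 1" "s - 1"] s by (simp add: of_nat_diff)
  have "n - 1 \<le> 2 * e + 1" using s by (auto simp: e_def)
  then have "(2::real) ^ (n - 1) \<le> 2 ^ (2 * e + 1)" by (intro power_increasing) auto
  also have "\<dots> = 2 * 4 ^ e" by (simp add: power_mult)
  finally have 3: "(2::real) ^ (n - 1) \<le> 2 * 4 ^ e" .
  have "D z = sqrt (real n) * ((real ((n - 1) choose (s - 1)) * sqrt (real n)) * (z ^ (s - 1) * (1 - z) ^ (n - s)))"
  proof -
    have "D z = (sqrt (real n) * sqrt (real n)) * real ((n - 1) choose (s - 1)) * z ^ (s - 1) * (1 - z) ^ (n - s)"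
      unfolding D_def by simp
    then show ?thesis by (simp only: mult_ac)
  qed
  also have "\<dots> \<le> sqrt (real n) * ((2 * 4 ^ e) * (1 / 4) ^ e)"
    by (rule mult_left_mono[OF mult_mono[OF order_trans[OF 2 3] 1]]) (use z01 in auto)
  also have "\<dots> = 2 * sqrt (real n)" by (simp add: power_divide)
  finally have "D z * (q - p) \<le> 2 * sqrt (real n) * (q - p)" using p by (intro mult_right_mono) auto
  then show ?thesis using z(3) by (simp only: mult.commute[of "q - p"])
qed simp

text \<open>For \<open>k \<ge> n / 2\<close> and \<open>p \<le> 1 - p\<close>, the factor \<open>p\<^sup>k (1 - p)\<^sup>n\<^sup>-\<^sup>k\<close> is largest at \<open>k = n / 2\<close>.\<close>

lemma binom_tail_chernoff:
  assumes p: "0 \<le> p" "p \<le> 1 / 2" and s: "n \<le> 2 * s"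
  shows "binom_tail n s p \<le> sqrt ((4 * p * (1 - p)) ^ n)"
proof -
  have t: "p ^ k * (1 - p) ^ (n - k) \<le> sqrt ((p * (1 - p)) ^ n)" if k: "k \<in> {s..n}" for k
  proof (rule real_le_rsqrt)
    have e: "2 * k = n + (2 * k - n)" "n = (2 * (n - k)) + (2 * k - n)" using k s by auto
    have "(p ^ k * (1 - p) ^ (n - k))\<^sup>2 = p ^ (2 * k) * (1 - p) ^ (2 * (n - k))"
      by (simp add: power_mult_distrib power_mult[symmetric] mult.commute)
    also have "\<dots> = p ^ n * (p ^ (2 * k - n) * (1 - p) ^ (2 * (n - k)))"
      by (subst e(1)) (simp add: power_add)
    also have "\<dots> \<le> p ^ n * ((1 - p) ^ (2 * k - n) * (1 - p) ^ (2 * (n - k)))"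
      using p by (intro mult_left_mono mult_right_mono power_mono) auto
    also have "\<dots> = p ^ n * (1 - p) ^ n"
      by (subst (4) e(2)) (simp add: power_add)
    finally show "(p ^ k * (1 - p) ^ (n - k))\<^sup>2 \<le> (p * (1 - p)) ^ n" by (simp add: power_mult_distrib)
  qed
  have "binom_tail n s p \<le> (\<Sum>k=s..n. real (n choose k) * sqrt ((p * (1 - p)) ^ n))"
    unfolding binom_tail_def using t by (intro sum_mono) (auto simp: mult.assoc intro!: mult_left_mono)
  also have "\<dots> \<le> (\<Sum>k\<le>n. real (n choose k) * sqrt ((p * (1 - p)) ^ n))"
    using p by (intro sum_mono2) auto
  also have "\<dots> = real (\<Sum>k\<le>n. n choose k) * sqrt ((p * (1 - p)) ^ n)" by (simp add: sum_distrib_right)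
  also have "\<dots> = 2 ^ n * sqrt ((p * (1 - p)) ^ n)" by (simp only: choose_row_sum) simp
  also have "\<dots> = sqrt (4 ^ n) * sqrt ((p * (1 - p)) ^ n)"
    by (simp add: real_sqrt_power)
  also have "\<dots> = sqrt ((4 * p * (1 - p)) ^ n)"
    by (simp add: real_sqrt_mult[symmetric] power_mult_distrib[symmetric] mult_ac)
  finally show ?thesis .
qed

section \<open>Counting independent events\<close>

context prob_space
begin

lemma prob_pattern:
  fixes X :: "'i \<Rightarrow> 'a \<Rightarrow> real"
  assumes ind: "indep_vars (\<lambda>_. borel) X I" and fin: "finite I" and B: "B \<in> sets borel"
    and p: "\<And>i. i \<in> I \<Longrightarrow> prob {\<omega> \<in> space M. X i \<omega> \<in> B} = p" and S: "S \<subseteq> I"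
  shows "{\<omega> \<in> space M. {i \<in> I. X i \<omega> \<in> B} = S} \<in> events"
    and "prob {\<omega> \<in> space M. {i \<in> I. X i \<omega> \<in> B} = S} = p ^ card S * (1 - p) ^ (card I - card S)"
proof -
  have rv [measurable]: "X i \<in> borel_measurable M" if "i \<in> I" for i
    using ind that by (auto simp: indep_vars_def)
  define A where "A = (\<lambda>i. if i \<in> S then B else - B)"
  have A: "A i \<in> sets borel" for i using B by (auto simp: A_def)
  have e: "{\<omega> \<in> space M. {i \<in> I. X i \<omega> \<in> B} = S} = (\<Inter>i\<in>I. X i -` A i \<inter> space M)" if "I \<noteq> {}"
    using S that by (auto simp: A_def split: if_splits)
  have pa: "prob (X i -` A i \<inter> space M) = (if i \<in> S then p else 1 - p)" if i: "i \<in> I" for i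
  proof -
    have s: "X i -` B \<inter> space M = {\<omega> \<in> space M. X i \<omega> \<in> B}"
      "X i -` (- B) \<inter> space M = space M - {\<omega> \<in> space M. X i \<omega> \<in> B}" by auto
    have "{\<omega> \<in> space M. X i \<omega> \<in> B} \<in> events" using rv[OF i] B by measurable
    then show ?thesis using p[OF i] by (auto simp: A_def s prob_compl)
  qed
  show "{\<omega> \<in> space M. {i \<in> I. X i \<omega> \<in> B} = S} \<in> events"
  proof (cases "I = {}")
    case True then show ?thesis using S by simp
  next
    case False
    then show ?thesis unfolding e[OF False] using fin A by (intro sets.finite_INT) (auto intro: measurable_sets)
  qed
  show "prob {\<omega> \<in> space M. {i \<in> I. X i \<omega> \<in> B} = S} = p ^ card S * (1 - p) ^ (card I - card S)"
  proof (cases "I = {}")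
    case True then show ?thesis using S by (simp add: prob_space)
  next
    case False
    have "prob (\<Inter>i\<in>I. X i -` A i \<inter> space M) = (\<Prod>i\<in>I. prob (X i -` A i \<inter> space M))"
      using ind False fin A by (intro indep_varsD_finite) auto
    also have "\<dots> = (\<Prod>i\<in>I. if i \<in> S then p else 1 - p)" using pa by (intro prod.cong) auto
    also have "\<dots> = p ^ card (I \<inter> S) * (1 - p) ^ card (I \<inter> - S)" by (simp add: prod.If_cases[OF fin])
    also have "I \<inter> S = S" using S by auto
    also have "card (I \<inter> - S) = card I - card S"
      using S fin by (simp add: Diff_eq[symmetric] card_Diff_subset finite_subset)
    finally show ?thesis using e[OF False] by simp
  qed
qed

lemma prob_count_eq:
  fixes X :: "'i \<Rightarrow> 'a \<Rightarrow> real"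
  assumes ind: "indep_vars (\<lambda>_. borel) X I" and fin: "finite I" and B: "B \<in> sets borel"
    and p: "\<And>i. i \<in> I \<Longrightarrow> prob {\<omega> \<in> space M. X i \<omega> \<in> B} = p"
  shows "{\<omega> \<in> space M. card {i \<in> I. X i \<omega> \<in> B} = k} \<in> events"
    and "prob {\<omega> \<in> space M. card {i \<in> I. X i \<omega> \<in> B} = k} = real (card I choose k) * p ^ k * (1 - p) ^ (card I - k)"
proof -
  define E where "E = (\<lambda>S. {\<omega> \<in> space M. {i \<in> I. X i \<omega> \<in> B} = S})"
  define \<S> where "\<S> = {S. S \<subseteq> I \<and> card S = k}"
  have fS: "finite \<S>" unfolding \<S>_def using fin by simp
  have E: "E S \<in> events" "prob (E S) = p ^ k * (1 - p) ^ (card I - k)" if "S \<in> \<S>" for S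
  proof -
    have S: "S \<subseteq> I" "card S = k" using that by (auto simp: \<S>_def)
    show "E S \<in> events" "prob (E S) = p ^ k * (1 - p) ^ (card I - k)"
      using prob_pattern[OF ind fin B p S(1)] unfolding E_def S(2) by blast+
  qed
  have eq: "{\<omega> \<in> space M. card {i \<in> I. X i \<omega> \<in> B} = k} = (\<Union>S\<in>\<S>. E S)"
    by (auto simp: E_def \<S>_def)
  show "{\<omega> \<in> space M. card {i \<in> I. X i \<omega> \<in> B} = k} \<in> events"
    unfolding eq using fS E by (intro sets.finite_UN) auto
  have "prob (\<Union>S\<in>\<S>. E S) = (\<Sum>S\<in>\<S>. prob (E S))"
    using fS E by (intro finite_measure_finite_Union) (auto simp: disjoint_family_on_def E_def)
  also have "\<dots> = real (card \<S>) * (p ^ k * (1 - p) ^ (card I - k))" using E by simp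
  also have "card \<S> = card I choose k" unfolding \<S>_def using fin by (rule n_subsets)
  finally show "prob {\<omega> \<in> space M. card {i \<in> I. X i \<omega> \<in> B} = k} = real (card I choose k) * p ^ k * (1 - p) ^ (card I - k)"
    unfolding eq by (simp only: mult.assoc)
qed

lemma prob_count_ge:
  fixes X :: "'i \<Rightarrow> 'a \<Rightarrow> real"
  assumes ind: "indep_vars (\<lambda>_. borel) X I" and fin: "finite I" and B: "B \<in> sets borel"
    and p: "\<And>i. i \<in> I \<Longrightarrow> prob {\<omega> \<in> space M. X i \<omega> \<in> B} = p"
  shows "{\<omega> \<in> space M. s \<le> card {i \<in> I. X i \<omega> \<in> B}} \<in> events"
    and "prob {\<omega> \<in> space M. s \<le> card {i \<in> I. X i \<omega> \<in> B}} = binom_tail (card I) s p"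
proof -
  define E where "E = (\<lambda>k. {\<omega> \<in> space M. card {i \<in> I. X i \<omega> \<in> B} = k})"
  have E: "E k \<in> events" "prob (E k) = real (card I choose k) * p ^ k * (1 - p) ^ (card I - k)" for k
    using prob_count_eq[OF ind fin B p, of k] unfolding E_def by blast+
  have "card {i \<in> I. X i \<omega> \<in> B} \<le> card I" for \<omega> using fin by (intro card_mono) auto
  then have eq: "{\<omega> \<in> space M. s \<le> card {i \<in> I. X i \<omega> \<in> B}} = (\<Union>k\<in>{s..card I}. E k)"
    by (auto simp: E_def)
  show "{\<omega> \<in> space M. s \<le> card {i \<in> I. X i \<omega> \<in> B}} \<in> events"
    unfolding eq using E by (intro sets.finite_UN) auto
  have "prob (\<Union>k\<in>{s..card I}. E k) = (\<Sum>k\<in>{s..card I}. prob (E k))"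
    using E by (intro finite_measure_finite_Union) (auto simp: disjoint_family_on_def E_def)
  then show "prob {\<omega> \<in> space M. s \<le> card {i \<in> I. X i \<omega> \<in> B}} = binom_tail (card I) s p"
    unfolding eq binom_tail_def E(2) .
qed

lemma prob_Median_gt:
  fixes X :: "'i \<Rightarrow> 'a \<Rightarrow> real"
  assumes ind: "indep_vars (\<lambda>_. borel) X I" and c: "card I = 2 * r + 1"
    and p: "\<And>i. i \<in> I \<Longrightarrow> prob {\<omega> \<in> space M. t < X i \<omega>} = p"
  shows "prob {\<omega> \<in> space M. t < Median I (\<lambda>i. X i \<omega>)} = binom_tail (2 * r + 1) (r + 1) p"
proof -
  have fin: "finite I" using c by (intro card_ge_0_finite) simp
  have "{\<omega> \<in> space M. t < Median I (\<lambda>i. X i \<omega>)} = {\<omega> \<in> space M. r + 1 \<le> card {i \<in> I. X i \<omega> \<in> {t<..}}}"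
    using less_Median_iff_odd[OF fin] c by auto
  then show ?thesis using prob_count_ge(2)[OF ind fin, of "{t<..}" p "r + 1"] p c by simp
qed

lemma prob_Median_less:
  fixes X :: "'i \<Rightarrow> 'a \<Rightarrow> real"
  assumes ind: "indep_vars (\<lambda>_. borel) X I" and c: "card I = 2 * r + 1"
    and p: "\<And>i. i \<in> I \<Longrightarrow> prob {\<omega> \<in> space M. X i \<omega> < t} = p"
  shows "prob {\<omega> \<in> space M. Median I (\<lambda>i. X i \<omega>) < t} = binom_tail (2 * r + 1) (r + 1) p"
proof -
  have fin: "finite I" "I \<noteq> {}" using c by (auto intro: card_ge_0_finite)
  have "indep_vars (\<lambda>_. borel) (\<lambda>i \<omega>. - X i \<omega>) I"
    by (rule indep_vars_compose2[OF ind]) auto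
  then have "prob {\<omega> \<in> space M. - t < Median I (\<lambda>i. - X i \<omega>)} = binom_tail (2 * r + 1) (r + 1) p"
    using p by (intro prob_Median_gt c) auto
  then show ?thesis using fin by (simp add: Median_uminus)
qed

text \<open>The square of \<open>Y\<close> is at most the sum of the odd numbers \<open>2 k + 1\<close> over all natural numbers \<open>k < Y\<close>, which
  replaces the integration of the tail by a series.\<close>

lemma second_moment_of_cubic_tail:
  assumes [measurable]: "Y \<in> borel_measurable M" and nn: "\<And>\<omega>. \<omega> \<in> space M \<Longrightarrow> 0 \<le> Y \<omega>"
    and t: "\<And>k::nat. prob {\<omega> \<in> space M. real k < Y \<omega>} \<le> 2 / (1 + real k) ^ 3"
  shows "(\<integral>\<^sup>+\<omega>. ennreal ((Y \<omega>)\<^sup>2) \<partial>M) \<le> 11"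
proof -
  define A where "A = (\<lambda>k::nat. {\<omega> \<in> space M. real k < Y \<omega>})"
  have [measurable]: "A k \<in> events" for k unfolding A_def by measurable
  have pw: "ennreal ((Y \<omega>)\<^sup>2) \<le> (\<Sum>k. ennreal (2 * real k + 1) * indicator (A k) \<omega>)"
    if w: "\<omega> \<in> space M" for \<omega>
  proof -
    define K where "K = nat \<lceil>Y \<omega>\<rceil>"
    have sq: "(\<Sum>k<K. 2 * real k + 1) = (real K)\<^sup>2" for K :: nat
      by (induction K) (auto simp: power2_eq_square algebra_simps)
    have "Y \<omega> \<le> real K" unfolding K_def by linarith
    then have "(Y \<omega>)\<^sup>2 \<le> (real K)\<^sup>2" using nn[OF w] by (intro power_mono) auto
    then have "ennreal ((Y \<omega>)\<^sup>2) \<le> ennreal (\<Sum>k<K. 2 * real k + 1)" unfolding sq by (intro ennreal_leI)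
    also have "\<dots> = (\<Sum>k<K. ennreal (2 * real k + 1))" by (subst sum_ennreal) auto
    also have "\<dots> = (\<Sum>k<K. ennreal (2 * real k + 1) * indicator (A k) \<omega>)"
    proof (intro sum.cong refl)
      fix k assume "k \<in> {..<K}"
      then have "real k < Y \<omega>" using nn[OF w] unfolding K_def lessThan_iff by linarith
      then show "ennreal (2 * real k + 1) = ennreal (2 * real k + 1) * indicator (A k) \<omega>"
        using w by (simp add: A_def)
    qed
    also have "\<dots> \<le> (\<Sum>k. ennreal (2 * real k + 1) * indicator (A k) \<omega>)"
      by (intro sum_le_suminf) auto
    finally show ?thesis .
  qed
  have s: "(\<lambda>n. 4 * (1 / (real n + 1)\<^sup>2)) sums (4 * (pi\<^sup>2 / 6))"
    using inverse_squares_sums by (intro sums_mult) (simp add: add.commute)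
  have "(\<integral>\<^sup>+\<omega>. ennreal ((Y \<omega>)\<^sup>2) \<partial>M) \<le> (\<integral>\<^sup>+\<omega>. (\<Sum>k. ennreal (2 * real k + 1) * indicator (A k) \<omega>) \<partial>M)"
    using pw by (intro nn_integral_mono)
  also have "\<dots> = (\<Sum>k. ennreal (2 * real k + 1) * emeasure M (A k))"
    by (subst nn_integral_suminf) (auto simp: nn_integral_cmult_indicator)
  also have "\<dots> \<le> (\<Sum>k. ennreal (4 * (1 / (real k + 1)\<^sup>2)))"
  proof (intro suminf_le)
    fix k :: nat
    have "(2 * real k + 1) * prob (A k) \<le> (2 * (real k + 1)) * (2 / (1 + real k) ^ 3)"
      using t[of k] by (intro mult_mono) (auto simp: A_def)
    also have "\<dots> = 4 * (1 / (real k + 1)\<^sup>2)"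
      by (simp add: power2_eq_square power3_eq_cube divide_simps) (simp add: algebra_simps)
    finally show "ennreal (2 * real k + 1) * emeasure M (A k) \<le> ennreal (4 * (1 / (real k + 1)\<^sup>2))"
      unfolding emeasure_eq_measure by (subst ennreal_mult'[symmetric]) (auto intro: ennreal_leI)
  qed auto
  also have "\<dots> = ennreal (4 * (pi\<^sup>2 / 6))" using s by (intro suminf_ennreal_eq) auto
  also have "\<dots> \<le> ennreal 11"
  proof (intro ennreal_leI)
    have "pi\<^sup>2 \<le> 4\<^sup>2" using pi_less_4 pi_gt_zero by (intro power_mono) auto
    then show "4 * (pi\<^sup>2 / 6) \<le> 11" by simp
  qed
  finally show ?thesis by simp
qed

end

section \<open>Tails of medians\<close>

lemma nat_floor_bounds: "1 \<le> x \<Longrightarrow> real (nat \<lfloor>x\<rfloor>) \<le> x" "1 \<le> x \<Longrightarrow> x / 2 \<le> real (nat \<lfloor>x\<rfloor>)"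
proof -
  assume x: "1 \<le> x"
  show "real (nat \<lfloor>x\<rfloor>) \<le> x" using x by linarith
  have "1 \<le> \<lfloor>x\<rfloor>" using x by (simp add: le_floor_iff)
  then have "1 \<le> real (nat \<lfloor>x\<rfloor>)" by simp
  then show "x / 2 \<le> real (nat \<lfloor>x\<rfloor>)" by linarith
qed

text \<open>Tail functions \<open>p u\<close> of symmetric observations, with explicit constants because block medians must satisfy the
  condition uniformly in the size of the blocks.\<close>

definition half_tail :: "real \<Rightarrow> real \<Rightarrow> real \<Rightarrow> real \<Rightarrow> (real \<Rightarrow> real) \<Rightarrow> bool" where
  "half_tail c u\<^sub>0 C a p \<longleftrightarrow> (\<forall>u\<ge>0. 0 \<le> p u) \<and> (\<forall>u v. 0 \<le> u \<longrightarrow> u \<le> v \<longrightarrow> p v \<le> p u) \<and>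
     (\<forall>u. 0 \<le> u \<longrightarrow> u \<le> u\<^sub>0 \<longrightarrow> p u \<le> 1 / 2 - c * u) \<and> (\<forall>u>0. p u \<le> C * u powr - a)"

text \<open>The square root of \<open>4 p (1 - p)\<close> is the base of the Chernoff bound for a majority of observations beyond \<open>u\<close>.\<close>

definition polynomial_profile :: "real \<Rightarrow> real \<Rightarrow> (real \<Rightarrow> real) \<Rightarrow> bool" where
  "polynomial_profile \<kappa> \<mu> p \<longleftrightarrow>
     (\<forall>u\<ge>0. 0 \<le> p u \<and> p u \<le> 1 / 2 \<and> 4 * p u * (1 - p u) \<le> (1 + \<kappa> * u\<^sup>2) powr - \<mu>)"

text \<open>Near zero both sides of the profile inequality are \<open>1 - O(u\<^sup>2)\<close>, and far out both are powers of \<open>u\<close>. On the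
  bounded range in between, \<open>p\<close> stays away from one half by monotonicity, and a small \<open>\<kappa>\<close> makes the right-hand side
  nearly one.\<close>

lemma half_tail_imp_profile:
  assumes pos: "0 < c" "0 < u\<^sub>0" "0 < C" "0 < a"
  shows "\<exists>\<kappa> \<mu>. 0 < \<kappa> \<and> 0 < \<mu> \<and> (\<forall>p. half_tail c u\<^sub>0 C a p \<longrightarrow> polynomial_profile \<kappa> \<mu> p)"
proof -
  define \<mu> where "\<mu> = a / 4"
  define t where "t = max 1 ((4 * C * 2 powr \<mu>) powr (2 / a))"
\<comment> \<open>The three bounds on \<open>\<kappa>\<close> are for large, small and intermediate \<open>u\<close>; \<open>t\<close> is where the power law takes over.\<close>
  define \<kappa> where "\<kappa> = min 1 (min (4 * c\<^sup>2 / \<mu>) (4 * c\<^sup>2 * u\<^sub>0\<^sup>2 / (\<mu> * t\<^sup>2)))"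
  have l: "0 < \<mu>" and t1: "1 \<le> t" using pos by (auto simp: \<mu>_def t_def)
  have k: "0 < \<kappa>" "\<kappa> \<le> 1" using pos l t1 by (auto simp: \<kappa>_def)
  have k1: "\<mu> * \<kappa> \<le> 4 * c\<^sup>2"
  proof -
    have "\<kappa> \<le> 4 * c\<^sup>2 / \<mu>" by (simp add: \<kappa>_def)
    then show ?thesis using l by (simp add: field_simps)
  qed
  have k2: "\<mu> * (\<kappa> * t\<^sup>2) \<le> 4 * (c * u\<^sub>0)\<^sup>2"
  proof -
    have "\<kappa> \<le> 4 * c\<^sup>2 * u\<^sub>0\<^sup>2 / (\<mu> * t\<^sup>2)" by (simp add: \<kappa>_def)
    then show ?thesis using l t1 by (simp add: field_simps power_mult_distrib)
  qed
  have near: "1 - 4 * x\<^sup>2 \<le> (1 + \<kappa> * u\<^sup>2) powr - \<mu>" if "\<mu> * (\<kappa> * u\<^sup>2) \<le> 4 * x\<^sup>2" for x u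
  proof -
    have "1 - 4 * x\<^sup>2 \<le> exp (- (4 * x\<^sup>2))" using exp_ge_add_one_self[of "- (4 * x\<^sup>2)"] by simp
    also have "\<dots> \<le> exp (- (\<mu> * (\<kappa> * u\<^sup>2)))" using that by simp
    also have "\<dots> \<le> exp (- \<mu> * ln (1 + \<kappa> * u\<^sup>2))"
    proof -
      have "ln (1 + \<kappa> * u\<^sup>2) \<le> \<kappa> * u\<^sup>2" using k by (intro ln_add_one_self_le_self) auto
      then have "\<mu> * ln (1 + \<kappa> * u\<^sup>2) \<le> \<mu> * (\<kappa> * u\<^sup>2)" using l by (intro mult_left_mono) auto
      then show ?thesis by simp
    qed
    also have "\<dots> = (1 + \<kappa> * u\<^sup>2) powr - \<mu>"
    proof -
      have "0 < 1 + \<kappa> * u\<^sup>2" using k by (intro add_pos_nonneg) auto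
      then show ?thesis by (simp add: powr_def)
    qed
    finally show ?thesis .
  qed
  have quad: "4 * q * (1 - q) \<le> 1 - 4 * x\<^sup>2" if "q \<le> 1 / 2 - x" "0 \<le> x" for q x :: real
  proof -
    have "x\<^sup>2 \<le> (1 / 2 - q)\<^sup>2" using that by (intro power_mono) auto
    then show ?thesis by (simp add: power2_eq_square algebra_simps)
  qed
  show ?thesis
  proof (intro exI conjI allI impI)
    fix p assume "half_tail c u\<^sub>0 C a p"
    then have p0: "\<And>u. 0 \<le> u \<Longrightarrow> 0 \<le> p u" and pm: "\<And>u v. 0 \<le> u \<Longrightarrow> u \<le> v \<Longrightarrow> p v \<le> p u"
      and p1: "\<And>u. 0 \<le> u \<Longrightarrow> u \<le> u\<^sub>0 \<Longrightarrow> p u \<le> 1 / 2 - c * u"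
      and p2: "\<And>u. 0 < u \<Longrightarrow> p u \<le> C * u powr - a" by (auto simp: half_tail_def)
    show "polynomial_profile \<kappa> \<mu> p"
      unfolding polynomial_profile_def
    proof (intro allI impI conjI p0)
      fix u :: real assume u: "0 \<le> u"
      show "p u \<le> 1 / 2" using pm[of 0 u] p1[of 0] u pos by simp
      consider "u \<le> u\<^sub>0" | "u\<^sub>0 \<le> u" "u \<le> t" | "u\<^sub>0 \<le> u" "t \<le> u" by linarith
      then show "4 * p u * (1 - p u) \<le> (1 + \<kappa> * u\<^sup>2) powr - \<mu>"
      proof cases
        case 1
        have "4 * p u * (1 - p u) \<le> 1 - 4 * (c * u)\<^sup>2" using p1[OF u 1] u pos by (intro quad) auto
        also have "\<dots> \<le> (1 + \<kappa> * u\<^sup>2) powr - \<mu>"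
          using mult_right_mono[OF k1, of "u\<^sup>2"] by (intro near) (simp add: power_mult_distrib mult.assoc)
        finally show ?thesis .
      next
        case 2
        have "p u \<le> 1 / 2 - c * u\<^sub>0" using pm[of u\<^sub>0 u] p1[of u\<^sub>0] 2 pos by force
        then have "4 * p u * (1 - p u) \<le> 1 - 4 * (c * u\<^sub>0)\<^sup>2" using pos by (intro quad) auto
        also have "\<dots> \<le> (1 + \<kappa> * u\<^sup>2) powr - \<mu>"
        proof (intro near)
          have "\<mu> * (\<kappa> * u\<^sup>2) \<le> \<mu> * (\<kappa> * t\<^sup>2)" using l k u 2 by (intro mult_left_mono power_mono) auto
          then show "\<mu> * (\<kappa> * u\<^sup>2) \<le> 4 * (c * u\<^sub>0)\<^sup>2" using k2 by linarith
        qed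
        finally show ?thesis .
      next
        case 3
        have u1: "1 \<le> u" using 3 t1 by linarith
        have "4 * C * 2 powr \<mu> = ((4 * C * 2 powr \<mu>) powr (2 / a)) powr (a / 2)"
          using pos by (simp add: powr_powr)
        also have "\<dots> \<le> u powr (a / 2)" using 3 pos by (intro powr_mono2) (auto simp: t_def)
        finally have g: "4 * C * 2 powr \<mu> \<le> u powr (a / 2)" .
        have "(1 + \<kappa> * u\<^sup>2) powr \<mu> \<le> (2 * u\<^sup>2) powr \<mu>"
        proof (intro powr_mono2)
          have "\<kappa> * u\<^sup>2 \<le> 1 * u\<^sup>2" using k by (intro mult_right_mono) auto
          moreover have "1 \<le> u\<^sup>2" using u1 by simp
          ultimately show "1 + \<kappa> * u\<^sup>2 \<le> 2 * u\<^sup>2" by linarith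
        qed (use k l in auto)
        also have "\<dots> = 2 powr \<mu> * u powr (a / 2)"
          using u1 by (simp add: powr_mult \<mu>_def powr_powr flip: powr_numeral)
        finally have h: "(1 + \<kappa> * u\<^sup>2) powr \<mu> \<le> 2 powr \<mu> * u powr (a / 2)" .
        have w: "0 < 1 + \<kappa> * u\<^sup>2" using k by (intro add_pos_nonneg) auto
        have "4 * p u * (1 - p u) \<le> 4 * p u * 1" using p0[OF u] by (intro mult_left_mono) auto
        also have "\<dots> \<le> 4 * C * u powr - a" using p2[of u] u1 by simp
        also have "\<dots> \<le> (1 + \<kappa> * u\<^sup>2) powr - \<mu>"
        proof -
          have "(4 * C * u powr - a) * (1 + \<kappa> * u\<^sup>2) powr \<mu> \<le> (4 * C * u powr - a) * (2 powr \<mu> * u powr (a / 2))"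
            using h pos by (intro mult_left_mono) auto
          also have "\<dots> = (4 * C * 2 powr \<mu>) * (u powr - a * u powr (a / 2))" by simp
          also have "\<dots> \<le> u powr (a / 2) * (u powr - a * u powr (a / 2))" using g by (intro mult_right_mono) auto
          also have "\<dots> = 1" using u1 by (simp add: powr_add[symmetric])
          finally show ?thesis using w by (simp add: powr_minus field_simps)
        qed
        finally show ?thesis .
      qed
    qed
  qed (use k l in auto)
qed

text \<open>Taking the median of \<open>m\<close> observations raises the profile to the power \<open>m / 2\<close>. Split into \<open>j\<close> equal powers, it is
  bounded by Bernoulli's inequality, so that every polynomial rate of decay is available at the scale \<open>1 / \<surd>m\<close>.\<close>

lemma binom_tail_profile_power:
  assumes P: "polynomial_profile \<kappa> \<mu> p" "0 < \<kappa>" "0 < \<mu>" and u: "0 \<le> u" and b: "2 * j * b \<le> \<mu> * real m"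
    and s: "m \<le> 2 * s"
  shows "binom_tail m s (p u) \<le> 1 / (1 + real b * \<kappa> * u\<^sup>2) ^ j"
proof -
  define w where "w = 1 + \<kappa> * u\<^sup>2"
  have w: "1 \<le> w" using P by (auto simp: w_def)
  have q: "0 \<le> p u" "p u \<le> 1 / 2" "4 * p u * (1 - p u) \<le> w powr - \<mu>"
    using P u by (auto simp: polynomial_profile_def w_def)
  have q0: "0 \<le> 4 * p u * (1 - p u)" using q by auto
  have "binom_tail m s (p u) \<le> sqrt ((4 * p u * (1 - p u)) ^ m)"
    using q s by (intro binom_tail_chernoff) auto
  also have "\<dots> \<le> sqrt ((w powr - \<mu>) ^ m)" using q q0 by (intro real_sqrt_le_mono power_mono) auto
  also have "\<dots> = w powr (- (\<mu> * real m / 2))"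
    using w by (simp add: powr_half_sqrt[symmetric] powr_powr powr_realpow[symmetric])
  also have "\<dots> \<le> w powr (- (real (b * j)))" using w b by (intro powr_mono) (auto simp: mult_ac)
  also have "\<dots> = 1 / (w ^ b) ^ j" 
    using w by (subst powr_minus_divide, subst powr_realpow) (auto simp: power_mult)
  also have "\<dots> \<le> 1 / (1 + real b * \<kappa> * u\<^sup>2) ^ j"
  proof (intro divide_left_mono power_mono)
    show "1 + real b * \<kappa> * u\<^sup>2 \<le> w ^ b"
    proof -
      have "0 \<le> \<kappa> * u\<^sup>2" using P by simp
      then have "- 1 \<le> \<kappa> * u\<^sup>2" by linarith
      then show ?thesis using Bernoulli_inequality[of "\<kappa> * u\<^sup>2" b] unfolding w_def by (simp add: mult.assoc)
    qed
    have "0 < 1 + real b * \<kappa> * u\<^sup>2" using P by (intro add_pos_nonneg) auto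
    then show "0 < (w ^ b) ^ j * (1 + real b * \<kappa> * u\<^sup>2) ^ j" using w by auto
    show "0 \<le> 1 + real b * \<kappa> * u\<^sup>2" using P by (intro add_nonneg_nonneg) auto
  qed auto
  finally show ?thesis .
qed

text \<open>The recursion from pixels to blocks: the constants of the conclusion do not involve \<open>m\<close>.\<close>

lemma half_tail_scaled_median:
  assumes P: "polynomial_profile \<kappa> \<mu> p" "0 < \<kappa>" "0 < \<mu>" and H: "half_tail c u\<^sub>0 C a p" "0 < c"
    and m: "m = 2 * r + 1" "2 \<le> \<mu> * real m"
  shows "half_tail (c / 4) (min u\<^sub>0 (1 / (2 * c))) (4 / (\<mu> * \<kappa>)) 2 (\<lambda>u. binom_tail m (r + 1) (p (u / sqrt (real m))))"
  unfolding half_tail_def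
proof (intro conjI allI impI)
  have p0: "\<And>u. 0 \<le> u \<Longrightarrow> 0 \<le> p u" and pm: "\<And>u v. 0 \<le> u \<Longrightarrow> u \<le> v \<Longrightarrow> p v \<le> p u"
    and p1: "\<And>u. 0 \<le> u \<Longrightarrow> u \<le> u\<^sub>0 \<Longrightarrow> p u \<le> 1 / 2 - c * u" using H by (auto simp: half_tail_def)
  have ph: "p u \<le> 1 / 2" if "0 \<le> u" for u using P that by (auto simp: polynomial_profile_def)
  have m1: "1 \<le> sqrt (real m)" "0 < real m" using m by auto
  { fix u :: real assume u: "0 \<le> u"
    then have v: "0 \<le> u / sqrt (real m)" by simp
    have "0 \<le> p (u / sqrt (real m))" "p (u / sqrt (real m)) \<le> 1 / 2" using p0[OF v] ph[OF v] .
    then show "0 \<le> binom_tail m (r + 1) (p (u / sqrt (real m)))"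
      unfolding binom_tail_def by (auto intro!: sum_nonneg mult_nonneg_nonneg) }
  { fix u v :: real assume u: "0 \<le> u" "u \<le> v"
    show "binom_tail m (r + 1) (p (v / sqrt (real m))) \<le> binom_tail m (r + 1) (p (u / sqrt (real m)))"
    proof (rule binom_tail_mono)
      show "p (v / sqrt (real m)) \<le> p (u / sqrt (real m))" using u by (intro pm divide_right_mono) auto
      show "0 \<le> p (v / sqrt (real m))" using u by (intro p0) auto
      show "p (u / sqrt (real m)) \<le> 1" using ph[of "u / sqrt (real m)"] u by auto
    qed (use m in auto) }
  { fix u :: real assume u: "0 \<le> u" "u \<le> min u\<^sub>0 (1 / (2 * c))"
    define x where "x = c * (u / sqrt (real m))"
    have x: "0 \<le> x" "2 * x * sqrt (real m) \<le> 1"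
      using u H m1 by (auto simp: x_def field_simps)
    have "u / sqrt (real m) \<le> u / 1" using u m1 by (intro divide_left_mono) auto
    then have "p (u / sqrt (real m)) \<le> 1 / 2 - x" unfolding x_def using u by (intro p1) auto
    then have "binom_tail m (r + 1) (p (u / sqrt (real m))) \<le> binom_tail m (r + 1) (1 / 2 - x)"
      using u x m by (intro binom_tail_mono p0) auto
    also have "\<dots> \<le> 1 / 2 - x * sqrt (real m) / 4"
    proof -
      have "2 * real r + 1 = real m" by (simp add: m)
      then show ?thesis using binom_tail_majority_below_half[of x r] x by (simp only: m(1))
    qed
    also have "x * sqrt (real m) = c * u" using m1 by (simp add: x_def)
    finally show "binom_tail m (r + 1) (p (u / sqrt (real m))) \<le> 1 / 2 - c / 4 * u" by simp }
  { fix u :: real assume u: "0 < u"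
    define b where "b = nat \<lfloor>\<mu> * real m / 2\<rfloor>"
    have b: "real b \<le> \<mu> * real m / 2" "\<mu> * real m / 4 \<le> real b"
      using nat_floor_bounds[of "\<mu> * real m / 2"] m unfolding b_def by auto
    have "binom_tail m (r + 1) (p (u / sqrt (real m))) \<le> 1 / (1 + real b * \<kappa> * (u / sqrt (real m))\<^sup>2) ^ 1"
      by (rule binom_tail_profile_power[OF P]) (use u b m in auto)
    also have "\<dots> \<le> 1 / (\<mu> * \<kappa> * u\<^sup>2 / 4)"
    proof -
      have "\<mu> * \<kappa> * u\<^sup>2 / 4 = (\<mu> * real m / 4) * (\<kappa> * (u / sqrt (real m))\<^sup>2)"
        using m1 by (simp add: power_divide)
      also have "\<dots> \<le> real b * (\<kappa> * (u / sqrt (real m))\<^sup>2)" using b P by (intro mult_right_mono) auto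
      finally have "\<mu> * \<kappa> * u\<^sup>2 / 4 \<le> 1 + real b * \<kappa> * (u / sqrt (real m))\<^sup>2" by (simp add: mult.assoc)
      moreover have "0 < \<mu> * \<kappa> * u\<^sup>2 / 4" using P u by auto
      ultimately show ?thesis unfolding power_one_right by (intro divide_left_mono mult_pos_pos) linarith+
    qed
    also have "\<dots> = 4 / (\<mu> * \<kappa>) * u powr - 2" using u by (simp add: powr_minus field_simps)
    finally show "binom_tail m (r + 1) (p (u / sqrt (real m))) \<le> 4 / (\<mu> * \<kappa>) * u powr - 2" . }
qed

text \<open>The quantity \<open>Y = b \<kappa> Z\<^sup>2\<close>, with \<open>b\<close> of order \<open>\<mu> M\<close> for the sample size \<open>M\<close>, has a cubic tail.
  The constant is \<open>1584 = 11 \<cdot> 12\<^sup>2\<close>, where \<open>12\<close> comes from rounding \<open>b\<close> down.\<close>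

lemma (in prob_space) fourth_moment_Median:
  fixes X :: "'i \<Rightarrow> 'a \<Rightarrow> real"
  assumes P: "polynomial_profile \<kappa> \<mu> p" "0 < \<kappa>" "0 < \<mu>"
    and ind: "indep_vars (\<lambda>_. borel) X I" and m: "card I = 2 * r + 1" "6 \<le> \<mu> * real (card I)"
    and up: "\<And>i u. i \<in> I \<Longrightarrow> 0 \<le> u \<Longrightarrow> prob {\<omega> \<in> space M. u < X i \<omega>} = p u"
    and dn: "\<And>i u. i \<in> I \<Longrightarrow> 0 \<le> u \<Longrightarrow> prob {\<omega> \<in> space M. X i \<omega> < - u} = p u"
  shows "(\<integral>\<^sup>+\<omega>. ennreal ((Median I (\<lambda>i. X i \<omega>)) ^ 4) \<partial>M) \<le> ennreal (1584 / (\<kappa> * \<mu> * real (card I))\<^sup>2)"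
proof -
  define m where "m = card I"
  have fin: "finite I" "I \<noteq> {}" using m by (auto intro: card_ge_0_finite)
  have rv: "X i \<in> borel_measurable M" if "i \<in> I" for i using ind that by (auto simp: indep_vars_def)
  define Z where "Z = (\<lambda>\<omega>. Median I (\<lambda>i. X i \<omega>))"
  have [measurable]: "Z \<in> borel_measurable M"
    unfolding Z_def using fin rv by (intro borel_measurable_Median) auto
  define b where "b = nat \<lfloor>\<mu> * real m / 6\<rfloor>"
  have b: "real b \<le> \<mu> * real m / 6" "\<mu> * real m / 12 \<le> real b"
    using nat_floor_bounds[of "\<mu> * real m / 6"] m unfolding b_def m_def by auto
  have bp: "0 < real b * \<kappa>" using b m P unfolding m_def[symmetric] by (intro mult_pos_pos) linarith+
  have tail: "prob {\<omega> \<in> space M. u < \<bar>Z \<omega>\<bar>} \<le> 2 / (1 + real b * \<kappa> * u\<^sup>2) ^ 3" if u: "0 \<le> u" for u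
  proof -
    have bt: "binom_tail (2 * r + 1) (r + 1) (p u) \<le> 1 / (1 + real b * \<kappa> * u\<^sup>2) ^ 3"
      by (rule binom_tail_profile_power[OF P u]) (use b m in \<open>auto simp: m_def\<close>)
    have "{\<omega> \<in> space M. u < \<bar>Z \<omega>\<bar>} = {\<omega> \<in> space M. u < Z \<omega>} \<union> {\<omega> \<in> space M. Z \<omega> < - u}" using u by auto
    then have "prob {\<omega> \<in> space M. u < \<bar>Z \<omega>\<bar>} \<le> prob {\<omega> \<in> space M. u < Z \<omega>} + prob {\<omega> \<in> space M. Z \<omega> < - u}"
      by (auto intro!: measure_Un_le)
    also have "\<dots> = 2 * binom_tail (2 * r + 1) (r + 1) (p u)"
      unfolding Z_def using prob_Median_gt[OF ind m(1), of u "p u"] prob_Median_less[OF ind m(1), of "- u" "p u"] up dn u by simp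
    finally show ?thesis using bt by simp
  qed
  have "(\<integral>\<^sup>+\<omega>. ennreal ((real b * \<kappa> * (Z \<omega>)\<^sup>2)\<^sup>2) \<partial>M) \<le> 11"
  proof (rule second_moment_of_cubic_tail)
    fix k :: nat
    define u where "u = sqrt (real k / (real b * \<kappa>))"
    have u: "0 \<le> u" "real b * \<kappa> * u\<^sup>2 = real k" using bp by (auto simp: u_def)
    have "real k < real b * \<kappa> * (Z \<omega>)\<^sup>2 \<Longrightarrow> u < \<bar>Z \<omega>\<bar>" for \<omega>
    proof -
      assume "real k < real b * \<kappa> * (Z \<omega>)\<^sup>2"
      then have "u\<^sup>2 < \<bar>Z \<omega>\<bar>\<^sup>2" unfolding u(2)[symmetric] using bp by (simp add: mult_less_cancel_left_pos)
      then show ?thesis by (rule power_less_imp_less_base) simp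
    qed
    then have "prob {\<omega> \<in> space M. real k < real b * \<kappa> * (Z \<omega>)\<^sup>2} \<le> prob {\<omega> \<in> space M. u < \<bar>Z \<omega>\<bar>}"
      by (intro finite_measure_mono) auto
    also have "\<dots> \<le> 2 / (1 + real k) ^ 3" using tail[OF u(1)] u(2) by simp
    finally show "prob {\<omega> \<in> space M. real k < real b * \<kappa> * (Z \<omega>)\<^sup>2} \<le> 2 / (1 + real k) ^ 3" .
  qed (use bp in auto)
  also have "(\<integral>\<^sup>+\<omega>. ennreal ((real b * \<kappa> * (Z \<omega>)\<^sup>2)\<^sup>2) \<partial>M) = ennreal ((real b * \<kappa>)\<^sup>2) * (\<integral>\<^sup>+\<omega>. ennreal ((Z \<omega>) ^ 4) \<partial>M)"
    by (subst nn_integral_cmult[symmetric]) (auto simp: ennreal_mult'[symmetric] power_mult_distrib power_mult[symmetric])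
  finally have e: "ennreal ((real b * \<kappa>)\<^sup>2) * (\<integral>\<^sup>+\<omega>. ennreal ((Z \<omega>) ^ 4) \<partial>M) \<le> 11" .
  have "(\<integral>\<^sup>+\<omega>. ennreal ((Z \<omega>) ^ 4) \<partial>M) = ennreal (1 / (real b * \<kappa>)\<^sup>2) * (ennreal ((real b * \<kappa>)\<^sup>2) * (\<integral>\<^sup>+\<omega>. ennreal ((Z \<omega>) ^ 4) \<partial>M))"
  proof -
    have "ennreal (1 / (real b * \<kappa>)\<^sup>2) * ennreal ((real b * \<kappa>)\<^sup>2) = ennreal (1 / (real b * \<kappa>)\<^sup>2 * (real b * \<kappa>)\<^sup>2)"
      by (rule ennreal_mult'[symmetric]) simp
    also have "1 / (real b * \<kappa>)\<^sup>2 * (real b * \<kappa>)\<^sup>2 = 1"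
    proof -
      have "(real b * \<kappa>)\<^sup>2 \<noteq> 0" using bp by (metis less_irrefl zero_eq_power2)
      then show ?thesis by (rule nonzero_divide_eq_eq[THEN iffD1, OF _ refl, symmetric])
    qed
    finally show ?thesis by (simp only: mult.assoc[symmetric] ennreal_1 mult_1)
  qed
  also have "\<dots> \<le> ennreal (1 / (real b * \<kappa>)\<^sup>2) * ennreal 11" using e by (intro mult_left_mono) auto
  also have "\<dots> = ennreal (11 / (real b * \<kappa>)\<^sup>2)" by (subst ennreal_mult'[symmetric]) auto
  also have "\<dots> \<le> ennreal (11 / (\<kappa> * \<mu> * real m / 12)\<^sup>2)"
  proof (intro ennreal_leI divide_left_mono power_mono)
    have "0 < \<mu> * real m" using m by (simp add: m_def)
    then have q: "0 < \<kappa> * \<mu> * real m / 12" using P by (simp add: mult.assoc)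
    then show "0 \<le> \<kappa> * \<mu> * real m / 12" by simp
    show "0 < (real b * \<kappa>)\<^sup>2 * (\<kappa> * \<mu> * real m / 12)\<^sup>2" by (intro mult_pos_pos[of "_\<^sup>2"] zero_less_power q bp)
    show "\<kappa> * \<mu> * real m / 12 \<le> real b * \<kappa>" using b P mult_left_mono[OF b(2), of \<kappa>] by (simp add: mult_ac)
  qed auto
  finally show ?thesis by (simp add: Z_def m_def power_divide)
qed

section \<open>White noise\<close>

locale symmetric_noise = prob_space \<Psi> for \<Psi> :: "real measure" +
  fixes K :: real
  assumes sets_noise [measurable_cong]: "sets \<Psi> = sets borel"
    and noise_uminus: "distr \<Psi> borel uminus = \<Psi>"
    and noise_density: "a \<le> b \<Longrightarrow> measure \<Psi> {a..b} \<le> K * (b - a)"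
begin

abbreviation noise :: "'i set \<Rightarrow> ('i \<Rightarrow> real) measure" where
  "noise I \<equiv> (\<Pi>\<^sub>M i\<in>I. \<Psi>)"

definition tail :: "real \<Rightarrow> real" where "tail t = measure \<Psi> {t<..}"

lemma space_noise [simp]: "space \<Psi> = UNIV"
  using sets_eq_imp_space_eq[OF sets_noise] by simp

lemma tail_nonneg: "0 \<le> tail t" by (simp add: tail_def)

lemma tail_antimono: "s \<le> t \<Longrightarrow> tail t \<le> tail s"
  unfolding tail_def by (intro finite_measure_mono) (auto simp: sets_noise)

lemma noise_less: "measure \<Psi> {..<- t} = tail t"
proof -
  have "measure \<Psi> {..<- t} = measure (distr \<Psi> borel uminus) {..<- t}" by (simp only: noise_uminus)
  also have "\<dots> = measure \<Psi> (uminus -` {..<- t} \<inter> space \<Psi>)"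
    by (rule measure_distr) (auto simp: measurable_cong_sets[OF sets_noise refl])
  also have "uminus -` {..<- t} \<inter> space \<Psi> = {t<..}" by auto
  finally show ?thesis by (simp add: tail_def)
qed

lemma noise_point: "measure \<Psi> {a} = 0"
  using noise_density[of a a] by (simp add: measure_le_0_iff)

lemma K_nonneg: "0 \<le> K"
proof -
  have "measure \<Psi> {0..1} \<le> K" using noise_density[of 0 1] by simp
  then show ?thesis by (rule order_trans[OF measure_nonneg])
qed

lemma noise_split: "s \<le> t \<Longrightarrow> tail s = measure \<Psi> {s<..t} + tail t"
proof -
  assume st: "s \<le> t"
  then have "{s<..} = {s<..t} \<union> {t<..}" by auto
  moreover have "measure \<Psi> ({s<..t} \<union> {t<..}) = measure \<Psi> {s<..t} + measure \<Psi> {t<..}"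
    by (rule finite_measure_Union) (auto simp: sets_noise)
  ultimately show ?thesis by (simp add: tail_def)
qed

lemma tail_zero: "tail 0 = 1 / 2"
proof -
  have "{..<0::real} \<union> {0} \<union> {0<..} = UNIV" by auto
  then have "1 = measure \<Psi> ({..<0} \<union> {0} \<union> {0<..})" using prob_space by simp
  also have "\<dots> = measure \<Psi> {..<0} + measure \<Psi> {0} + measure \<Psi> {0<..}"
    by (subst finite_measure_Union; (subst finite_measure_Union)?) (auto simp: sets_noise)
  also have "\<dots> = 2 * tail 0" using noise_less[of 0] by (simp add: noise_point tail_def)
  finally show ?thesis by simp
qed

lemma prob_space_product: "prob_space (noise I)"
  by (intro prob_space_PiM prob_space_axioms)

lemma coordinate_distr:
  assumes "i \<in> I" shows "distr (noise I) borel (\<lambda>z. z i) = \<Psi>"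
proof -
  interpret product_prob_space "\<lambda>_. \<Psi>" I by (intro product_prob_spaceI prob_space_axioms)
  have "distr (noise I) borel (\<lambda>z. z i) = distr (noise I) \<Psi> (\<lambda>z. z i)"
    by (intro distr_cong) (auto simp: sets_noise)
  also have "\<dots> = \<Psi>" using PiM_component[OF assms] by simp
  finally show ?thesis .
qed

lemma coordinate_measurable: "i \<in> I \<Longrightarrow> (\<lambda>z. z i) \<in> borel_measurable (noise I)"
proof -
  assume "i \<in> I"
  then have "(\<lambda>z. z i) \<in> (noise I) \<rightarrow>\<^sub>M \<Psi>" by (rule measurable_component_singleton)
  then show ?thesis by (simp only: measurable_cong_sets[OF refl sets_noise])
qed

lemma coordinate_prob:
  assumes i: "i \<in> I" and B: "B \<in> sets borel"
  shows "measure (noise I) {z \<in> space (noise I). z i \<in> B} = measure \<Psi> B"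
proof -
  have "measure \<Psi> B = measure (distr (noise I) borel (\<lambda>z. z i)) B" by (simp only: coordinate_distr[OF i])
  also have "\<dots> = measure (noise I) ((\<lambda>z. z i) -` B \<inter> space (noise I))"
    using i B by (intro measure_distr) auto
  also have "(\<lambda>z. z i) -` B \<inter> space (noise I) = {z \<in> space (noise I). z i \<in> B}" by auto
  finally show ?thesis by simp
qed

lemma coordinates_indep: "prob_space.indep_vars (noise I) (\<lambda>_. borel) (\<lambda>i z. z i) I"
proof -
  interpret P: prob_space "noise I" by (rule prob_space_product)
  show ?thesis
  proof (cases "I = {}")
    case True then show ?thesis unfolding P.indep_vars_def P.indep_sets_def by auto
  next
    case False
    have s: "sets (\<Pi>\<^sub>M i\<in>I. (borel :: real measure)) = sets (noise I)"
      by (intro sets_PiM_cong) (auto simp: sets_noise)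
    have "distr (noise I) (\<Pi>\<^sub>M i\<in>I. borel) (\<lambda>z. \<lambda>i\<in>I. z i) = distr (noise I) (noise I) (\<lambda>z. z)"
      by (intro distr_cong s) (auto simp: space_PiM restrict_PiE_iff extensional_restrict PiE_restrict)
    also have "\<dots> = (noise I)" by (rule distr_id)
    also have "\<dots> = (\<Pi>\<^sub>M i\<in>I. distr (noise I) borel (\<lambda>z. z i))"
      by (intro PiM_cong) (auto simp: coordinate_distr)
    finally show ?thesis using False by (subst P.indep_vars_iff_distr_eq_PiM') auto
  qed
qed

lemma block_Median_measurable:
  assumes "A \<subseteq> I" "finite A" "A \<noteq> {}"
  shows "(\<lambda>z. Median A z) \<in> borel_measurable (noise I)"
proof (rule borel_measurable_Median[OF assms(2,3)])
  fix a assume "a \<in> A"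
  then show "(\<lambda>z. z a) \<in> borel_measurable (noise I)" using assms(1) by (intro coordinate_measurable) auto
qed

lemma block_Medians_indep:
  assumes A: "\<And>k. k \<in> L \<Longrightarrow> A k \<subseteq> I \<and> finite (A k) \<and> A k \<noteq> {}" and dj: "disjoint_family_on A L"
  shows "prob_space.indep_vars (noise I) (\<lambda>_. borel) (\<lambda>k z. Median (A k) z) L"
proof -
  interpret P: prob_space "noise I" by (rule prob_space_product)
  have "P.indep_vars (\<lambda>j. PiM (A j) (\<lambda>_. borel)) (\<lambda>j z. restrict (\<lambda>i. z i) (A j)) L"
    using A dj by (intro P.indep_vars_restrict[OF coordinates_indep]) auto
  then have "P.indep_vars (\<lambda>_. borel) (\<lambda>k z. Median (A k) (restrict (\<lambda>i. z i) (A k))) L"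
  proof (rule P.indep_vars_compose2)
    fix k assume k: "k \<in> L"
    show "(\<lambda>z. Median (A k) z) \<in> borel_measurable (PiM (A k) (\<lambda>_. borel :: real measure))"
    proof (rule borel_measurable_Median)
      fix a assume "a \<in> A k"
      then show "(\<lambda>z. z a) \<in> borel_measurable (PiM (A k) (\<lambda>_. borel :: real measure))"
        by (rule measurable_component_singleton)
    qed (use A[OF k] in auto)
  qed
  moreover have "Median (A k) (restrict (\<lambda>i. z i) (A k)) = Median (A k) z" for k z
    by (intro Median_cong) auto
  ultimately show ?thesis by simp
qed

text \<open>Symmetries of the noise take the place of any smoothness of its density in the lower bound for the bias.\<close>

lemma reflect_permute_distr:
  assumes fin: "finite I" and \<rho>: "bij_betw \<rho> I I"
  shows "distr (noise I) (noise I) (\<lambda>z. \<lambda>i\<in>I. - z (\<rho> i)) = (noise I)"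
proof -
  have u [measurable]: "uminus \<in> \<Psi> \<rightarrow>\<^sub>M \<Psi>"
    by (subst measurable_cong_sets[OF sets_noise sets_noise]) simp
  have a: "distr (noise I) (noise I) (\<lambda>z. \<lambda>i\<in>I. z (\<rho> i)) = (noise I)"
    using \<rho> by (intro distr_PiM_reindex prob_space_axioms) (auto simp: bij_betw_def)
  have "distr \<Psi> \<Psi> uminus = distr \<Psi> borel uminus" by (intro distr_cong) (auto simp: sets_noise)
  then have b: "distr (noise I) (noise I) (compose I uminus) = (noise I)"
    using distr_PiM_finite_prob_space'[of I "\<lambda>_. \<Psi>" "\<lambda>_. \<Psi>" uminus] fin prob_space_axioms u
    by (simp add: noise_uminus)
  have m1: "(\<lambda>z. \<lambda>i\<in>I. z (\<rho> i)) \<in> (noise I) \<rightarrow>\<^sub>M (noise I)"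
    using \<rho> by (intro measurable_restrict measurable_component_singleton) (auto simp: bij_betw_def)
  have m2: "compose I uminus \<in> (noise I) \<rightarrow>\<^sub>M (noise I)"
    unfolding compose_def by measurable
  have "distr (noise I) (noise I) (\<lambda>z. \<lambda>i\<in>I. - z (\<rho> i))
      = distr (noise I) (noise I) (compose I uminus \<circ> (\<lambda>z. \<lambda>i\<in>I. z (\<rho> i)))"
    by (intro distr_cong) (auto simp: compose_def fun_eq_iff)
  also have "\<dots> = distr (distr (noise I) (noise I) (\<lambda>z. \<lambda>i\<in>I. z (\<rho> i))) (noise I) (compose I uminus)"
    by (rule distr_distr[OF m2 m1, symmetric])
  also have "\<dots> = (noise I)" by (simp only: a b)
  finally show ?thesis .
qed

lemma reflect_permute_measurable:
  assumes \<rho>: "bij_betw \<rho> I I"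
  shows "(\<lambda>z. \<lambda>i\<in>I. - z (\<rho> i)) \<in> (noise I) \<rightarrow>\<^sub>M (noise I)"
proof (rule measurable_restrict)
  fix i assume "i \<in> I"
  then have "\<rho> i \<in> I" using \<rho> by (auto simp: bij_betw_def)
  then have "(\<lambda>z. - z (\<rho> i)) \<in> borel_measurable (noise I)" by (intro borel_measurable_uminus coordinate_measurable)
  then show "(\<lambda>z. - z (\<rho> i)) \<in> (noise I) \<rightarrow>\<^sub>M \<Psi>"
    by (simp only: measurable_cong_sets[OF refl sets_noise])
qed

lemma nn_integral_reflect_permute:
  assumes fin: "finite I" and \<rho>: "bij_betw \<rho> I I" and g: "g \<in> borel_measurable (noise I)"
  shows "(\<integral>\<^sup>+z. g (\<lambda>i\<in>I. - z (\<rho> i)) \<partial>(noise I)) = (\<integral>\<^sup>+z. g z \<partial>(noise I))"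
proof -
  have "(\<integral>\<^sup>+z. g z \<partial>(noise I)) = (\<integral>\<^sup>+z. g z \<partial>distr (noise I) (noise I) (\<lambda>z. \<lambda>i\<in>I. - z (\<rho> i)))"
    by (simp only: reflect_permute_distr[OF fin \<rho>])
  also have "\<dots> = (\<integral>\<^sup>+z. g (\<lambda>i\<in>I. - z (\<rho> i)) \<partial>(noise I))"
    by (rule nn_integral_distr[OF reflect_permute_measurable[OF \<rho>]]) (simp add: g)
  finally show ?thesis by simp
qed

lemma block_Median_symmetric:
  assumes A: "A \<subseteq> I" "A \<noteq> {}" and fin: "finite I" and B: "B \<in> sets borel"
  shows "measure (noise I) {z \<in> space (noise I). - Median A z \<in> B}
       = measure (noise I) {z \<in> space (noise I). Median A z \<in> B}"
proof -
  define P where "P = (noise I)"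
  define F where "F = (\<lambda>z::'a\<Rightarrow>real. \<lambda>i\<in>I. - z i)"
  have finA: "finite A" using A fin finite_subset by blast
  have mF: "F \<in> P \<rightarrow>\<^sub>M P" unfolding F_def P_def using reflect_permute_measurable[of "\<lambda>i. i" I] by (simp add: bij_betw_def)
  have dF: "distr P P F = P" unfolding F_def P_def using reflect_permute_distr[OF fin, of "\<lambda>i. i"] by (simp add: bij_betw_def)
  have [measurable]: "(\<lambda>z. Median A z) \<in> borel_measurable P" unfolding P_def using A finA by (intro block_Median_measurable)
  have "{z \<in> space P. Median A z \<in> B} = (\<lambda>z. Median A z) -` B \<inter> space P" by auto
  also have "\<dots> \<in> sets P" using B by (intro measurable_sets[of _ P borel]) auto
  finally have S: "{z \<in> space P. Median A z \<in> B} \<in> sets P" .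
  have e: "Median A (F z) = - Median A z" for z
  proof -
    have "Median A (F z) = Median A (\<lambda>i. - z i)" using A by (intro Median_cong) (auto simp: F_def)
    then show ?thesis using A finA by (simp add: Median_uminus)
  qed
  have "measure P {z \<in> space P. Median A z \<in> B} = measure (distr P P F) {z \<in> space P. Median A z \<in> B}" by (simp only: dF)
  also have "\<dots> = measure P (F -` {z \<in> space P. Median A z \<in> B} \<inter> space P)" by (rule measure_distr[OF mF S])
  also have "F -` {z \<in> space P. Median A z \<in> B} \<inter> space P = {z \<in> space P. - Median A z \<in> B}"
    using measurable_space[OF mF] by (auto simp: e)
  finally show ?thesis by (simp add: P_def)
qed

end

section \<open>Unimodal symmetric densities\<close>

lemma shape_condition_consequences:
  assumes pr: "prob_space \<Psi>" and sh: "shape_condition \<Psi> \<psi>"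
  obtains K where "symmetric_noise \<Psi> K" "\<And>x. \<psi> x \<le> K"
proof -
  have P: "\<Psi> = density lborel (\<lambda>x. ennreal (\<psi> x))" and p0: "\<And>x. 0 \<le> \<psi> x"
    and un: "unimodal \<psi>" and co: "continuous_on UNIV \<psi>" and sy: "\<And>x. \<psi> (- x) = \<psi> x"
    using sh by (auto simp: shape_condition_def)
  have [measurable]: "\<psi> \<in> borel_measurable borel" using co by (rule borel_measurable_continuous_onI)
  obtain m where m: "mono_on {..m} \<psi>" "antimono_on {m..} \<psi>" using un by (auto simp: unimodal_def)
  have K: "\<psi> x \<le> \<psi> m" for x
    using mono_onD[OF m(1), of x m] monotone_onD[OF m(2), of m x] by (cases "x \<le> m") auto
  interpret prob_space \<Psi> by (rule pr)
  have "symmetric_noise \<Psi> (\<psi> m)"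
  proof
    show s: "sets \<Psi> = sets borel" by (simp add: P)
    show "distr \<Psi> borel uminus = \<Psi>"
    proof (rule measure_eqI)
      fix A assume "A \<in> sets (distr \<Psi> borel uminus)"
      then have A [measurable]: "A \<in> sets borel" by simp
      have "emeasure (distr \<Psi> borel uminus) A = emeasure \<Psi> (uminus -` A)"
        by (subst emeasure_distr) (auto simp: P)
      also have "\<dots> = (\<integral>\<^sup>+x. ennreal (\<psi> x) * indicator (uminus -` A) x \<partial>lborel)"
      proof -
        have "uminus -` A \<in> sets (borel :: real measure)"
          using measurable_sets[of uminus borel borel A] A by simp
        then show ?thesis unfolding P by (subst emeasure_density) auto
      qed
      also have "\<dots> = (\<integral>\<^sup>+x. ennreal (\<psi> (- x)) * indicator A (- x) \<partial>lborel)"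
        by (intro nn_integral_cong) (auto simp: sy indicator_def)
      also have "\<dots> = (\<integral>\<^sup>+x. ennreal (\<psi> x) * indicator A x \<partial>distr lborel borel uminus)"
        by (subst nn_integral_distr) auto
      also have "\<dots> = emeasure \<Psi> A" unfolding lborel_distr_uminus P by (subst emeasure_density) auto
      finally show "emeasure (distr \<Psi> borel uminus) A = emeasure \<Psi> A" .
    qed (simp add: s)
    fix a b :: real assume ab: "a \<le> b"
    have "emeasure \<Psi> {a..b} = (\<integral>\<^sup>+x. ennreal (\<psi> x) * indicator {a..b} x \<partial>lborel)"
      unfolding P by (subst emeasure_density) auto
    also have "\<dots> \<le> (\<integral>\<^sup>+x. ennreal (\<psi> m) * indicator {a..b} x \<partial>lborel)"
      using K by (intro nn_integral_mono mult_right_mono ennreal_leI) auto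
    also have "\<dots> = ennreal (\<psi> m * (b - a))"
      using ab p0 by (simp add: nn_integral_cmult_indicator ennreal_mult')
    finally show "measure \<Psi> {a..b} \<le> \<psi> m * (b - a)"
      using ab p0 by (simp add: emeasure_eq_measure ennreal_le_iff)
  qed
  then show ?thesis using K that by blast
qed

text \<open>A unimodal density that vanished at zero would vanish on the half-line beyond zero that does not contain the mode,
  and by symmetry everywhere.\<close>

lemma density_positive_at_zero:
  assumes pr: "prob_space \<Psi>" and sh: "shape_condition \<Psi> \<psi>"
  shows "0 < \<psi> 0"
proof (rule ccontr)
  assume "\<not> 0 < \<psi> 0"
  have P: "\<Psi> = density lborel (\<lambda>x. ennreal (\<psi> x))" and p0: "\<And>x. 0 \<le> \<psi> x"
    and un: "unimodal \<psi>" and sy: "\<And>x. \<psi> (- x) = \<psi> x"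
    using sh by (auto simp: shape_condition_def)
  then have z: "\<psi> 0 = 0" using \<open>\<not> 0 < \<psi> 0\<close> p0[of 0] by linarith
  obtain m where m: "mono_on {..m} \<psi>" "antimono_on {m..} \<psi>" using un by (auto simp: unimodal_def)
  have "\<psi> x = 0" for x
  proof -
    have "\<psi> (- \<bar>x\<bar>) \<le> 0 \<or> \<psi> \<bar>x\<bar> \<le> 0"
      using mono_onD[OF m(1), of "- \<bar>x\<bar>" 0] monotone_onD[OF m(2), of 0 "\<bar>x\<bar>"] z by (cases "0 \<le> m") auto
    then have "\<psi> x \<le> 0" using sy by (cases "0 \<le> x") auto
    then show ?thesis using p0[of x] by linarith
  qed
  then have "emeasure \<Psi> (space \<Psi>) = 0" unfolding P by (subst emeasure_density) auto
  then show False using prob_space.emeasure_space_1[OF pr] by simp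
qed

text \<open>Continuity at zero gives the linear part, and a density that decays with an exponent larger than one integrates to
  a polynomial tail.\<close>

lemma half_tail_noise:
  assumes pr: "prob_space \<Psi>" and sh: "shape_condition \<Psi> \<psi>" and de: "1 < decay_exponent \<psi>"
    and N: "symmetric_noise \<Psi> K"
  obtains c u\<^sub>0 C a where "0 < c" "0 < u\<^sub>0" "0 < C" "0 < a" "half_tail c u\<^sub>0 C a (symmetric_noise.tail \<Psi>)"
proof -
  interpret symmetric_noise \<Psi> K by (rule N)
  have P: "\<Psi> = density lborel (\<lambda>x. ennreal (\<psi> x))" and p0: "\<And>x. 0 \<le> \<psi> x"
    and co: "continuous_on UNIV \<psi>"
    using sh by (auto simp: shape_condition_def)
  have [measurable]: "\<psi> \<in> borel_measurable borel" using co by (rule borel_measurable_continuous_onI)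
  have dens: "emeasure \<Psi> A = (\<integral>\<^sup>+x. ennreal (\<psi> x) * indicator A x \<partial>lborel)" if "A \<in> sets borel" for A
    using that by (subst P, subst emeasure_density) auto
  have pos: "0 < \<psi> 0" by (rule density_positive_at_zero[OF pr sh])
  have "isCont \<psi> 0" using co by (simp add: continuous_on_eq_continuous_at)
  then obtain d where d: "0 < d" "\<forall>x. x \<noteq> 0 \<and> dist x 0 < d \<longrightarrow> dist (\<psi> x) (\<psi> 0) < \<psi> 0 / 2"
    unfolding isCont_def LIM_def using half_gt_zero[OF pos] by blast
  have lo: "\<psi> 0 / 2 \<le> \<psi> x" if x: "\<bar>x\<bar> < d" for x
  proof (cases "x = 0")
    case True then show ?thesis using pos by simp
  next
    case False
    then have "\<bar>\<psi> x - \<psi> 0\<bar> < \<psi> 0 / 2" using d(2) x by (auto simp: dist_real_def)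
    then show ?thesis unfolding abs_less_iff by linarith
  qed
  define u\<^sub>0 where "u\<^sub>0 = d / 2"
  have near: "tail u \<le> 1 / 2 - \<psi> 0 / 2 * u" if u: "0 \<le> u" "u \<le> u\<^sub>0" for u
  proof -
    have "ennreal (\<psi> 0 / 2 * u) = (\<integral>\<^sup>+x. ennreal (\<psi> 0 / 2) * indicator {0<..u} x \<partial>lborel)"
      using u pos by (subst nn_integral_cmult_indicator) (auto simp: ennreal_mult'[symmetric])
    also have "\<dots> \<le> (\<integral>\<^sup>+x. ennreal (\<psi> x) * indicator {0<..u} x \<partial>lborel)"
      using u lo d by (intro nn_integral_mono) (auto simp: u\<^sub>0_def indicator_def intro!: ennreal_leI)
    also have "\<dots> = emeasure \<Psi> {0<..u}" by (rule dens[symmetric]) simp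
    finally have "\<psi> 0 / 2 * u \<le> measure \<Psi> {0<..u}"
      using u pos by (simp add: emeasure_eq_measure ennreal_le_iff)
    then show ?thesis using noise_split[OF u(1)] tail_zero by linarith
  qed
  obtain s where s: "1 < s" "bounded (range (\<lambda>x. \<psi> x * (\<bar>x\<bar> + 1) powr s))"
    using de unfolding decay_exponent_def less_SUP_iff by auto
  obtain D where D: "0 < D" "\<And>x. \<psi> x * (\<bar>x\<bar> + 1) powr s \<le> D"
  proof -
    obtain B where "\<And>x. norm (\<psi> x * (\<bar>x\<bar> + 1) powr s) \<le> B" using s(2) unfolding bounded_iff by auto
    then have "\<psi> x * (\<bar>x\<bar> + 1) powr s \<le> max B 1" for x by (smt (verit) real_norm_def)
    then show ?thesis by (intro that[of "max B 1"]) auto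
  qed
  have far: "tail t \<le> D / (s - 1) * t powr - (s - 1)" if t: "0 < t" for t
  proof -
    define F where "F = (\<lambda>x. - (D / (s - 1)) * (x + 1) powr (1 - s))"
    have "emeasure \<Psi> {t<..} = (\<integral>\<^sup>+x. ennreal (\<psi> x) * indicator {t<..} x \<partial>lborel)"
      by (rule dens) simp
    also have "\<dots> \<le> (\<integral>\<^sup>+x. ennreal (D * (x + 1) powr - s) * indicator {t..} x \<partial>lborel)"
    proof (intro nn_integral_mono)
      fix x :: real
      show "ennreal (\<psi> x) * indicator {t<..} x \<le> ennreal (D * (x + 1) powr - s) * indicator {t..} x"
      proof (cases "t < x")
        case True
        then have "\<psi> x * (x + 1) powr s \<le> D" using D(2)[of x] t by simp
        then have "\<psi> x \<le> D * (x + 1) powr - s" using True t by (simp add: powr_minus field_simps)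
        then show ?thesis using True by (simp add: ennreal_leI)
      qed simp
    qed
    also have "\<dots> = ennreal (0 - F t)"
    proof (rule nn_integral_FTC_atLeast)
      fix x :: real assume x: "t \<le> x"
      show "(F has_real_derivative D * (x + 1) powr - s) (at x)"
      proof -
        have "- (D / (s - 1)) * ((1 - s) * y) = D * y" for y using s by (simp add: field_simps)
        moreover have "(F has_real_derivative - (D / (s - 1)) * ((1 - s) * (x + 1) powr - s)) (at x)"
          unfolding F_def using x t s by (auto intro!: derivative_eq_intros)
        ultimately show ?thesis by simp
      qed
      show "0 \<le> D * (x + 1) powr - s" using D by simp
    next
      have "((\<lambda>x. (x + 1) powr (1 - s)) \<longlongrightarrow> 0) at_top"
        using s by (intro tendsto_neg_powr filterlim_tendsto_add_at_top[OF tendsto_const[of 1], simplified add.commute[of 1]] filterlim_ident) auto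
      then show "(F \<longlongrightarrow> 0) at_top" unfolding F_def by (rule tendsto_mult_right_zero)
    qed measurable
    also have "0 - F t \<le> D / (s - 1) * t powr - (s - 1)"
    proof -
      have "(t + 1) powr (1 - s) \<le> t powr (1 - s)" using t s by (intro powr_mono2') auto
      then have "D / (s - 1) * (t + 1) powr (1 - s) \<le> D / (s - 1) * t powr (1 - s)"
        using s D by (intro mult_left_mono) auto
      then show ?thesis unfolding F_def by simp
    qed
    finally show ?thesis using s D t unfolding tail_def by (simp add: emeasure_eq_measure ennreal_le_iff ennreal_leI)
  qed
  show ?thesis
  proof (rule that[of "\<psi> 0 / 2" u\<^sub>0 "D / (s - 1)" "s - 1"])
    show "half_tail (\<psi> 0 / 2) u\<^sub>0 (D / (s - 1)) (s - 1) tail"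
      unfolding half_tail_def using near far tail_nonneg tail_antimono by auto
  qed (use pos d s D in \<open>auto simp: u\<^sub>0_def\<close>)
qed

section \<open>Integer form of the two-scale filter\<close>

text \<open>The block with index \<open>k\<close>, for \<open>n h\<^sub>1 = m\<close>.\<close>

definition pixels :: "nat \<Rightarrow> nat \<Rightarrow> nat \<Rightarrow> nat set" where
  "pixels n m k = {i \<in> {1..n}. k * m + 1 \<le> i \<and> i \<le> (k + 1) * m}"

text \<open>The last index of the coarse grid; the corresponding block is the only one that may have fewer than \<open>m\<close> pixels.\<close>

definition last_block :: "nat \<Rightarrow> nat \<Rightarrow> nat" where
  "last_block n m = (n - 1) div m"

text \<open>The coarse window, with \<open>w\<close> for the integer part of \<open>h\<^sub>2 / h\<^sub>1\<close>.\<close>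

definition window :: "nat \<Rightarrow> nat \<Rightarrow> nat \<Rightarrow> nat \<Rightarrow> nat set" where
  "window n m w k = {k'. k' \<le> last_block n m \<and> k \<le> k' + w \<and> k' \<le> k + w}"

definition median_filter :: "nat \<Rightarrow> nat \<Rightarrow> nat \<Rightarrow> (nat \<Rightarrow> real) \<Rightarrow> nat \<Rightarrow> real" where
  "median_filter n m w Y i = Median (window n m w ((i - 1) div m)) (\<lambda>k. Median (pixels n m k) Y)"

lemma mem_pixels_iff:
  assumes "1 \<le> m" shows "i \<in> pixels n m k \<longleftrightarrow> i \<in> {1..n} \<and> (i - 1) div m = k"
proof (cases "1 \<le> i")
  case True
  then obtain j where i: "i = Suc j" by (cases i) auto
  have "k * m + 1 \<le> i \<and> i \<le> (k + 1) * m \<longleftrightarrow> k * m \<le> j \<and> j < Suc k * m" using i by auto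
  also have "\<dots> \<longleftrightarrow> k \<le> j div m \<and> j div m < Suc k"
    using assms less_eq_div_iff_mult_less_eq[of m k j] div_less_iff_less_mult[of m j "Suc k"] by simp
  also have "\<dots> \<longleftrightarrow> j div m = k" by auto
  finally show ?thesis unfolding pixels_def i by auto
qed (auto simp: pixels_def)

lemma pixels_subset: "pixels n m k \<subseteq> {1..n}"
  by (auto simp: pixels_def)

lemma finite_pixels [simp]: "finite (pixels n m k)"
  by (simp add: pixels_def)

lemma disjoint_pixels: "1 \<le> m \<Longrightarrow> disjoint_family_on (pixels n m) L"
  by (auto simp: disjoint_family_on_def mem_pixels_iff)

lemma last_block_bounds:
  assumes "1 \<le> m" "1 \<le> n"
  shows "last_block n m * m < n" "n \<le> (last_block n m + 1) * m"
proof -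
  have "last_block n m * m \<le> n - 1" unfolding last_block_def by simp
  then show "last_block n m * m < n" using assms by linarith
  have "n - 1 < (n - 1) div m * m + m"
    using assms by (metis div_mult_mod_eq add_less_cancel_left mod_less_divisor zero_less_one less_le_trans)
  then show "n \<le> (last_block n m + 1) * m" unfolding last_block_def by simp
qed

lemma pixels_full:
  assumes "1 \<le> m" "1 \<le> n" "k < last_block n m"
  shows "pixels n m k = {k * m + 1..(k + 1) * m}" "card (pixels n m k) = m" "(k + 1) * m < n"
proof -
  have "(k + 1) * m \<le> last_block n m * m" using assms by (intro mult_le_mono1) auto
  then show "(k + 1) * m < n" using last_block_bounds(1)[OF assms(1,2)] by linarith
  then show "pixels n m k = {k * m + 1..(k + 1) * m}" by (auto simp: pixels_def)
  then show "card (pixels n m k) = m" by simp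
qed

lemma card_pixels_le: "card (pixels n m k) \<le> m"
proof -
  have "card (pixels n m k) \<le> card {k * m + 1..(k + 1) * m}" by (intro card_mono) (auto simp: pixels_def)
  then show ?thesis by simp
qed

lemma pixels_nonempty:
  assumes "1 \<le> m" "1 \<le> n" "k \<le> last_block n m"
  shows "pixels n m k \<noteq> {}"
proof -
  have "k * m \<le> last_block n m * m" using assms by (intro mult_le_mono1) auto
  then have "k * m + 1 \<le> n" using last_block_bounds(1)[OF assms(1,2)] by linarith
  then have "k * m + 1 \<in> pixels n m k" using assms(1) by (auto simp: pixels_def)
  then show ?thesis by blast
qed

lemma finite_window [simp]: "finite (window n m w k)"
  by (rule finite_subset[of _ "{..last_block n m}"]) (auto simp: window_def)

lemma card_window_le: "card (window n m w k) \<le> 2 * w + 1"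
proof -
  have "card (window n m w k) \<le> card {k - w..k + w}" by (intro card_mono) (auto simp: window_def)
  then show ?thesis by simp
qed

lemma card_window_ge:
  assumes "k \<le> last_block n m" "w \<le> last_block n m"
  shows "w + 1 \<le> card (window n m w k)"
proof (cases "w \<le> k")
  case True
  have "card {k - w..k} \<le> card (window n m w k)" using assms by (intro card_mono) (auto simp: window_def)
  then show ?thesis using True by simp
next
  case False
  have "card {0..w} \<le> card (window n m w k)" using assms False by (intro card_mono) (auto simp: window_def)
  then show ?thesis by simp
qed

lemma window_nonempty: "k \<le> last_block n m \<Longrightarrow> window n m w k \<noteq> {}"
proof -
  assume "k \<le> last_block n m"
  then have "k \<in> window n m w k" by (simp add: window_def)
  then show ?thesis by blast
qed

lemma block_index_le: "i \<in> {1..n} \<Longrightarrow> (i - 1) div m \<le> last_block n m"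
  unfolding last_block_def by (intro div_le_mono) auto

lemma window_interior:
  assumes "w \<le> k" "k + w \<le> last_block n m"
  shows "window n m w k = {k - w..k + w}" "card (window n m w k) = 2 * w + 1"
proof -
  show "window n m w k = {k - w..k + w}" using assms by (auto simp: window_def)
  then show "card (window n m w k) = 2 * w + 1" using assms by simp
qed

lemma two_scale_median_eq:
  assumes h: "0 < h\<^sub>1" "h\<^sub>1 < h\<^sub>2" and n: "1 \<le> n" and m: "1 \<le> m" "real n * h\<^sub>1 = real m" and i: "i \<in> {1..n}"
  shows "two_scale_median n h\<^sub>1 h\<^sub>2 Y i = median_filter n m (nat \<lfloor>h\<^sub>2 / h\<^sub>1\<rfloor>) Y i"
proof -
  define w where "w = nat \<lfloor>h\<^sub>2 / h\<^sub>1\<rfloor>"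
  have grid: "k \<in> coarse_grid h\<^sub>1 \<longleftrightarrow> k \<le> last_block n m" for k
  proof -
    have "k \<in> coarse_grid h\<^sub>1 \<longleftrightarrow> real k * h\<^sub>1 < 1"
      using h by (simp add: coarse_grid_def field_simps)
    also have "\<dots> \<longleftrightarrow> real n * (real k * h\<^sub>1) < real n * 1"
      using n by (subst mult_less_cancel_left_pos) auto
    also have "real n * (real k * h\<^sub>1) = real (k * m)"
      using m(2) by (metis mult.left_commute of_nat_mult)
    also have "real (k * m) < real n * 1 \<longleftrightarrow> k * m < n" by (simp del: of_nat_mult)
    also have "\<dots> \<longleftrightarrow> k * m \<le> n - 1" using n by linarith
    also have "\<dots> \<longleftrightarrow> k \<le> last_block n m"
      using m(1) unfolding last_block_def by (simp add: less_eq_div_iff_mult_less_eq)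
    finally show ?thesis .
  qed
  have blk: "block n h\<^sub>1 k = pixels n m k" for k
  proof -
    have "real k * real m + 1 = real (k * m + 1)" "(real k + 1) * real m = real ((k + 1) * m)"
      by (simp_all add: algebra_simps)
    then show ?thesis unfolding block_def pixels_def m(2) by (simp only: of_nat_le_iff)
  qed
  have "block_index n h\<^sub>1 i = (i - 1) div m"
    unfolding block_index_def blk mem_pixels_iff[OF m(1)] grid
    using i block_index_le[OF i] by (intro the_equality) auto
  moreover have "coarse_window h\<^sub>1 h\<^sub>2 k = window n m w k" for k
  proof -
    have "\<bar>real k' - real k\<bar> \<le> h\<^sub>2 / h\<^sub>1 \<longleftrightarrow> k \<le> k' + w \<and> k' \<le> k + w" for k'
    proof -
      have "\<bar>real k' - real k\<bar> = real_of_int \<bar>int k' - int k\<bar>" by simp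
      then have "\<bar>real k' - real k\<bar> \<le> h\<^sub>2 / h\<^sub>1 \<longleftrightarrow> \<bar>int k' - int k\<bar> \<le> \<lfloor>h\<^sub>2 / h\<^sub>1\<rfloor>" by (simp only: le_floor_iff)
      moreover have "int w = \<lfloor>h\<^sub>2 / h\<^sub>1\<rfloor>" unfolding w_def using h by simp
      ultimately show ?thesis by linarith
    qed
    then show ?thesis unfolding coarse_window_def window_def grid by auto
  qed
  ultimately show ?thesis
    unfolding two_scale_median_def median_filter_def coarse_signal_def[abs_def] blk by (simp add: w_def)
qed

lemma admissible_scales_integers:
  assumes n: "1 \<le> n" and a: "(h\<^sub>1, h\<^sub>2) \<in> admissible_scales n"
  obtains m w where "1 \<le> m" "1 \<le> w" "w * m < n"
    "\<And>Y i. i \<in> {1..n} \<Longrightarrow> two_scale_median n h\<^sub>1 h\<^sub>2 Y i = median_filter n m w Y i"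
proof -
  have h: "0 < h\<^sub>1" "h\<^sub>1 < h\<^sub>2" "h\<^sub>2 < 1" using a by (auto simp: admissible_scales_def)
  obtain m where m: "1 \<le> m" "real n * h\<^sub>1 = real m"
    using a two_scale_defined_iff[OF h n] by (auto simp: admissible_scales_def)
  define w where "w = nat \<lfloor>h\<^sub>2 / h\<^sub>1\<rfloor>"
  have q: "1 < h\<^sub>2 / h\<^sub>1" using h by simp
  have w1: "1 \<le> w"
  proof -
    have "1 \<le> \<lfloor>h\<^sub>2 / h\<^sub>1\<rfloor>" using q by (simp add: le_floor_iff)
    then show ?thesis unfolding w_def by linarith
  qed
  have "real w \<le> h\<^sub>2 / h\<^sub>1" unfolding w_def using q by (intro of_nat_floor) auto
  then have "real w * real m \<le> h\<^sub>2 / h\<^sub>1 * (real n * h\<^sub>1)" unfolding m(2) by (intro mult_right_mono) auto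
  also have "\<dots> = h\<^sub>2 * real n" using h by simp
  also have "\<dots> < real n" using h n by simp
  finally have "w * m < n" by (simp flip: of_nat_mult)
  then show ?thesis using that[OF m(1) w1] two_scale_median_eq[OF h(1,2) n m] by (simp add: w_def)
qed

lemma admissible_scales_of_integers:
  assumes "1 \<le> m" "2 \<le> w" "w * m < n"
  defines "h\<^sub>1 \<equiv> real m / real n" and "h\<^sub>2 \<equiv> real (w * m) / real n"
  shows "(h\<^sub>1, h\<^sub>2) \<in> admissible_scales n"
    "i \<in> {1..n} \<Longrightarrow> two_scale_median n h\<^sub>1 h\<^sub>2 Y i = median_filter n m w Y i"
proof -
  have n: "1 \<le> n" using assms by linarith
  have h: "0 < h\<^sub>1" "h\<^sub>1 < h\<^sub>2" "h\<^sub>2 < 1"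
    unfolding h\<^sub>1_def h\<^sub>2_def using assms(1-3) n by (auto simp: divide_less_eq divide_strict_right_mono simp del: of_nat_mult)
  have m: "real n * h\<^sub>1 = real m" using n by (simp add: h\<^sub>1_def)
  show "(h\<^sub>1, h\<^sub>2) \<in> admissible_scales n"
    unfolding admissible_scales_def using h two_scale_defined_iff[OF h n] m assms(1) by auto
  have "h\<^sub>2 / h\<^sub>1 = real w" unfolding h\<^sub>1_def h\<^sub>2_def using assms(1) n by simp
  then show "i \<in> {1..n} \<Longrightarrow> two_scale_median n h\<^sub>1 h\<^sub>2 Y i = median_filter n m w Y i"
    using two_scale_median_eq[OF h(1,2) n assms(1) m] by simp
qed

lemma risk_cong:
  assumes "\<And>Y i. i \<in> {1..n} \<Longrightarrow> T Y i = T' Y i"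
  shows "risk n \<sigma> \<Psi> T f = risk n \<sigma> \<Psi> T' f"
  unfolding risk_def using assms by (intro arg_cong2[where f = "(/)"] sum.cong nn_integral_cong) auto

section \<open>Error of a median filter with contaminated blocks\<close>

lemma block_Median_bounds:
  assumes "finite A" "A \<noteq> {}" "0 < \<sigma>" "\<And>j. j \<in> A \<Longrightarrow> \<bar>g j - a\<bar> \<le> \<tau>"
  shows "Median A (\<lambda>j. g j + \<sigma> * z j) \<le> a + \<tau> + \<sigma> * Median A z"
    and "a - \<tau> + \<sigma> * Median A z \<le> Median A (\<lambda>j. g j + \<sigma> * z j)"
proof -
  have b: "g j \<le> a + \<tau>" "a - \<tau> \<le> g j" if "j \<in> A" for j using assms(4)[OF that] by linarith+
  have "Median A (\<lambda>j. g j + \<sigma> * z j) \<le> Median A (\<lambda>j. (a + \<tau>) + \<sigma> * z j)"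
    using b by (intro Median_mono assms(1,2)) auto
  then show "Median A (\<lambda>j. g j + \<sigma> * z j) \<le> a + \<tau> + \<sigma> * Median A z"
    unfolding Median_affine[OF assms(1-3)] .
  have "Median A (\<lambda>j. (a - \<tau>) + \<sigma> * z j) \<le> Median A (\<lambda>j. g j + \<sigma> * z j)"
    using b by (intro Median_mono assms(1,2)) auto
  then show "a - \<tau> + \<sigma> * Median A z \<le> Median A (\<lambda>j. g j + \<sigma> * z j)"
    unfolding Median_affine[OF assms(1-3)] .
qed

lemma two_square_le_weighted:
  fixes e \<theta> :: real
  assumes "0 < \<theta>" shows "2 * e\<^sup>2 \<le> \<theta> + e ^ 4 / \<theta>"
proof -
  have "0 \<le> (\<theta> - e\<^sup>2)\<^sup>2 / \<theta>" using assms by simp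
  also have "(\<theta> - e\<^sup>2)\<^sup>2 / \<theta> = \<theta> - 2 * e\<^sup>2 + e ^ 4 / \<theta>"
    using assms by (simp add: power2_eq_square power4_eq_xxxx field_simps)
  finally show ?thesis by linarith
qed

text \<open>The inequality \<open>2 e\<^sup>2 \<le> \<theta> + e\<^sup>4 / \<theta>\<close> stands in for the Cauchy-Schwarz inequality: it passes from the fourth to the
  second moment under the integral, and \<open>\<theta>\<close> is chosen afterwards.\<close>

lemma clean_window_error:
  assumes W: "finite W" "W \<noteq> {}" and \<sigma>: "0 < \<sigma>" and \<theta>: "0 < \<theta>" and \<tau>: "0 \<le> \<tau>"
    and up: "\<And>k. k \<in> W \<Longrightarrow> y k \<le> a + \<tau> + \<sigma> * \<xi> k" and lo: "\<And>k. k \<in> W \<Longrightarrow> a - \<tau> + \<sigma> * \<xi> k \<le> y k"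
  shows "(Median W y - a)\<^sup>2 \<le> 2 * \<tau>\<^sup>2 + \<sigma>\<^sup>2 * (\<theta> + (Median W \<xi>) ^ 4 / \<theta>)"
proof -
  define e where "e = Median W \<xi>"
  have "Median W y \<le> (a + \<tau>) + \<sigma> * e" unfolding e_def
    using Median_mono[OF W up] Median_affine[OF W \<sigma>] by simp
  moreover have "(a - \<tau>) + \<sigma> * e \<le> Median W y" unfolding e_def
    using Median_mono[OF W lo] Median_affine[OF W \<sigma>] by simp
  ultimately have "\<bar>Median W y - a\<bar> \<le> \<tau> + \<sigma> * \<bar>e\<bar>"
  proof -
    have "\<bar>\<sigma> * e\<bar> = \<sigma> * \<bar>e\<bar>" using \<sigma> by (simp add: abs_mult)
    moreover assume "Median W y \<le> (a + \<tau>) + \<sigma> * e" "(a - \<tau>) + \<sigma> * e \<le> Median W y"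
    ultimately show ?thesis by linarith
  qed
  then have "(Median W y - a)\<^sup>2 \<le> (\<tau> + \<sigma> * \<bar>e\<bar>)\<^sup>2" by (metis abs_ge_zero power2_abs power_mono)
  also have "\<dots> \<le> 2 * \<tau>\<^sup>2 + 2 * (\<sigma> * \<bar>e\<bar>)\<^sup>2"
    using zero_le_power2[of "\<tau> - \<sigma> * \<bar>e\<bar>"] by (simp add: power2_eq_square algebra_simps)
  also have "(\<sigma> * \<bar>e\<bar>)\<^sup>2 = \<sigma>\<^sup>2 * e\<^sup>2" by (simp add: power_mult_distrib)
  also have "2 * \<tau>\<^sup>2 + 2 * (\<sigma>\<^sup>2 * e\<^sup>2) \<le> 2 * \<tau>\<^sup>2 + \<sigma>\<^sup>2 * (\<theta> + e ^ 4 / \<theta>)"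
  proof -
    have "2 * e\<^sup>2 \<le> \<theta> + e ^ 4 / \<theta>" using two_square_le_weighted[OF \<theta>] .
    then have "\<sigma>\<^sup>2 * (2 * e\<^sup>2) \<le> \<sigma>\<^sup>2 * (\<theta> + e ^ 4 / \<theta>)" by (rule mult_left_mono) simp
    then show ?thesis by simp
  qed
  finally show ?thesis by (simp add: e_def)
qed

text \<open>If the output is off by \<open>\<tau> + \<sigma> e\<close>, at least half of the blocks in the window are off by as much in the same
  direction. At least \<open>s\<close> of these are good, and the noise medians of good blocks can only be responsible if they are
  at least \<open>e\<close> in absolute value; hence \<open>s e\<^sup>4\<close> is at most the sum of their fourth powers.\<close>

lemma contaminated_window_error:
  assumes W: "finite W" "W \<noteq> {}" and G: "G \<subseteq> W" and \<sigma>: "0 < \<sigma>" and \<theta>: "0 < \<theta>" and \<tau>: "0 \<le> \<tau>"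
    and s: "0 < s" "2 * s \<le> real (card W) - 2 * real (card (W - G))"
    and up: "\<And>k. k \<in> G \<Longrightarrow> y k \<le> a + \<tau> + \<sigma> * \<xi> k" and lo: "\<And>k. k \<in> G \<Longrightarrow> a - \<tau> + \<sigma> * \<xi> k \<le> y k"
  shows "(Median W y - a)\<^sup>2 \<le> 2 * \<tau>\<^sup>2 + \<sigma>\<^sup>2 * (\<theta> + (\<Sum>k\<in>G. (\<xi> k) ^ 4) / (s * \<theta>))"
proof -
  have finG: "finite G" using G W finite_subset by blast
  define e where "e = max 0 ((\<bar>Median W y - a\<bar> - \<tau>) / \<sigma>)"
  have e0: "0 \<le> e" by (simp add: e_def)
  have le: "\<bar>Median W y - a\<bar> \<le> \<tau> + \<sigma> * e"
  proof -
    have "(\<bar>Median W y - a\<bar> - \<tau>) / \<sigma> \<le> e" by (simp add: e_def)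
    then show ?thesis using \<sigma> by (simp add: field_simps)
  qed
  have many: "s * e ^ 4 \<le> (\<Sum>k\<in>G. (\<xi> k) ^ 4)"
  proof (cases "e = 0")
    case True then show ?thesis by (simp add: sum_nonneg)
  next
    case False
    then have ep: "0 < e" "\<bar>Median W y - a\<bar> = \<tau> + \<sigma> * e"
      using e0 \<sigma> by (auto simp: e_def max_def split: if_splits)
    have "s \<le> real (card {k \<in> G. e \<le> \<bar>\<xi> k\<bar>})"
    proof -
      have cb: "card B \<le> card (W - G) + card {k \<in> G. e \<le> \<bar>\<xi> k\<bar>}" if "B \<subseteq> (W - G) \<union> {k \<in> G. e \<le> \<bar>\<xi> k\<bar>}" for B
        using card_mono[OF _ that] card_Un_le[of "W - G" "{k \<in> G. e \<le> \<bar>\<xi> k\<bar>}"] W(1) finG by fastforce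
      consider "a + \<tau> + \<sigma> * e \<le> Median W y" | "Median W y \<le> a - \<tau> - \<sigma> * e" using ep(2) by linarith
      then have "card W \<le> 2 * (card (W - G) + card {k \<in> G. e \<le> \<bar>\<xi> k\<bar>})"
      proof cases
        case 1
        have "card {k \<in> W. a + \<tau> + \<sigma> * e \<le> y k} \<le> card (W - G) + card {k \<in> G. e \<le> \<bar>\<xi> k\<bar>}"
        proof (rule cb)
          show "{k \<in> W. a + \<tau> + \<sigma> * e \<le> y k} \<subseteq> (W - G) \<union> {k \<in> G. e \<le> \<bar>\<xi> k\<bar>}"
        proof safe
          fix k assume k: "k \<in> W" "a + \<tau> + \<sigma> * e \<le> y k" "k \<in> G"
          then have "\<sigma> * e \<le> \<sigma> * \<xi> k" using up[of k] by linarith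
          then have "e \<le> \<xi> k" using \<sigma> by simp
          then show "e \<le> \<bar>\<xi> k\<bar>" by linarith
        qed
        qed
        then show ?thesis by (rule order_trans[OF card_ge_of_le_Median[OF W 1] mult_le_mono2])
      next
        case 2
        have "card {k \<in> W. y k \<le> a - \<tau> - \<sigma> * e} \<le> card (W - G) + card {k \<in> G. e \<le> \<bar>\<xi> k\<bar>}"
        proof (rule cb)
          show "{k \<in> W. y k \<le> a - \<tau> - \<sigma> * e} \<subseteq> (W - G) \<union> {k \<in> G. e \<le> \<bar>\<xi> k\<bar>}"
        proof safe
          fix k assume k: "k \<in> W" "y k \<le> a - \<tau> - \<sigma> * e" "k \<in> G"
          then have "\<sigma> * \<xi> k \<le> \<sigma> * (- e)" using lo[of k] by simp
          then have "\<xi> k \<le> - e" using \<sigma> by (metis mult_le_cancel_left_pos)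
          then show "e \<le> \<bar>\<xi> k\<bar>" by linarith
        qed
        qed
        then show ?thesis by (rule order_trans[OF card_le_of_Median_le[OF W 2] mult_le_mono2])
      qed
      then have "real (card W) \<le> real (2 * (card (W - G) + card {k \<in> G. e \<le> \<bar>\<xi> k\<bar>}))"
        by (simp only: of_nat_le_iff)
      then have "real (card W) \<le> 2 * real (card (W - G)) + 2 * real (card {k \<in> G. e \<le> \<bar>\<xi> k\<bar>})" by simp
      then show ?thesis using s(2) by argo
    qed
    then have "s * e ^ 4 \<le> real (card {k \<in> G. e \<le> \<bar>\<xi> k\<bar>}) * e ^ 4" by (intro mult_right_mono) auto
    also have "\<dots> = (\<Sum>k\<in>{k \<in> G. e \<le> \<bar>\<xi> k\<bar>}. e ^ 4)" by simp
    also have "\<dots> \<le> (\<Sum>k\<in>{k \<in> G. e \<le> \<bar>\<xi> k\<bar>}. (\<xi> k) ^ 4)"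
    proof (rule sum_mono)
      fix k assume "k \<in> {k \<in> G. e \<le> \<bar>\<xi> k\<bar>}"
      then have "e ^ 4 \<le> \<bar>\<xi> k\<bar> ^ 4" using e0 by (intro power_mono) auto
      then show "e ^ 4 \<le> (\<xi> k) ^ 4" by simp
    qed
    also have "\<dots> \<le> (\<Sum>k\<in>G. (\<xi> k) ^ 4)" using finG by (intro sum_mono2) auto
    finally show ?thesis .
  qed
  have "(Median W y - a)\<^sup>2 \<le> (\<tau> + \<sigma> * e)\<^sup>2" using le by (metis abs_ge_zero power2_abs power_mono)
  also have "\<dots> \<le> 2 * \<tau>\<^sup>2 + 2 * (\<sigma> * e)\<^sup>2"
    using zero_le_power2[of "\<tau> - \<sigma> * e"] by (simp add: power2_eq_square algebra_simps)
  also have "(\<sigma> * e)\<^sup>2 = \<sigma>\<^sup>2 * e\<^sup>2" by (simp add: power_mult_distrib)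
  also have "2 * \<tau>\<^sup>2 + 2 * (\<sigma>\<^sup>2 * e\<^sup>2) \<le> 2 * \<tau>\<^sup>2 + \<sigma>\<^sup>2 * (\<theta> + (\<Sum>k\<in>G. (\<xi> k) ^ 4) / (s * \<theta>))"
  proof -
    have "e ^ 4 \<le> (\<Sum>k\<in>G. (\<xi> k) ^ 4) / s" using many s by (simp add: field_simps)
    then have "e ^ 4 / \<theta> \<le> (\<Sum>k\<in>G. (\<xi> k) ^ 4) / s / \<theta>" using \<theta> by (intro divide_right_mono) auto
    then have "2 * e\<^sup>2 \<le> \<theta> + (\<Sum>k\<in>G. (\<xi> k) ^ 4) / (s * \<theta>)" using two_square_le_weighted[OF \<theta>, of e] by simp
    then have "\<sigma>\<^sup>2 * (2 * e\<^sup>2) \<le> \<sigma>\<^sup>2 * (\<theta> + (\<Sum>k\<in>G. (\<xi> k) ^ 4) / (s * \<theta>))" by (rule mult_left_mono) simp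
    then show ?thesis by simp
  qed
  finally show ?thesis .
qed

section \<open>Piecewise Lipschitz signals\<close>

text \<open>For every \<open>\<gamma> > \<beta>\<close> the bound with \<open>\<gamma>\<close> holds on short intervals around each point and is additive under
  concatenation, so subdivision (\<open>Bolzano\<close>) extends it to the whole interval.\<close>

lemma local_lip_imp_lipschitz:
  assumes ab: "0 \<le> a" "a \<le> b" "b \<le> 1" and L: "\<And>t. a \<le> t \<Longrightarrow> t \<le> b \<Longrightarrow> local_lip f t \<le> ereal \<beta>"
  shows "\<bar>f b - f a\<bar> \<le> \<beta> * (b - a)"
proof -
  have step: "\<bar>f b - f a\<bar> \<le> \<gamma> * (b - a)" if \<gamma>: "\<beta> < \<gamma>" for \<gamma>
  proof -
    define P where "P = (\<lambda>u v. a \<le> u \<longrightarrow> v \<le> b \<longrightarrow> \<bar>f v - f u\<bar> \<le> \<gamma> * (v - u))"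
    have "P a b"
    proof (rule Bolzano[OF ab(2)])
      fix u v w assume "P u v" "P v w" "u \<le> v" "v \<le> w"
      then show "P u w"
        unfolding P_def by (force simp: algebra_simps abs_le_iff)
    next
      fix x assume x: "a \<le> x" "x \<le> b"
      define g where "g = (\<lambda>\<epsilon>. SUP y\<in>{y \<in> {0..1}. \<bar>y - x\<bar> \<le> \<epsilon> \<and> y \<noteq> x}. ereal (\<bar>f y - f x\<bar> / \<bar>y - x\<bar>))"
      have "Limsup (at_right 0) g < ereal \<gamma>"
        using L[OF x] \<gamma> unfolding local_lip_def g_def by (meson le_less_trans less_ereal.simps(1))
      then have "eventually (\<lambda>\<epsilon>. g \<epsilon> < ereal \<gamma>) (at_right 0)" by (rule Limsup_lessD)
      then obtain d where d: "0 < d" "\<And>\<epsilon>. 0 < \<epsilon> \<Longrightarrow> \<epsilon> < d \<Longrightarrow> g \<epsilon> < ereal \<gamma>"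
        unfolding eventually_at_right_field by blast
      have near: "\<bar>f y - f x\<bar> \<le> \<gamma> * \<bar>y - x\<bar>" if y: "y \<in> {0..1}" "\<bar>y - x\<bar> < d / 2" for y
      proof (cases "y = x")
        case False
        have "ereal (\<bar>f y - f x\<bar> / \<bar>y - x\<bar>) \<le> g (d / 2)"
          unfolding g_def using y False by (intro SUP_upper) auto
        also have "\<dots> < ereal \<gamma>" using d by auto
        finally show ?thesis using False by (simp add: field_simps)
      qed simp
      show "\<exists>d>0. \<forall>u v. u \<le> x \<and> x \<le> v \<and> v - u < d \<longrightarrow> P u v"
      proof (intro exI conjI allI impI)
        fix u v assume uv: "u \<le> x \<and> x \<le> v \<and> v - u < d / 2"
        show "P u v"
          unfolding P_def
        proof (intro impI)
          assume "a \<le> u" "v \<le> b"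
          then have "\<bar>f u - f x\<bar> \<le> \<gamma> * \<bar>u - x\<bar>" "\<bar>f v - f x\<bar> \<le> \<gamma> * \<bar>v - x\<bar>"
            using uv ab \<open>a \<le> u\<close> \<open>v \<le> b\<close> near[of u] near[of v] by simp_all
          moreover have "\<gamma> * \<bar>u - x\<bar> + \<gamma> * \<bar>v - x\<bar> = \<gamma> * (v - u)" using uv by (simp add: algebra_simps)
          ultimately show "\<bar>f v - f u\<bar> \<le> \<gamma> * (v - u)" by linarith
        qed
      qed (use d in auto)
    qed
    then show ?thesis using ab unfolding P_def by simp
  qed
  show ?thesis
  proof (rule field_le_epsilon)
    fix e :: real assume e: "0 < e"
    have "\<bar>f b - f a\<bar> \<le> (\<beta> + e) * (b - a)" using e by (intro step) auto
    moreover have "e * (b - a) \<le> e * 1" using e ab by (intro mult_left_mono) auto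
    ultimately show "\<bar>f b - f a\<bar> \<le> \<beta> * (b - a) + e" by (simp add: algebra_simps)
  qed
qed

text \<open>Pixels before the pixel \<open>\<lceil>n x\<rceil>\<close> lie to the left of \<open>x\<close>, and pixels after it to the right; an irregularity of
  the signal at \<open>x\<close> is invisible in comparisons that do not involve the block of this pixel.\<close>

definition jump_block :: "nat \<Rightarrow> nat \<Rightarrow> real \<Rightarrow> nat" where
  "jump_block n m x = (nat \<lceil>real n * x\<rceil> - 1) div m"

lemma pixel_lipschitz:
  assumes n: "1 \<le> n" and L: "\<And>t. t \<in> {0..1} - X \<Longrightarrow> local_lip f t \<le> ereal \<beta>" and X: "X \<subseteq> {0..1}"
    and ij: "i \<in> {1..n}" "j \<in> {1..n}" "i \<le> j"
    and J: "\<And>x. x \<in> X \<Longrightarrow> \<not> ((i - 1) div m \<le> jump_block n m x \<and> jump_block n m x \<le> (j - 1) div m)"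
  shows "\<bar>f (real j / real n) - f (real i / real n)\<bar> \<le> \<beta> * ((real j - real i) / real n)"
proof -
  have "\<bar>f (real j / real n) - f (real i / real n)\<bar> \<le> \<beta> * (real j / real n - real i / real n)"
  proof (rule local_lip_imp_lipschitz)
    fix t assume t: "real i / real n \<le> t" "t \<le> real j / real n"
    have t2: "real i \<le> real n * t" "real n * t \<le> real j" using t n by (auto simp: field_simps)
    have "t \<notin> X"
    proof
      assume tX: "t \<in> X"
      have "i \<le> nat \<lceil>real n * t\<rceil>" "nat \<lceil>real n * t\<rceil> \<le> j" using t2 by linarith+
      then have "(i - 1) div m \<le> jump_block n m t" "jump_block n m t \<le> (j - 1) div m"
        unfolding jump_block_def by (auto intro!: div_le_mono diff_le_mono)
      then show False using J[OF tX] by simp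
    qed
    moreover have "0 \<le> real i / real n" "real j / real n \<le> 1" using ij n by auto
    then have "0 \<le> t" "t \<le> 1" using t by linarith+
    ultimately show "local_lip f t \<le> ereal \<beta>" by (intro L) auto
  qed (use ij n in \<open>auto simp: divide_right_mono\<close>)
  then show ?thesis by (simp add: diff_divide_distrib)
qed

lemma jump_block_bounds:
  assumes "1 \<le> m" "0 < real n * x"
  shows "real n * x \<le> (real (jump_block n m x) + 1) * real m"
    and "real (jump_block n m x) * real m < real n * x"
proof -
  define p where "p = nat \<lceil>real n * x\<rceil>"
  have p: "real n * x \<le> real p" "real p < real n * x + 1" "1 \<le> p" using assms unfolding p_def by linarith+
  have k: "jump_block n m x = (p - 1) div m" by (simp add: jump_block_def p_def)
  have "p - 1 < (p - 1) div m * m + m"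
    using assms by (metis div_mult_mod_eq add_less_cancel_left mod_less_divisor zero_less_one less_le_trans)
  then have "p \<le> (jump_block n m x + 1) * m" unfolding k by simp
  then have "real p \<le> real ((jump_block n m x + 1) * m)" by (simp only: of_nat_le_iff)
  then show "real n * x \<le> (real (jump_block n m x) + 1) * real m" using p by (simp add: algebra_simps)
  have "jump_block n m x * m \<le> p - 1" unfolding k by simp
  then have "jump_block n m x * m + 1 \<le> p" using p by linarith
  then have "real (jump_block n m x * m + 1) \<le> real p" by (simp only: of_nat_le_iff)
  then show "real (jump_block n m x) * real m < real n * x" using p by simp
qed

text \<open>Windows shorter than \<open>\<eta>\<close> meet at most one irregularity of the signal, and none if they are cut off by an end of
  the interval.\<close>

lemma jump_blocks_separated:
  assumes n: "1 \<le> n" "1 \<le> m" and \<eta>: "0 < \<eta>" and large: "real ((2 * w + 2) * m) \<le> \<eta> * real n"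
    and x: "\<eta> \<le> x" "x \<le> 1 - \<eta>"
  shows "2 * w \<le> jump_block n m x" "jump_block n m x + 2 * w < last_block n m"
    and "y \<in> {0..1} \<Longrightarrow> \<eta> \<le> y - x \<Longrightarrow> jump_block n m x + 2 * w < jump_block n m y"
proof -
  define k where "k = jump_block n m x"
  have nx: "0 < real n * x" using n \<eta> x by auto
  have k: "real n * x \<le> (real k + 1) * real m" "real k * real m < real n * x"
    using jump_block_bounds[OF n(2) nx] by (auto simp: k_def)
  have c: "(2 * real w + 2) * real m \<le> \<eta> * real n" using large by (simp add: algebra_simps)
  have m: "0 < real m" using n by simp
  have "(2 * real w + 2) * real m \<le> (real k + 1) * real m"
    using c k(1) mult_left_mono[OF x(1), of "real n"] by (simp add: mult.commute)
  then have "2 * real w + 2 \<le> real k + 1" using m by simp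
  then show "2 * w \<le> jump_block n m x" unfolding k_def[symmetric] by linarith
  have "real k * real m < real n - \<eta> * real n" using k(2) mult_left_mono[OF x(2), of "real n"] by (simp add: algebra_simps)
  then have "(real k + (2 * real w + 2)) * real m < real n" using c by (simp add: algebra_simps)
  moreover have "n \<le> (last_block n m + 1) * m" by (rule last_block_bounds(2)[OF n(2,1)])
  then have "real n \<le> (real (last_block n m) + 1) * real m" by (metis of_nat_1 of_nat_add of_nat_le_iff of_nat_mult)
  ultimately have "(real k + (2 * real w + 2)) * real m < (real (last_block n m) + 1) * real m" by linarith
  then have "real k + (2 * real w + 2) < real (last_block n m) + 1" using m by simp
  then show "jump_block n m x + 2 * w < last_block n m" unfolding k_def[symmetric] by linarith
  assume y: "y \<in> {0..1}" "\<eta> \<le> y - x"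
  define l where "l = jump_block n m y"
  have "0 < real n * y" using n \<eta> x y by auto
  then have l: "real n * y \<le> (real l + 1) * real m" using jump_block_bounds(1)[OF n(2)] by (auto simp: l_def)
  have "\<eta> * real n \<le> real n * y - real n * x" using mult_left_mono[OF y(2), of "real n"] by (simp add: algebra_simps)
  then have "(real k + (2 * real w + 2)) * real m < (real l + 1) * real m" using c k l by (simp add: algebra_simps)
  then have "real k + (2 * real w + 2) < real l + 1" using m by simp
  then show "jump_block n m x + 2 * w < jump_block n m y" unfolding k_def[symmetric] l_def[symmetric] by linarith
qed

section \<open>Moments of block and window medians\<close>

lemma (in prob_space) nn_integral_affine_le:
  assumes S [measurable]: "S \<in> borel_measurable M" and S0: "\<And>\<omega>. 0 \<le> S \<omega>"
    and B: "(\<integral>\<^sup>+\<omega>. ennreal (S \<omega>) \<partial>M) \<le> ennreal B" and ab: "0 \<le> a" "0 \<le> b" "0 \<le> B"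
    and h: "\<And>\<omega>. h \<omega> \<le> a + b * S \<omega>"
  shows "(\<integral>\<^sup>+\<omega>. ennreal (h \<omega>) \<partial>M) \<le> ennreal (a + b * B)"
proof -
  have "(\<integral>\<^sup>+\<omega>. ennreal (h \<omega>) \<partial>M) \<le> (\<integral>\<^sup>+\<omega>. ennreal a + ennreal b * ennreal (S \<omega>) \<partial>M)"
  proof (intro nn_integral_mono)
    fix \<omega>
    have "ennreal (h \<omega>) \<le> ennreal (a + b * S \<omega>)" using h by (rule ennreal_leI)
    also have "\<dots> = ennreal a + ennreal b * ennreal (S \<omega>)" using ab S0 by (simp add: ennreal_mult')
    finally show "ennreal (h \<omega>) \<le> ennreal a + ennreal b * ennreal (S \<omega>)" .
  qed
  also have "\<dots> = ennreal a + ennreal b * (\<integral>\<^sup>+\<omega>. ennreal (S \<omega>) \<partial>M)"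
    by (simp add: nn_integral_add nn_integral_cmult emeasure_space_1)
  also have "\<dots> \<le> ennreal a + ennreal b * ennreal B" using B by (intro add_left_mono mult_left_mono) auto
  also have "\<dots> = ennreal (a + b * B)" using ab by (simp add: ennreal_mult')
  finally show ?thesis .
qed

context symmetric_noise
begin

lemma block_Median_prob:
  assumes A: "A \<subseteq> I" "card A = 2 * r + 1" and u: "0 \<le> u"
  shows "measure (noise I) {z \<in> space (noise I). u < Median A z} = binom_tail (2 * r + 1) (r + 1) (tail u)"
    and "measure (noise I) {z \<in> space (noise I). Median A z < - u} = binom_tail (2 * r + 1) (r + 1) (tail u)"
proof -
  interpret P: prob_space "noise I" by (rule prob_space_product)
  have ind: "P.indep_vars (\<lambda>_. borel) (\<lambda>i z. z i) A" by (rule P.indep_vars_subset[OF coordinates_indep A(1)])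
  have up: "P.prob {z \<in> space (noise I). u < z i} = tail u" if "i \<in> A" for i
    using coordinate_prob[of i I "{u<..}"] that A by (auto simp: tail_def)
  have dn: "P.prob {z \<in> space (noise I). z i < - u} = tail u" if "i \<in> A" for i
    using coordinate_prob[of i I "{..<- u}"] that A noise_less by auto
  show "P.prob {z \<in> space (noise I). u < Median A z} = binom_tail (2 * r + 1) (r + 1) (tail u)"
    using P.prob_Median_gt[OF ind A(2) up] by simp
  show "P.prob {z \<in> space (noise I). Median A z < - u} = binom_tail (2 * r + 1) (r + 1) (tail u)"
    using P.prob_Median_less[OF ind A(2) dn] by simp
qed

lemma block_fourth_moment:
  assumes P: "polynomial_profile \<kappa> \<mu> tail" "0 < \<kappa>" "0 < \<mu>"
    and A: "A \<subseteq> I" "card A = 2 * r + 1" "6 \<le> \<mu> * real (card A)"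
  shows "(\<integral>\<^sup>+z. ennreal ((Median A z) ^ 4) \<partial>(noise I)) \<le> ennreal (1584 / (\<kappa> * \<mu> * real (card A))\<^sup>2)"
proof -
  interpret P: prob_space "noise I" by (rule prob_space_product)
  have ind: "P.indep_vars (\<lambda>_. borel) (\<lambda>i z. z i) A" by (rule P.indep_vars_subset[OF coordinates_indep A(1)])
  show ?thesis
  proof (rule P.fourth_moment_Median[OF P ind A(2,3)])
    fix i and u :: real assume iu: "i \<in> A" "0 \<le> u"
    show "P.prob {z \<in> space (noise I). u < z i} = tail u"
      using coordinate_prob[of i I "{u<..}"] iu A by (auto simp: tail_def)
    show "P.prob {z \<in> space (noise I). z i < - u} = tail u"
      using coordinate_prob[of i I "{..<- u}"] iu A noise_less by auto
  qed
qed

text \<open>Block medians of odd blocks again have a polynomial profile once they are multiplied by the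
  square root of the block size, so that the single-scale moment bound applies a second time.\<close>

lemma window_fourth_moment:
  assumes m: "m = 2 * r + 1"
    and Q: "polynomial_profile \<kappa> \<mu> (\<lambda>u. binom_tail m (r + 1) (tail (u / sqrt (real m))))" "0 < \<kappa>" "0 < \<mu>"
    and W: "card W = 2 * w + 1" "6 \<le> \<mu> * real (card W)"
    and A: "\<And>k. k \<in> W \<Longrightarrow> A k \<subseteq> I" "\<And>k. k \<in> W \<Longrightarrow> card (A k) = m" "disjoint_family_on A W"
  shows "(\<integral>\<^sup>+z. ennreal ((Median W (\<lambda>k. Median (A k) z)) ^ 4) \<partial>(noise I))
       \<le> ennreal (1584 / (\<kappa> * \<mu>)\<^sup>2 / (real m * real (card W))\<^sup>2)"
proof -
  interpret P: prob_space "noise I" by (rule prob_space_product)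
  define s where "s = sqrt (real m)"
  have s: "0 < s" "s\<^sup>2 = real m" using m by (auto simp: s_def)
  have s4: "s ^ 4 = (real m)\<^sup>2"
    by (metis s(2) power2_eq_square power4_eq_xxxx mult.assoc)
  have finW: "finite W" "W \<noteq> {}" using W by (auto intro: card_ge_0_finite)
  have finA: "finite (A k)" "A k \<noteq> {}" if "k \<in> W" for k
  proof -
    have "0 < card (A k)" using A(2)[OF that] m by simp
    then show "finite (A k)" "A k \<noteq> {}" by (auto intro: card_ge_0_finite)
  qed
  have "P.indep_vars (\<lambda>_. borel) (\<lambda>k z. Median (A k) z) W"
    using A finA by (intro block_Medians_indep) auto
  then have ind: "P.indep_vars (\<lambda>_. borel) (\<lambda>k z. s * Median (A k) z) W"
    by (rule P.indep_vars_compose2) auto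
  have meas: "(\<lambda>z. Median (A k) z) \<in> borel_measurable (noise I)" if "k \<in> W" for k
    using A(1) finA that by (intro block_Median_measurable)
  have sm: "u < s * v \<longleftrightarrow> u / s < v" "s * v < - u \<longleftrightarrow> v < - (u / s)" for u v using s by (auto simp: field_simps)
  have mom: "(\<integral>\<^sup>+z. ennreal ((Median W (\<lambda>k. s * Median (A k) z)) ^ 4) \<partial>(noise I))
      \<le> ennreal (1584 / (\<kappa> * \<mu> * real (card W))\<^sup>2)"
  proof (rule P.fourth_moment_Median[OF Q ind W])
    fix k and u :: real assume k: "k \<in> W" "0 \<le> u"
    have us: "0 \<le> u / s" using k s by simp
    have ca: "card (A k) = 2 * r + 1" using A(2)[OF k(1)] m by simp
    show "P.prob {z \<in> space (noise I). u < s * Median (A k) z} = binom_tail m (r + 1) (tail (u / sqrt (real m)))"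
      unfolding sm using block_Median_prob(1)[OF A(1)[OF k(1)] ca us] by (simp add: m s_def)
    show "P.prob {z \<in> space (noise I). s * Median (A k) z < - u} = binom_tail m (r + 1) (tail (u / sqrt (real m)))"
      unfolding sm using block_Median_prob(2)[OF A(1)[OF k(1)] ca us] by (simp add: m s_def)
  qed
  define Z where "Z = (\<lambda>z. Median W (\<lambda>k. Median (A k) z))"
  have e: "(Median W (\<lambda>k. s * Median (A k) z)) ^ 4 = (real m)\<^sup>2 * (Z z) ^ 4" for z
    using Median_affine[OF finW s(1), of 0 "\<lambda>k. Median (A k) z"] by (simp add: power_mult_distrib s4 Z_def)
  have Zm [measurable]: "Z \<in> borel_measurable (noise I)"
    unfolding Z_def by (rule borel_measurable_Median[OF finW meas])
  have m2: "0 < (real m)\<^sup>2" using m by simp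
  have "(\<integral>\<^sup>+z. ennreal ((Z z) ^ 4) \<partial>(noise I))
      = (\<integral>\<^sup>+z. ennreal (1 / (real m)\<^sup>2) * ennreal ((real m)\<^sup>2 * (Z z) ^ 4) \<partial>(noise I))"
    using m2 by (intro nn_integral_cong) (subst ennreal_mult'[symmetric], auto)
  also have "\<dots> = ennreal (1 / (real m)\<^sup>2) * (\<integral>\<^sup>+z. ennreal ((real m)\<^sup>2 * (Z z) ^ 4) \<partial>(noise I))"
    by (rule nn_integral_cmult) measurable
  also have "\<dots> \<le> ennreal (1 / (real m)\<^sup>2) * ennreal (1584 / (\<kappa> * \<mu> * real (card W))\<^sup>2)"
    using mom unfolding e by (rule mult_left_mono) simp
  also have "\<dots> = ennreal (1 / (real m)\<^sup>2 * (1584 / (\<kappa> * \<mu> * real (card W))\<^sup>2))"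
    by (rule ennreal_mult'[symmetric]) simp
  also have "1 / (real m)\<^sup>2 * (1584 / (\<kappa> * \<mu> * real (card W))\<^sup>2) = 1584 / (\<kappa> * \<mu>)\<^sup>2 / (real m * real (card W))\<^sup>2"
    by (simp add: power_mult_distrib mult_ac)
  finally show ?thesis by (simp only: Z_def)
qed

end

section \<open>Mean squared error at one pixel\<close>

definition pixel_risk :: "nat \<Rightarrow> real \<Rightarrow> real measure \<Rightarrow> nat \<Rightarrow> nat \<Rightarrow> (real \<Rightarrow> real) \<Rightarrow> nat \<Rightarrow> ennreal" where
  "pixel_risk n \<sigma> \<Psi> m w f i =
     (\<integral>\<^sup>+z. ennreal ((median_filter n m w (observation n \<sigma> f z) i - f (real i / real n))\<^sup>2) \<partial>(\<Pi>\<^sub>M j\<in>{1..n}. \<Psi>))"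

lemma risk_median_filter: "risk n \<sigma> \<Psi> (median_filter n m w) f = (\<Sum>i\<in>{1..n}. pixel_risk n \<sigma> \<Psi> m w f i) / of_nat n"
  by (simp add: risk_def pixel_risk_def)

context symmetric_noise
begin

lemma pixel_risk_clean:
  assumes n: "1 \<le> n" and m: "1 \<le> m" and \<sigma>: "0 < \<sigma>" and i: "i \<in> {1..n}"
    and \<tau>: "0 \<le> \<tau>" "\<And>k j. k \<in> window n m w ((i - 1) div m) \<Longrightarrow> j \<in> pixels n m k \<Longrightarrow>
              \<bar>f (real j / real n) - f (real i / real n)\<bar> \<le> \<tau>"
    and B: "0 < q" "0 \<le> B" "(\<integral>\<^sup>+z. ennreal ((Median (window n m w ((i - 1) div m)) (\<lambda>k. Median (pixels n m k) z)) ^ 4)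
              \<partial>(noise {1..n})) \<le> ennreal (B / q\<^sup>2)"
  shows "pixel_risk n \<sigma> \<Psi> m w f i \<le> ennreal (2 * \<tau>\<^sup>2 + \<sigma>\<^sup>2 * (1 + B) / q)"
proof -
  interpret P: prob_space "noise {1..n}" by (rule prob_space_product)
  define W where "W = window n m w ((i - 1) div m)"
  define Z where "Z = (\<lambda>z. Median W (\<lambda>k. Median (pixels n m k) z))"
  have W: "finite W" "W \<noteq> {}" using window_nonempty[OF block_index_le[OF i]] by (auto simp: W_def)
  have ne: "pixels n m k \<noteq> {}" if "k \<in> W" for k
    using that by (intro pixels_nonempty[OF m n]) (auto simp: W_def window_def)
  have Zm [measurable]: "Z \<in> borel_measurable (noise {1..n})"
    unfolding Z_def by (intro borel_measurable_Median[OF W] block_Median_measurable pixels_subset finite_pixels ne)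
  have "pixel_risk n \<sigma> \<Psi> m w f i \<le> ennreal ((2 * \<tau>\<^sup>2 + \<sigma>\<^sup>2 / q) + \<sigma>\<^sup>2 * q * (B / q\<^sup>2))"
    unfolding pixel_risk_def
  proof (rule P.nn_integral_affine_le)
    show "(\<lambda>z. (Z z) ^ 4) \<in> borel_measurable (noise {1..n})" by measurable
    show "(\<integral>\<^sup>+z. ennreal ((Z z) ^ 4) \<partial>(noise {1..n})) \<le> ennreal (B / q\<^sup>2)"
      using B(3) by (simp add: Z_def W_def)
    fix z
    have "(Median W (\<lambda>k. Median (pixels n m k) (observation n \<sigma> f z)) - f (real i / real n))\<^sup>2
        \<le> 2 * \<tau>\<^sup>2 + \<sigma>\<^sup>2 * (1 / q + (Z z) ^ 4 / (1 / q))"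
      unfolding Z_def
    proof (rule clean_window_error[OF W \<sigma> _ \<tau>(1)])
      fix k assume k: "k \<in> W"
      show "Median (pixels n m k) (observation n \<sigma> f z) \<le> f (real i / real n) + \<tau> + \<sigma> * Median (pixels n m k) z"
        "f (real i / real n) - \<tau> + \<sigma> * Median (pixels n m k) z \<le> Median (pixels n m k) (observation n \<sigma> f z)"
        using block_Median_bounds[of "pixels n m k" \<sigma> "\<lambda>j. f (real j / real n)" "f (real i / real n)" \<tau> z] ne[OF k] \<sigma> \<tau>(2) k
        unfolding observation_def W_def by auto
    qed (use B in auto)
    also have "\<dots> = (2 * \<tau>\<^sup>2 + \<sigma>\<^sup>2 / q) + \<sigma>\<^sup>2 * q * (Z z) ^ 4" by (simp add: algebra_simps)
    finally show "(median_filter n m w (observation n \<sigma> f z) i - f (real i / real n))\<^sup>2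
        \<le> (2 * \<tau>\<^sup>2 + \<sigma>\<^sup>2 / q) + \<sigma>\<^sup>2 * q * (Z z) ^ 4" by (simp add: median_filter_def W_def)
  qed (use B in auto)
  also have "(2 * \<tau>\<^sup>2 + \<sigma>\<^sup>2 / q) + \<sigma>\<^sup>2 * q * (B / q\<^sup>2) = 2 * \<tau>\<^sup>2 + \<sigma>\<^sup>2 * (1 + B) / q"
    using B by (simp add: power2_eq_square field_simps)
  finally show ?thesis .
qed

lemma pixel_risk_contaminated:
  assumes n: "1 \<le> n" and m: "1 \<le> m" and \<sigma>: "0 < \<sigma>" and i: "i \<in> {1..n}"
    and G: "G \<subseteq> window n m w ((i - 1) div m)"
    and s: "0 < s" "2 * s \<le> real (card (window n m w ((i - 1) div m))) - 2 * real (card (window n m w ((i - 1) div m) - G))"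
    and \<tau>: "0 \<le> \<tau>" "\<And>k j. k \<in> G \<Longrightarrow> j \<in> pixels n m k \<Longrightarrow> \<bar>f (real j / real n) - f (real i / real n)\<bar> \<le> \<tau>"
    and B: "0 \<le> B" "\<And>k. k \<in> G \<Longrightarrow> (\<integral>\<^sup>+z. ennreal ((Median (pixels n m k) z) ^ 4) \<partial>(noise {1..n})) \<le> ennreal (B / (real m)\<^sup>2)"
  shows "pixel_risk n \<sigma> \<Psi> m w f i \<le> ennreal (2 * \<tau>\<^sup>2 + \<sigma>\<^sup>2 * (1 + B) * sqrt (real (2 * w + 1) / s) / real m)"
proof -
  interpret P: prob_space "noise {1..n}" by (rule prob_space_product)
  define W where "W = window n m w ((i - 1) div m)"
  have W: "finite W" "W \<noteq> {}" using window_nonempty[OF block_index_le[OF i]] by (auto simp: W_def)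
  have GW: "G \<subseteq> W" using G by (simp add: W_def)
  have finG: "finite G" using GW W finite_subset by blast
  have ne: "pixels n m k \<noteq> {}" if "k \<in> G" for k
    using that GW by (intro pixels_nonempty[OF m n]) (auto simp: W_def window_def)
  define g where "g = real (2 * w + 1)"
  have cg: "real (card G) \<le> g"
    using card_mono[OF W(1) GW] card_window_le[of n m w "(i - 1) div m"] by (simp add: g_def W_def)
  have g0: "0 < g" "0 < real m" using m by (auto simp: g_def)
\<comment> \<open>This \<open>\<theta>\<close> makes the two terms of the error bound equal up to the constant \<open>B\<close>.\<close>
  define \<theta> where "\<theta> = sqrt (g / s) / real m"
  have \<theta>: "0 < \<theta>" using g0 s by (simp add: \<theta>_def)
  have \<theta>2: "g / s / (real m)\<^sup>2 = \<theta>\<^sup>2" using g0 s by (simp add: \<theta>_def power_divide)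
  define S where "S = (\<lambda>z. \<Sum>k\<in>G. (Median (pixels n m k) z) ^ 4)"
  have xm [measurable]: "(\<lambda>z. Median (pixels n m k) z) \<in> borel_measurable (noise {1..n})" if "k \<in> G" for k
    using ne[OF that] by (intro block_Median_measurable pixels_subset) auto
  have Sm: "S \<in> borel_measurable (noise {1..n})" unfolding S_def by (intro borel_measurable_sum) measurable
  have "pixel_risk n \<sigma> \<Psi> m w f i \<le> ennreal ((2 * \<tau>\<^sup>2 + \<sigma>\<^sup>2 * \<theta>) + \<sigma>\<^sup>2 / (s * \<theta>) * (g * (B / (real m)\<^sup>2)))"
    unfolding pixel_risk_def
  proof (rule P.nn_integral_affine_le)
    show "S \<in> borel_measurable (noise {1..n})" by (rule Sm)
    show "0 \<le> S z" for z unfolding S_def by (intro sum_nonneg) auto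
    have "(\<integral>\<^sup>+z. ennreal (S z) \<partial>(noise {1..n})) = (\<integral>\<^sup>+z. (\<Sum>k\<in>G. ennreal ((Median (pixels n m k) z) ^ 4)) \<partial>(noise {1..n}))"
      unfolding S_def by (intro nn_integral_cong) (simp add: sum_ennreal)
    also have "\<dots> = (\<Sum>k\<in>G. \<integral>\<^sup>+z. ennreal ((Median (pixels n m k) z) ^ 4) \<partial>(noise {1..n}))"
      by (intro nn_integral_sum) measurable
    also have "\<dots> \<le> (\<Sum>k\<in>G. ennreal (B / (real m)\<^sup>2))" using B by (intro sum_mono) auto
    also have "\<dots> = ennreal (real (card G) * (B / (real m)\<^sup>2))" using B(1) by (subst sum_ennreal) auto
    also have "\<dots> \<le> ennreal (g * (B / (real m)\<^sup>2))" using cg B by (intro ennreal_leI mult_right_mono) auto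
    finally show "(\<integral>\<^sup>+z. ennreal (S z) \<partial>(noise {1..n})) \<le> ennreal (g * (B / (real m)\<^sup>2))" .
    fix z
    have "(Median W (\<lambda>k. Median (pixels n m k) (observation n \<sigma> f z)) - f (real i / real n))\<^sup>2
        \<le> 2 * \<tau>\<^sup>2 + \<sigma>\<^sup>2 * (\<theta> + (\<Sum>k\<in>G. (Median (pixels n m k) z) ^ 4) / (s * \<theta>))"
    proof (rule contaminated_window_error[OF W GW \<sigma> \<theta> \<tau>(1) s(1)])
      show "2 * s \<le> real (card W) - 2 * real (card (W - G))" using s(2) by (simp add: W_def)
      fix k assume k: "k \<in> G"
      show "Median (pixels n m k) (observation n \<sigma> f z) \<le> f (real i / real n) + \<tau> + \<sigma> * Median (pixels n m k) z"
        "f (real i / real n) - \<tau> + \<sigma> * Median (pixels n m k) z \<le> Median (pixels n m k) (observation n \<sigma> f z)"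
        using block_Median_bounds[of "pixels n m k" \<sigma> "\<lambda>j. f (real j / real n)" "f (real i / real n)" \<tau> z] ne[OF k] \<sigma> \<tau>(2) k
        unfolding observation_def by auto
    qed
    also have "\<dots> = (2 * \<tau>\<^sup>2 + \<sigma>\<^sup>2 * \<theta>) + \<sigma>\<^sup>2 / (s * \<theta>) * S z" by (simp add: S_def algebra_simps)
    finally show "(median_filter n m w (observation n \<sigma> f z) i - f (real i / real n))\<^sup>2
        \<le> (2 * \<tau>\<^sup>2 + \<sigma>\<^sup>2 * \<theta>) + \<sigma>\<^sup>2 / (s * \<theta>) * S z" by (simp add: median_filter_def W_def)
  qed (use B \<theta> s g0 in auto)
  also have "(2 * \<tau>\<^sup>2 + \<sigma>\<^sup>2 * \<theta>) + \<sigma>\<^sup>2 / (s * \<theta>) * (g * (B / (real m)\<^sup>2)) = 2 * \<tau>\<^sup>2 + \<sigma>\<^sup>2 * \<theta> + \<sigma>\<^sup>2 * B * (g / s / (real m)\<^sup>2) / \<theta>"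
    by (simp add: mult_ac)
  also have "\<dots> = 2 * \<tau>\<^sup>2 + \<sigma>\<^sup>2 * (1 + B) * \<theta>" unfolding \<theta>2 using \<theta> by (simp add: power2_eq_square field_simps)
  finally show ?thesis by (simp add: \<theta>_def g_def)
qed

end

section \<open>The upper bound\<close>

lemma sum_inverse_sqrt_le: "(\<Sum>j=1..w. 1 / sqrt (real j)) \<le> 2 * sqrt (real w)"
proof (induction w)
  case (Suc w)
  define a b where "a = sqrt (real w)" and "b = sqrt (real (Suc w))"
  have ab: "0 \<le> a" "a \<le> b" "0 < b" "b\<^sup>2 = a\<^sup>2 + 1" by (auto simp: a_def b_def)
  have "1 = (b - a) * (b + a)" using ab(4) by (simp add: power2_eq_square algebra_simps)
  also have "\<dots> \<le> (b - a) * (2 * b)" using ab by (intro mult_left_mono) auto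
  finally have "1 / b \<le> 2 * b - 2 * a" using ab(3) by (simp add: field_simps)
  then show ?case using Suc.IH by (simp add: a_def b_def)
qed simp

text \<open>The blocks around a jump together cost no more, up to a constant, than \<open>w\<close> blocks with squared error
  \<open>1 / m\<close>, because \<open>1 / \<surd>j\<close> is summed to order \<open>\<surd>w\<close>.\<close>

lemma sum_sqrt_distance_le:
  assumes "w \<le> a"
  shows "(\<Sum>k\<le>F. if a \<noteq> k \<and> \<bar>int a - int k\<bar> \<le> int w then sqrt (real w / \<bar>real a - real k\<bar>) else 0) \<le> 4 * real w"
proof -
  define h where "h = (\<lambda>k. sqrt (real w / \<bar>real a - real k\<bar>))"
  have half: "(\<Sum>j=1..w. sqrt (real w / real j)) \<le> 2 * real w"
  proof -
    have "(\<Sum>j=1..w. sqrt (real w / real j)) = sqrt (real w) * (\<Sum>j=1..w. 1 / sqrt (real j))"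
      by (simp add: real_sqrt_divide sum_distrib_left)
    also have "\<dots> \<le> sqrt (real w) * (2 * sqrt (real w))" by (intro mult_left_mono sum_inverse_sqrt_le) auto
    also have "\<dots> = 2 * (sqrt (real w) * sqrt (real w))" by (simp only: mult_ac)
    also have "\<dots> = 2 * real w" by simp
    finally show ?thesis .
  qed
  have "(\<Sum>k\<le>F. if a \<noteq> k \<and> \<bar>int a - int k\<bar> \<le> int w then h k else 0) = (\<Sum>k\<in>{k. k \<le> F \<and> a \<noteq> k \<and> \<bar>int a - int k\<bar> \<le> int w}. h k)"
    by (subst sum.inter_filter[symmetric]) (auto intro: sum.cong)
  also have "\<dots> \<le> (\<Sum>k\<in>{a - w..<a} \<union> {a<..a + w}. h k)"
    using assms by (intro sum_mono2) (auto simp: h_def)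
  also have "\<dots> = (\<Sum>k\<in>{a - w..<a}. h k) + (\<Sum>k\<in>{a<..a + w}. h k)"
    by (intro sum.union_disjoint) auto
  also have "(\<Sum>k\<in>{a - w..<a}. h k) = (\<Sum>j=1..w. sqrt (real w / real j))"
    using assms by (intro sum.reindex_bij_witness[of _ "\<lambda>j. a - j" "\<lambda>k. a - k"]) (auto simp: h_def)
  also have "(\<Sum>k\<in>{a<..a + w}. h k) = (\<Sum>j=1..w. sqrt (real w / real j))"
    by (intro sum.reindex_bij_witness[of _ "\<lambda>j. a + j" "\<lambda>k. k - a"]) (auto simp: h_def)
  finally show ?thesis using half unfolding h_def by linarith
qed

lemma sum_over_pixels_le:
  assumes n: "1 \<le> n" "1 \<le> m" and g: "\<And>k. 0 \<le> g k"
  shows "(\<Sum>i\<in>{1..n}. g ((i - 1) div m)) \<le> real m * (\<Sum>k\<le>last_block n m. g k :: real)"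
proof -
  have "(\<Sum>i\<in>{1..n}. g ((i - 1) div m)) = (\<Sum>k\<le>last_block n m. \<Sum>i\<in>{i \<in> {1..n}. (i - 1) div m = k}. g ((i - 1) div m))"
    using block_index_le by (intro sum.group[symmetric]) auto
  also have "\<dots> = (\<Sum>k\<le>last_block n m. real (card (pixels n m k)) * g k)"
  proof (intro sum.cong refl)
    fix k
    have "{i \<in> {1..n}. (i - 1) div m = k} = pixels n m k" using mem_pixels_iff[OF n(2)] by auto
    then show "(\<Sum>i\<in>{i \<in> {1..n}. (i - 1) div m = k}. g ((i - 1) div m)) = real (card (pixels n m k)) * g k"
      using mem_pixels_iff[OF n(2), of _ n k] by simp
  qed
  also have "\<dots> \<le> (\<Sum>k\<le>last_block n m. real m * g k)"
    using card_pixels_le g by (intro sum_mono mult_right_mono) auto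
  finally show ?thesis by (simp add: sum_distrib_left)
qed

text \<open>The summands account for the error of an undisturbed window, for blocks with an irregularity, for windows cut off
  by an end of the interval, and for windows in which block \<open>a\<close> and the blocks beyond it are contaminated.\<close>

definition block_bound :: "nat \<Rightarrow> nat \<Rightarrow> nat \<Rightarrow> nat set \<Rightarrow> real \<Rightarrow> real \<Rightarrow> nat \<Rightarrow> real" where
  "block_bound n m w J \<tau> D k =
     2 * \<tau>\<^sup>2 + D / (real m * real (2 * w + 1))
     + (if k \<in> J then 2 + D else 0)
     + (if k < w \<or> last_block n m \<le> k + w then D / real m else 0)
     + (\<Sum>a\<in>J. if a \<noteq> k \<and> \<bar>int a - int k\<bar> \<le> int w then D * sqrt (real w / \<bar>real a - real k\<bar>) / real m else 0)"

text \<open>At distance \<open>d\<close> from an irregularity, \<open>w + 1 - d\<close> of the \<open>2 w + 1\<close> blocks of the window are contaminated, which leaves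
  \<open>s = d - 1 / 2\<close> in \<open>contaminated_window_error\<close>. Windows at an end of the interval, and those centred at an
  irregularity (where only the bound \<open>1\<close> on differences of the signal is used), discard at most the incomplete last
  block, so that \<open>s\<close> is proportional to \<open>w\<close>.\<close>

lemma (in symmetric_noise) pixel_risk_upper:
  assumes n: "1 \<le> n" and m: "1 \<le> m" and w: "2 \<le> w" "w \<le> last_block n m" and \<sigma>: "0 < \<sigma>" and \<beta>: "0 \<le> \<beta>"
    and f: "\<And>t. t \<in> {0..1} \<Longrightarrow> f t \<in> {0..1}" and L: "\<And>t. t \<in> {0..1} - X \<Longrightarrow> local_lip f t \<le> ereal \<beta>"
    and X: "X \<subseteq> {0..1}" "finite X" and J: "J = jump_block n m ` X"
    and sep: "\<And>a b. a \<in> J \<Longrightarrow> b \<in> J \<Longrightarrow> a < b \<Longrightarrow> a + 2 * w < b"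
    and inner: "\<And>a. a \<in> J \<Longrightarrow> 2 * w \<le> a \<and> a + 2 * w < last_block n m"
    and B: "0 \<le> B" "\<And>k. k < last_block n m \<Longrightarrow>
        (\<integral>\<^sup>+z. ennreal ((Median (pixels n m k) z) ^ 4) \<partial>(noise {1..n})) \<le> ennreal (B / (real m)\<^sup>2)"
      "\<And>k. w \<le> k \<Longrightarrow> k + w < last_block n m \<Longrightarrow>
        (\<integral>\<^sup>+z. ennreal ((Median (window n m w k) (\<lambda>k. Median (pixels n m k) z)) ^ 4) \<partial>(noise {1..n}))
          \<le> ennreal (B / (real m * real (2 * w + 1))\<^sup>2)"
    and i: "i \<in> {1..n}"
  defines "\<tau> \<equiv> \<beta> * (real ((w + 1) * m) / real n)" and "D \<equiv> 4 * \<sigma>\<^sup>2 * (1 + B)"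
  shows "pixel_risk n \<sigma> \<Psi> m w f i \<le> ennreal (block_bound n m w J \<tau> D ((i - 1) div m))"
proof -
  define k where "k = (i - 1) div m"
  define F where "F = last_block n m"
  define W where "W = window n m w k"
  have kF: "k \<le> F" using block_index_le[OF i] by (simp add: k_def F_def)
  have finW: "finite W" by (simp add: W_def)
  have \<tau>0: "0 \<le> \<tau>" using \<beta> by (simp add: \<tau>_def)
  have D0: "0 \<le> D" using B by (simp add: D_def)
  have ik: "k * m + 1 \<le> i" "i \<le> (k + 1) * m"
    using mem_pixels_iff[OF m, of i n k] i by (auto simp: k_def pixels_def)
  have clean: "\<bar>f (real j / real n) - f (real i / real n)\<bar> \<le> \<tau>"
    if k': "k' \<in> W" and j: "j \<in> pixels n m k'"
      and no: "\<And>a. a \<in> J \<Longrightarrow> \<not> (min k k' \<le> a \<and> a \<le> max k k')" for k' j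
  proof -
    have jn: "j \<in> {1..n}" "(j - 1) div m = k'" using j mem_pixels_iff[OF m] by auto
    have kw: "k \<le> k' + w" "k' \<le> k + w" using k' by (auto simp: W_def window_def)
    have jk: "k' * m + 1 \<le> j" "j \<le> (k' + 1) * m" using j by (auto simp: pixels_def)
    have le: "\<beta> * (d / real n) \<le> \<tau>" if "d \<le> real ((w + 1) * m)" for d
      unfolding \<tau>_def using \<beta> that n by (intro mult_left_mono divide_right_mono) auto
    show ?thesis
    proof (cases "i \<le> j")
      case True
      then have kk: "k \<le> k'" unfolding k_def jn(2)[symmetric] by (intro div_le_mono diff_le_mono)
      have "j - i \<le> (k' + 1) * m - (k * m + 1)" using jk ik by linarith
      also have "\<dots> \<le> (k + w + 1) * m - (k * m + 1)" using kw by (intro diff_le_mono mult_le_mono1) auto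
      also have "\<dots> \<le> (w + 1) * m" by (simp add: algebra_simps)
      finally have "real (j - i) \<le> real ((w + 1) * m)" by (simp only: of_nat_le_iff)
      then have d: "real j - real i \<le> real ((w + 1) * m)" using True by (simp add: of_nat_diff)
      have "\<bar>f (real j / real n) - f (real i / real n)\<bar> \<le> \<beta> * ((real j - real i) / real n)"
      proof (rule pixel_lipschitz[OF n L X(1) i jn(1) True])
        fix x assume "x \<in> X"
        then show "\<not> ((i - 1) div m \<le> jump_block n m x \<and> jump_block n m x \<le> (j - 1) div m)"
          unfolding jn(2) k_def[symmetric] using no[of "jump_block n m x"] kk J by auto
      qed
      then show ?thesis using le[OF d] by linarith
    next
      case False
      then have kk: "k' \<le> k" unfolding k_def jn(2)[symmetric] by (intro div_le_mono diff_le_mono) auto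
      have "i - j \<le> (k + 1) * m - (k' * m + 1)" using jk ik by linarith
      also have "\<dots> \<le> (k' + w + 1) * m - (k' * m + 1)" using kw by (intro diff_le_mono mult_le_mono1) auto
      also have "\<dots> \<le> (w + 1) * m" by (simp add: algebra_simps)
      finally have "real (i - j) \<le> real ((w + 1) * m)" by (simp only: of_nat_le_iff)
      then have d: "real i - real j \<le> real ((w + 1) * m)" using False by (simp add: of_nat_diff)
      have "\<bar>f (real i / real n) - f (real j / real n)\<bar> \<le> \<beta> * ((real i - real j) / real n)"
      proof (rule pixel_lipschitz[OF n L X(1) jn(1) i])
        fix x assume "x \<in> X"
        then show "\<not> ((j - 1) div m \<le> jump_block n m x \<and> jump_block n m x \<le> (i - 1) div m)"
          unfolding jn(2) k_def[symmetric] using no[of "jump_block n m x"] kk J by auto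
      qed (use False in auto)
      then show ?thesis using le[OF d] by linarith
    qed
  qed
  have cW: "w + 1 \<le> card W" unfolding W_def using kF w by (intro card_window_ge) (auto simp: F_def)
  have bb: "block_bound n m w J \<tau> D k = 2 * \<tau>\<^sup>2 + D / (real m * real (2 * w + 1))
     + (if k \<in> J then 2 + D else 0) + (if k < w \<or> F \<le> k + w then D / real m else 0)
     + (\<Sum>a\<in>J. if a \<noteq> k \<and> \<bar>int a - int k\<bar> \<le> int w then D * sqrt (real w / \<bar>real a - real k\<bar>) / real m else 0)"
    by (simp add: block_bound_def F_def)
  have fJ: "finite J" using J X by simp
  have nonneg: "0 \<le> 2 * \<tau>\<^sup>2" "0 \<le> D / (real m * real (2 * w + 1))"
     "0 \<le> (if k \<in> J then 2 + D else 0)" "0 \<le> (if k < w \<or> F \<le> k + w then D / real m else 0)"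
     "0 \<le> (\<Sum>a\<in>J. if a \<noteq> k \<and> \<bar>int a - int k\<bar> \<le> int w then D * sqrt (real w / \<bar>real a - real k\<bar>) / real m else 0)"
    using D0 by (auto intro!: sum_nonneg)
  have last: "pixel_risk n \<sigma> \<Psi> m w f i \<le> ennreal (2 * \<rho>\<^sup>2 + D / real m)"
    if \<rho>: "0 \<le> \<rho>" "\<And>k' j. k' \<in> W - {F} \<Longrightarrow> j \<in> pixels n m k' \<Longrightarrow> \<bar>f (real j / real n) - f (real i / real n)\<bar> \<le> \<rho>" for \<rho>
  proof -
    define s where "s = (real w - 1) / 2"
    have s: "0 < s" using w by (simp add: s_def)
    have "card (W - (W - {F})) \<le> card {F}" by (intro card_mono) auto
    then have s2: "2 * s \<le> real (card W) - 2 * real (card (W - (W - {F})))" using cW w by (simp add: s_def)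
    have "pixel_risk n \<sigma> \<Psi> m w f i \<le> ennreal (2 * \<rho>\<^sup>2 + \<sigma>\<^sup>2 * (1 + B) * sqrt (real (2 * w + 1) / s) / real m)"
    proof (rule pixel_risk_contaminated[OF n m \<sigma> i _ s _ \<rho>(1)])
      show "W - {F} \<subseteq> window n m w ((i - 1) div m)" by (auto simp: W_def k_def)
      show "2 * s \<le> real (card (window n m w ((i - 1) div m))) - 2 * real (card (window n m w ((i - 1) div m) - (W - {F})))"
        using s2 by (simp add: W_def k_def)
      show "0 \<le> B" by (rule B(1))
      show "(\<integral>\<^sup>+z. ennreal ((Median (pixels n m k) z) ^ 4) \<partial>(noise {1..n})) \<le> ennreal (B / (real m)\<^sup>2)" if "k \<in> W - {F}" for k
        using that by (intro B(2)) (auto simp: W_def window_def F_def)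
    qed (use \<rho>(2) in auto)
    also have "\<dots> \<le> ennreal (2 * \<rho>\<^sup>2 + D / real m)"
    proof (intro ennreal_leI add_left_mono divide_right_mono)
      have "real (2 * w + 1) / s \<le> 16" using w s by (simp add: s_def field_simps)
      then have "sqrt (real (2 * w + 1) / s) \<le> sqrt 16" by (rule real_sqrt_le_mono)
      then have "\<sigma>\<^sup>2 * (1 + B) * sqrt (real (2 * w + 1) / s) \<le> \<sigma>\<^sup>2 * (1 + B) * 4"
        using B by (intro mult_left_mono) auto
      then show "\<sigma>\<^sup>2 * (1 + B) * sqrt (real (2 * w + 1) / s) \<le> D" by (simp add: D_def)
    qed simp
    finally show ?thesis .
  qed
  consider (jump) "k \<in> J" | (border) "k \<notin> J" "k < w \<or> F \<le> k + w"
    | (interior) "k \<notin> J" "w \<le> k" "k + w < F" "\<And>a. a \<in> J \<Longrightarrow> int w < \<bar>int a - int k\<bar>"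
    | (edge) a where "k \<notin> J" "w \<le> k" "k + w < F" "a \<in> J" "\<bar>int a - int k\<bar> \<le> int w"
    by force
  then have "pixel_risk n \<sigma> \<Psi> m w f i \<le> ennreal (block_bound n m w J \<tau> D k)"
  proof cases
    case jump
    have "pixel_risk n \<sigma> \<Psi> m w f i \<le> ennreal (2 * 1\<^sup>2 + D / real m)"
    proof (rule last)
      fix k' j assume "j \<in> pixels n m k'"
      then have "real j / real n \<in> {0..1}" "real i / real n \<in> {0..1}" using i n by (auto simp: pixels_def)
      from f[OF this(1)] f[OF this(2)] show "\<bar>f (real j / real n) - f (real i / real n)\<bar> \<le> 1" by auto
    qed simp
    also have "\<dots> \<le> ennreal (block_bound n m w J \<tau> D k)"
    proof (rule ennreal_leI)
      have "D / real m \<le> D / 1" using D0 m by (intro divide_left_mono) auto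
      moreover have "(if k \<in> J then 2 + D else 0) = 2 + D" using jump by simp
      ultimately show "2 * 1\<^sup>2 + D / real m \<le> block_bound n m w J \<tau> D k"
        unfolding bb one_power2 div_by_1 using nonneg(1,2,4,5) by linarith
    qed
    finally show ?thesis .
  next
    case border
    have "pixel_risk n \<sigma> \<Psi> m w f i \<le> ennreal (2 * \<tau>\<^sup>2 + D / real m)"
    proof (rule last[OF \<tau>0])
      fix k' j assume k': "k' \<in> W - {F}" and j: "j \<in> pixels n m k'"
      show "\<bar>f (real j / real n) - f (real i / real n)\<bar> \<le> \<tau>"
      proof (rule clean[OF _ j])
        fix a assume "a \<in> J"
        then have "2 * w \<le> a" "a + 2 * w < F" using inner by (auto simp: F_def)
        then show "\<not> (min k k' \<le> a \<and> a \<le> max k k')" using border(2) k' by (auto simp: W_def window_def)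
      qed (use k' in auto)
    qed
    also have "\<dots> \<le> ennreal (block_bound n m w J \<tau> D k)"
      using border nonneg(2,5) unfolding bb by (intro ennreal_leI) auto
    finally show ?thesis .
  next
    case interior
    have "pixel_risk n \<sigma> \<Psi> m w f i \<le> ennreal (2 * \<tau>\<^sup>2 + \<sigma>\<^sup>2 * (1 + B) / (real m * real (2 * w + 1)))"
    proof (rule pixel_risk_clean[OF n m \<sigma> i \<tau>0])
      fix k' j assume k': "k' \<in> window n m w ((i - 1) div m)" and j: "j \<in> pixels n m k'"
      then have k'': "k' \<in> W" by (simp add: W_def k_def)
      show "\<bar>f (real j / real n) - f (real i / real n)\<bar> \<le> \<tau>"
      proof (rule clean[OF k'' j])
        fix a assume "a \<in> J"
        then have "int w < \<bar>int a - int k\<bar>" by (rule interior(4))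
        then show "\<not> (min k k' \<le> a \<and> a \<le> max k k')" using k'' by (auto simp: W_def window_def)
      qed
    next
      show "0 < real m * real (2 * w + 1)" using m by simp
      show "(\<integral>\<^sup>+z. ennreal ((Median (window n m w ((i - 1) div m)) (\<lambda>k. Median (pixels n m k) z)) ^ 4) \<partial>(noise {1..n}))
          \<le> ennreal (B / (real m * real (2 * w + 1))\<^sup>2)"
        using B(3)[of k] interior(2,3) by (simp add: k_def F_def)
    qed (rule B(1))
    also have "\<dots> \<le> ennreal (block_bound n m w J \<tau> D k)"
    proof (rule ennreal_leI)
      have "\<sigma>\<^sup>2 * (1 + B) \<le> D" using B by (simp add: D_def)
      then have "\<sigma>\<^sup>2 * (1 + B) / (real m * real (2 * w + 1)) \<le> D / (real m * real (2 * w + 1))"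
        by (intro divide_right_mono) auto
      then show "2 * \<tau>\<^sup>2 + \<sigma>\<^sup>2 * (1 + B) / (real m * real (2 * w + 1)) \<le> block_bound n m w J \<tau> D k"
        unfolding bb using nonneg(3,4,5) by linarith
    qed
    finally show ?thesis .
  next
    case edge
    define d where "d = nat \<bar>int a - int k\<bar>"
    have "a \<noteq> k" using edge by auto
    then have d: "1 \<le> d" "d \<le> w" using edge(5) unfolding d_def by linarith+
    have unique: "b = a" if b: "b \<in> J" "\<bar>int b - int k\<bar> \<le> int w" for b
    proof (rule ccontr)
      assume "b \<noteq> a"
      then have "a + 2 * w < b \<or> b + 2 * w < a" using sep[OF edge(4) b(1)] sep[OF b(1) edge(4)] by linarith
      then show False using b(2) edge(5) by linarith
    qed
    define G where "G = (if k < a then {k - w..<a} else {a<..k + w})"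
    have Wi: "W = {k - w..k + w}" "card W = 2 * w + 1"
      using window_interior[of w k n m] edge by (auto simp: W_def F_def)
    have GW: "G \<subseteq> W" unfolding Wi G_def using edge by auto
    have "W - G = (if k < a then {a..k + w} else {k - w..a})" unfolding Wi G_def using edge by auto
    then have bad: "card (W - G) = w + 1 - d"
    proof (cases "k < a")
      case True
      then have "card (W - G) = k + w + 1 - a" using \<open>W - G = _\<close> by simp
      moreover have "d = a - k" using True by (simp add: d_def)
      ultimately show ?thesis using True by linarith
    next
      case False
      then have ak: "a < k" using edge by (metis linorder_neqE_nat)
      then have "card (W - G) = a + 1 - (k - w)" using \<open>W - G = _\<close> by simp
      moreover have "d = k - a" using ak by (simp add: d_def)
      ultimately show ?thesis using ak edge(2) d(2) by linarith
    qed
    define s where "s = real d - 1 / 2"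
    have s: "0 < s" "real d / 2 \<le> s" using d by (auto simp: s_def)
    have s2: "2 * s \<le> real (card W) - 2 * real (card (W - G))"
      unfolding Wi(2) bad s_def using d by (simp add: of_nat_diff)
    have "pixel_risk n \<sigma> \<Psi> m w f i \<le> ennreal (2 * \<tau>\<^sup>2 + \<sigma>\<^sup>2 * (1 + B) * sqrt (real (2 * w + 1) / s) / real m)"
    proof (rule pixel_risk_contaminated[OF n m \<sigma> i _ s(1) _ \<tau>0])
      show "G \<subseteq> window n m w ((i - 1) div m)" using GW by (simp add: W_def k_def)
      show "2 * s \<le> real (card (window n m w ((i - 1) div m))) - 2 * real (card (window n m w ((i - 1) div m) - G))"
        using s2 by (simp add: W_def k_def)
      show "0 \<le> B" by (rule B(1))
      show "(\<integral>\<^sup>+z. ennreal ((Median (pixels n m k') z) ^ 4) \<partial>(noise {1..n})) \<le> ennreal (B / (real m)\<^sup>2)" if "k' \<in> G" for k'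
      proof (rule B(2))
        have "k' \<le> k + w" using that GW by (auto simp: Wi)
        then show "k' < last_block n m" using edge(3) by (simp add: F_def)
      qed
      fix k' j assume k': "k' \<in> G" and j: "j \<in> pixels n m k'"
      show "\<bar>f (real j / real n) - f (real i / real n)\<bar> \<le> \<tau>"
      proof (rule clean[OF _ j])
        show k'': "k' \<in> W" using k' GW by auto
        fix b assume b: "b \<in> J"
        show "\<not> (min k k' \<le> b \<and> b \<le> max k k')"
        proof
          assume bt: "min k k' \<le> b \<and> b \<le> max k k'"
          have "\<bar>int k' - int k\<bar> \<le> int w" using k'' by (auto simp: Wi)
          then have "\<bar>int b - int k\<bar> \<le> int w" using bt by (auto simp: min_def max_def split: if_splits)
          then have "b = a" by (rule unique[OF b])
          then show False using bt k' edge(1,4) by (auto simp: G_def min_def max_def split: if_splits)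
        qed
      qed
    qed
    also have "\<dots> \<le> ennreal (2 * \<tau>\<^sup>2 + D * sqrt (real w / real d) / real m)"
    proof (intro ennreal_leI add_left_mono divide_right_mono)
      have "real (2 * w + 1) / s \<le> real (2 * w + 1) / (real d / 2)" using s d by (intro divide_left_mono) auto
      also have "\<dots> \<le> 16 * (real w / real d)" using d w by (simp add: field_simps)
      finally have "sqrt (real (2 * w + 1) / s) \<le> sqrt (16 * (real w / real d))" by (rule real_sqrt_le_mono)
      also have "\<dots> = 4 * sqrt (real w / real d)" unfolding real_sqrt_mult by simp
      finally have "\<sigma>\<^sup>2 * (1 + B) * sqrt (real (2 * w + 1) / s) \<le> \<sigma>\<^sup>2 * (1 + B) * (4 * sqrt (real w / real d))"
        using B by (intro mult_left_mono) auto
      then show "\<sigma>\<^sup>2 * (1 + B) * sqrt (real (2 * w + 1) / s) \<le> D * sqrt (real w / real d)" by (simp add: D_def mult_ac)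
    qed simp
    also have "\<dots> \<le> ennreal (block_bound n m w J \<tau> D k)"
    proof (rule ennreal_leI)
      have "real d = \<bar>real a - real k\<bar>" by (simp add: d_def)
      then have "D * sqrt (real w / real d) / real m
          = (if a \<noteq> k \<and> \<bar>int a - int k\<bar> \<le> int w then D * sqrt (real w / \<bar>real a - real k\<bar>) / real m else 0)"
        using edge by auto
      also have "\<dots> \<le> (\<Sum>a\<in>J. if a \<noteq> k \<and> \<bar>int a - int k\<bar> \<le> int w then D * sqrt (real w / \<bar>real a - real k\<bar>) / real m else 0)"
        using D0 by (intro member_le_sum[OF edge(4) _ fJ]) auto
      finally show "2 * \<tau>\<^sup>2 + D * sqrt (real w / real d) / real m \<le> block_bound n m w J \<tau> D k"
        unfolding bb using nonneg(2,3,4) by linarith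
    qed
    finally show ?thesis .
  qed
  then show ?thesis by (simp add: k_def)
qed

lemma sum_block_bound_le:
  assumes n: "1 \<le> n" "1 \<le> m" and D: "0 \<le> D" and J: "finite J" "card J \<le> N" "\<And>a. a \<in> J \<Longrightarrow> w \<le> a"
    and mn: "m \<le> n"
  shows "(\<Sum>i\<in>{1..n}. block_bound n m w J \<tau> D ((i - 1) div m))
     \<le> 2 * real n * (2 * \<tau>\<^sup>2 + D / (real m * real (2 * w + 1))) + real m * real N * (2 + D) + D * real (2 * w + 1) + 4 * D * real N * real w"
proof -
  define F where "F = last_block n m"
  define c where "c = 2 * \<tau>\<^sup>2 + D / (real m * real (2 * w + 1))"
  have c0: "0 \<le> c" using D by (simp add: c_def)
  have m0: "0 < real m" using n by simp
  have s1: "(\<Sum>k\<le>F. if k \<in> J then 2 + D else 0) \<le> real N * (2 + D)"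
  proof -
    have "(\<Sum>k\<le>F. if k \<in> J then 2 + D else 0) = real (card ({..F} \<inter> J)) * (2 + D)"
      by (simp add: sum.inter_restrict[symmetric])
    also have "card ({..F} \<inter> J) \<le> N" using card_mono[of J "{..F} \<inter> J"] J by auto
    then have "real (card ({..F} \<inter> J)) * (2 + D) \<le> real N * (2 + D)" using D by (intro mult_right_mono) auto
    finally show ?thesis .
  qed
  have s2: "(\<Sum>k\<le>F. if k < w \<or> F \<le> k + w then D / real m else 0) \<le> real (2 * w + 1) * (D / real m)"
  proof -
    have "card {k \<in> {..F}. k < w \<or> F \<le> k + w} \<le> card ({..<w} \<union> {F - w..F})" by (intro card_mono) auto
    also have "\<dots> \<le> card {..<w} + card {F - w..F}" by (rule card_Un_le)
    also have "\<dots> \<le> 2 * w + 1" by simp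
    finally have c: "real (card {k \<in> {..F}. k < w \<or> F \<le> k + w}) \<le> real (2 * w + 1)" by (simp only: of_nat_le_iff)
    have "(\<Sum>k\<le>F. if k < w \<or> F \<le> k + w then D / real m else 0) = real (card {k \<in> {..F}. k < w \<or> F \<le> k + w}) * (D / real m)"
      by (subst sum.inter_filter[symmetric]) auto
    also have "\<dots> \<le> real (2 * w + 1) * (D / real m)" using D by (intro mult_right_mono[OF c]) auto
    finally show ?thesis .
  qed
  have s3: "(\<Sum>k\<le>F. \<Sum>a\<in>J. if a \<noteq> k \<and> \<bar>int a - int k\<bar> \<le> int w then D * sqrt (real w / \<bar>real a - real k\<bar>) / real m else 0)
      \<le> real N * (D / real m * (4 * real w))"
  proof -
    have "(\<Sum>k\<le>F. \<Sum>a\<in>J. if a \<noteq> k \<and> \<bar>int a - int k\<bar> \<le> int w then D * sqrt (real w / \<bar>real a - real k\<bar>) / real m else 0)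
        = (\<Sum>a\<in>J. \<Sum>k\<le>F. if a \<noteq> k \<and> \<bar>int a - int k\<bar> \<le> int w then D * sqrt (real w / \<bar>real a - real k\<bar>) / real m else 0)"
      by (rule sum.swap)
    also have "\<dots> = (\<Sum>a\<in>J. D / real m * (\<Sum>k\<le>F. if a \<noteq> k \<and> \<bar>int a - int k\<bar> \<le> int w then sqrt (real w / \<bar>real a - real k\<bar>) else 0))"
      unfolding sum_distrib_left by (intro sum.cong refl) auto
    also have "\<dots> \<le> (\<Sum>a\<in>J. D / real m * (4 * real w))"
      using D J(3) by (intro sum_mono mult_left_mono sum_sqrt_distance_le) auto
    also have "\<dots> = real (card J) * (D / real m * (4 * real w))" by simp
    also have "\<dots> \<le> real N * (D / real m * (4 * real w))" using J(2) D by (intro mult_right_mono) auto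
    finally show ?thesis .
  qed
  have "(\<Sum>i\<in>{1..n}. block_bound n m w J \<tau> D ((i - 1) div m)) \<le> real m * (\<Sum>k\<le>F. block_bound n m w J \<tau> D k)"
    unfolding F_def
  proof (rule sum_over_pixels_le[OF n])
    show "0 \<le> block_bound n m w J \<tau> D k" for k
      unfolding block_bound_def using D by (intro add_nonneg_nonneg sum_nonneg) auto
  qed
  also have "(\<Sum>k\<le>F. block_bound n m w J \<tau> D k) = real (F + 1) * c
     + (\<Sum>k\<le>F. if k \<in> J then 2 + D else 0) + (\<Sum>k\<le>F. if k < w \<or> F \<le> k + w then D / real m else 0)
     + (\<Sum>k\<le>F. \<Sum>a\<in>J. if a \<noteq> k \<and> \<bar>int a - int k\<bar> \<le> int w then D * sqrt (real w / \<bar>real a - real k\<bar>) / real m else 0)"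
    unfolding block_bound_def F_def[symmetric] c_def[symmetric] sum.distrib by simp
  also have "real m * \<dots> \<le> real m * (real (F + 1) * c + real N * (2 + D) + real (2 * w + 1) * (D / real m) + real N * (D / real m * (4 * real w)))"
    using s1 s2 s3 by (intro mult_left_mono add_mono) auto
  also have "\<dots> = (real m * real (F + 1)) * c + real m * real N * (2 + D) + D * real (2 * w + 1) + 4 * D * real N * real w"
    using m0 by (simp add: algebra_simps)
  also have "\<dots> \<le> 2 * real n * c + real m * real N * (2 + D) + D * real (2 * w + 1) + 4 * D * real N * real w"
  proof -
    have "m * (F + 1) \<le> 2 * n" using last_block_bounds(1)[OF n(2,1)] mn by (simp add: F_def algebra_simps)
    then have "real (m * (F + 1)) \<le> real (2 * n)" by (simp only: of_nat_le_iff)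
    then have "real m * real (F + 1) \<le> 2 * real n" by (simp only: of_nat_mult of_nat_numeral)
    then have "(real m * real (F + 1)) * c \<le> 2 * real n * c" using c0 by (rule mult_right_mono)
    then show ?thesis by linarith
  qed
  finally show ?thesis by (simp only: c_def)
qed


lemma (in symmetric_noise) median_filter_risk_upper:
  assumes P: "polynomial_profile \<kappa> \<mu> tail" "0 < \<kappa>" "0 < \<mu>" and m: "m = 2 * r + 1"
    and Q: "polynomial_profile \<kappa>' \<mu>' (\<lambda>u. binom_tail m (r + 1) (tail (u / sqrt (real m))))" "0 < \<kappa>'" "0 < \<mu>'"
    and large: "6 \<le> \<mu> * real m" "6 \<le> \<mu>' * real (2 * w + 1)" "2 \<le> w" "w * m < n" "real ((2 * w + 2) * m) \<le> \<eta> * real n"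
    and \<sigma>: "0 < \<sigma>" and \<beta>: "0 \<le> \<beta>" and \<eta>: "0 < \<eta>" and f: "f \<in> SEP_PLIP \<eta> \<beta> N"
    and B: "1584 / (\<kappa> * \<mu>)\<^sup>2 \<le> B" "1584 / (\<kappa>' * \<mu>')\<^sup>2 \<le> B"
  defines "\<tau> \<equiv> \<beta> * (real ((w + 1) * m) / real n)" and "D \<equiv> 4 * \<sigma>\<^sup>2 * (1 + B)"
  shows "risk n \<sigma> \<Psi> (median_filter n m w) f \<le> ennreal
    ((2 * real n * (2 * \<tau>\<^sup>2 + D / (real m * real (2 * w + 1))) + real m * real N * (2 + D) + D * real (2 * w + 1)
      + 4 * D * real N * real w) / real n)"
proof -
  have m1: "1 \<le> m" using m by simp
  have mw: "m * 2 \<le> w * m" using large(3) by simp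
  have n: "1 \<le> n" "m \<le> n" using large(4) mw m1 by linarith+
  have B0: "0 \<le> B" using B(1) by (rule order_trans[rotated]) simp
  have D0: "0 \<le> D" using B0 by (simp add: D_def)
  obtain x where x: "well_separated \<eta> N x" and L: "\<And>t. t \<in> {0..1} - x ` {1..N} \<Longrightarrow> local_lip f t \<le> ereal \<beta>"
    and f01: "\<And>t. t \<in> {0..1} \<Longrightarrow> f t \<in> {0..1}" using f by (auto simp: SEP_PLIP_def)
  define X where "X = x ` {1..N}"
  define J where "J = jump_block n m ` X"
  have X: "X \<subseteq> {0..1}" "finite X" using x by (auto simp: X_def well_separated_def)
  have Xin: "\<eta> \<le> y" "y \<le> 1 - \<eta>" if "y \<in> X" for y using x that by (auto simp: X_def well_separated_def)
  have Xsep: "\<eta> \<le> \<bar>y - z\<bar>" if yz: "y \<in> X" "z \<in> X" "y \<noteq> z" for y z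
  proof -
    obtain i j where ij: "i \<in> {1..N}" "j \<in> {1..N}" "y = x i" "z = x j" using yz by (auto simp: X_def)
    then have "j \<noteq> i" using yz by auto
    then show ?thesis using x ij unfolding well_separated_def by blast
  qed
  have cJ: "card J \<le> N"
  proof -
    have "card J \<le> card X" unfolding J_def by (rule card_image_le[OF X(2)])
    also have "\<dots> \<le> card {1..N}" unfolding X_def by (rule card_image_le) simp
    finally show ?thesis by simp
  qed
  have inner: "2 * w \<le> a \<and> a + 2 * w < last_block n m" if a: "a \<in> J" for a
  proof -
    obtain y where "y \<in> X" "a = jump_block n m y" using a by (auto simp: J_def)
    then show ?thesis using jump_blocks_separated(1,2)[OF n(1) m1 \<eta> large(5) Xin] by blast
  qed
  have sep: "a + 2 * w < b" if ab: "a \<in> J" "b \<in> J" "a < b" for a b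
  proof -
    obtain y z where yz: "y \<in> X" "a = jump_block n m y" "z \<in> X" "b = jump_block n m z" using ab by (auto simp: J_def)
    have "\<eta> \<le> \<bar>y - z\<bar>" using yz ab(3) by (intro Xsep) auto
    then consider "\<eta> \<le> z - y" | "\<eta> \<le> y - z" by linarith
    then show ?thesis
    proof cases
      case 1
      then show ?thesis using jump_blocks_separated(3)[OF n(1) m1 \<eta> large(5) Xin[OF yz(1)], of z] yz X by auto
    next
      case 2
      then have "b + 2 * w < a"
        using jump_blocks_separated(3)[OF n(1) m1 \<eta> large(5) Xin[OF yz(3)], of y] yz X by auto
      then show ?thesis using ab by linarith
    qed
  qed
  have wF: "w \<le> last_block n m"
  proof -
    have "w * m \<le> n - 1" using large(4) by linarith
    then show ?thesis using m1 unfolding last_block_def by (simp add: less_eq_div_iff_mult_less_eq)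
  qed
  have B1: "(\<integral>\<^sup>+z. ennreal ((Median (pixels n m k) z) ^ 4) \<partial>(noise {1..n})) \<le> ennreal (B / (real m)\<^sup>2)"
    if k: "k < last_block n m" for k
  proof -
    have c: "card (pixels n m k) = m" by (rule pixels_full(2)[OF m1 n(1) k])
    have "(\<integral>\<^sup>+z. ennreal ((Median (pixels n m k) z) ^ 4) \<partial>(noise {1..n})) \<le> ennreal (1584 / (\<kappa> * \<mu> * real (card (pixels n m k)))\<^sup>2)"
    proof (rule block_fourth_moment[OF P pixels_subset])
      show "card (pixels n m k) = 2 * r + 1" unfolding c by (rule m)
      show "6 \<le> \<mu> * real (card (pixels n m k))" unfolding c by (rule large(1))
    qed
    also have "1584 / (\<kappa> * \<mu> * real (card (pixels n m k)))\<^sup>2 = 1584 / (\<kappa> * \<mu>)\<^sup>2 / (real m)\<^sup>2"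
      by (simp add: c power_mult_distrib)
    also have "ennreal \<dots> \<le> ennreal (B / (real m)\<^sup>2)" using B(1) by (intro ennreal_leI divide_right_mono) auto
    finally show ?thesis .
  qed
  have B2: "(\<integral>\<^sup>+z. ennreal ((Median (window n m w k) (\<lambda>k. Median (pixels n m k) z)) ^ 4) \<partial>(noise {1..n}))
          \<le> ennreal (B / (real m * real (2 * w + 1))\<^sup>2)"
    if k: "w \<le> k" "k + w < last_block n m" for k
  proof -
    have W: "window n m w k = {k - w..k + w}" "card (window n m w k) = 2 * w + 1"
      using window_interior[of w k n m] k by auto
    have "(\<integral>\<^sup>+z. ennreal ((Median (window n m w k) (\<lambda>k. Median (pixels n m k) z)) ^ 4) \<partial>(noise {1..n}))
        \<le> ennreal (1584 / (\<kappa>' * \<mu>')\<^sup>2 / (real m * real (card (window n m w k)))\<^sup>2)"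
    proof (rule window_fourth_moment[OF m Q W(2)])
      show "6 \<le> \<mu>' * real (card (window n m w k))" using large(2) by (simp only: W(2))
      show "card (pixels n m k') = m" if "k' \<in> window n m w k" for k'
        using that k by (intro pixels_full(2)[OF m1 n(1)]) (auto simp: W)
      show "disjoint_family_on (pixels n m) (window n m w k)" by (rule disjoint_pixels[OF m1])
    qed (rule pixels_subset)
    also have "\<dots> \<le> ennreal (B / (real m * real (2 * w + 1))\<^sup>2)"
      unfolding W(2) using B(2) by (intro ennreal_leI divide_right_mono) auto
    finally show ?thesis .
  qed
  have bb0: "0 \<le> block_bound n m w J \<tau> D k" for k
    unfolding block_bound_def using D0 by (intro add_nonneg_nonneg sum_nonneg) auto
  have "(\<Sum>i\<in>{1..n}. pixel_risk n \<sigma> \<Psi> m w f i) \<le> (\<Sum>i\<in>{1..n}. ennreal (block_bound n m w J \<tau> D ((i - 1) div m)))"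
  proof (rule sum_mono)
    fix i assume i: "i \<in> {1..n}"
    show "pixel_risk n \<sigma> \<Psi> m w f i \<le> ennreal (block_bound n m w J \<tau> D ((i - 1) div m))"
      unfolding \<tau>_def D_def
      by (rule pixel_risk_upper[OF n(1) m1 large(3) wF \<sigma> \<beta> f01 L[folded X_def] X J_def sep inner B0 B1 B2 i])
  qed
  also have "\<dots> = ennreal (\<Sum>i\<in>{1..n}. block_bound n m w J \<tau> D ((i - 1) div m))" using bb0 by (subst sum_ennreal) auto
  also have "\<dots> \<le> ennreal (2 * real n * (2 * \<tau>\<^sup>2 + D / (real m * real (2 * w + 1))) + real m * real N * (2 + D) + D * real (2 * w + 1)
      + 4 * D * real N * real w)"
  proof (intro ennreal_leI sum_block_bound_le[OF n(1) m1 D0 _ cJ _ n(2)])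
    show "finite J" using X by (simp add: J_def)
    show "w \<le> a" if "a \<in> J" for a using inner[OF that] by linarith
  qed
  finally have "risk n \<sigma> \<Psi> (median_filter n m w) f \<le> ennreal (2 * real n * (2 * \<tau>\<^sup>2 + D / (real m * real (2 * w + 1)))
      + real m * real N * (2 + D) + D * real (2 * w + 1) + 4 * D * real N * real w) / of_nat n"
    unfolding risk_median_filter by (rule divide_right_mono_ennreal)
  also have "\<dots> = ennreal ((2 * real n * (2 * \<tau>\<^sup>2 + D / (real m * real (2 * w + 1))) + real m * real N * (2 + D) + D * real (2 * w + 1)
      + 4 * D * real N * real w) / real n)"
    using n(1) D0 by (subst divide_ennreal[symmetric]) (auto simp: ennreal_of_nat_eq_real_of_nat)
  finally show ?thesis .
qed

lemma tuned_bound_le: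
  fixes n r N :: nat and \<beta> :: real
  assumes y: "y = real n powr (1 / 3)" "3 \<le> y" and r: "r = nat \<lfloor>y\<rfloor>" and D: "0 \<le> D"
  defines "m \<equiv> 2 * r + 1" and "\<tau> \<equiv> \<beta> * (real ((r + 1) * (2 * r + 1)) / real n)"
  shows "(2 * real n * (2 * \<tau>\<^sup>2 + D / (real m * real (2 * r + 1))) + real m * real N * (2 + D) + D * real (2 * r + 1)
      + 4 * D * real N * real r) / real n \<le> (144 * \<beta>\<^sup>2 + 5 * D + 3 * real N * (2 + D) + 4 * D * real N) * real n powr (- 2 / 3)"
proof -
  have n0: "0 < real n" using y by (cases "n = 0") auto
  have y3: "y ^ 3 = real n" unfolding y(1) using n0 by (simp add: powr_realpow[symmetric] powr_powr)
  have "1 / y\<^sup>2 = real n powr (- 2 / 3)"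
    unfolding y(1) using n0 by (simp add: powr_realpow[symmetric] powr_powr powr_minus_divide)
  have ry: "real r \<le> y" "y - 1 < real r" using y(2) unfolding r by linarith+
  have y0: "0 < y" using y(2) by simp
  have \<tau>: "\<tau>\<^sup>2 \<le> 36 * \<beta>\<^sup>2 / y\<^sup>2"
  proof -
    have "real ((r + 1) * (2 * r + 1)) \<le> (2 * y) * (3 * y)"
      unfolding of_nat_mult using ry y(2) by (intro mult_mono) auto
    then have "real ((r + 1) * (2 * r + 1)) / real n \<le> (2 * y) * (3 * y) / y ^ 3"
      unfolding y3 using n0 by (intro divide_right_mono) auto
    also have "\<dots> = 6 / y" using y0 by (simp add: power3_eq_cube field_simps)
    finally have "(real ((r + 1) * (2 * r + 1)) / real n)\<^sup>2 \<le> (6 / y)\<^sup>2" by (intro power_mono) auto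
    then have "\<beta>\<^sup>2 * (real ((r + 1) * (2 * r + 1)) / real n)\<^sup>2 \<le> \<beta>\<^sup>2 * (6 / y)\<^sup>2" by (rule mult_left_mono) simp
    then show ?thesis unfolding \<tau>_def power_mult_distrib by (simp add: power_divide mult.commute)
  qed
  have q: "D / (real m * real (2 * r + 1)) \<le> D / y\<^sup>2"
  proof -
    have "y * y \<le> real m * real (2 * r + 1)" unfolding m_def using ry y0 by (intro mult_mono) auto
    then show ?thesis using D y0 by (intro divide_left_mono) (auto simp: power2_eq_square m_def)
  qed
  have "2 * real n * (2 * \<tau>\<^sup>2 + D / (real m * real (2 * r + 1))) \<le> 2 * real n * (2 * (36 * \<beta>\<^sup>2 / y\<^sup>2) + D / y\<^sup>2)"
    using \<tau> q by (intro mult_left_mono add_mono) auto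
  also have "\<dots> = (144 * \<beta>\<^sup>2 + 2 * D) * y" unfolding y3[symmetric] using y0 by (simp add: power3_eq_cube power2_eq_square field_simps)
  finally have 1: "2 * real n * (2 * \<tau>\<^sup>2 + D / (real m * real (2 * r + 1))) \<le> (144 * \<beta>\<^sup>2 + 2 * D) * y" .
  have m3: "real (2 * r + 1) \<le> 3 * y" using ry y(2) by simp
  have 2: "real m * real N * (2 + D) \<le> 3 * y * real N * (2 + D)"
    unfolding m_def using m3 D by (intro mult_right_mono) auto
  have 3: "D * real (2 * r + 1) \<le> D * (3 * y)" using m3 D by (rule mult_left_mono)
  have 4: "4 * D * real N * real r \<le> 4 * D * real N * y" using ry D by (intro mult_left_mono) auto
  have "(2 * real n * (2 * \<tau>\<^sup>2 + D / (real m * real (2 * r + 1))) + real m * real N * (2 + D) + D * real (2 * r + 1)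
      + 4 * D * real N * real r) / real n \<le> ((144 * \<beta>\<^sup>2 + 5 * D + 3 * real N * (2 + D) + 4 * D * real N) * y) / real n"
    using 1 2 3 4 n0 by (intro divide_right_mono) (auto simp: algebra_simps)
  also have "\<dots> = (144 * \<beta>\<^sup>2 + 5 * D + 3 * real N * (2 + D) + 4 * D * real N) * (1 / y\<^sup>2)"
    unfolding y3[symmetric] using y0 by (simp add: power3_eq_cube power2_eq_square)
  finally show ?thesis using \<open>1 / y\<^sup>2 = _\<close> by simp
qed

text \<open>Blocks of about \<open>2 n\<^sup>1\<^sup>/\<^sup>3\<close> pixels and windows of about \<open>2 n\<^sup>1\<^sup>/\<^sup>3\<close> blocks balance all contributions. The block size
  is odd, so that block medians are single order statistics and have an exact binomial law.\<close>

lemma class_risk_upper_bound: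
  assumes \<sigma>: "0 < \<sigma>" and \<beta>: "0 < \<beta>" and \<eta>: "0 < \<eta>"
    and pr: "prob_space \<Psi>" and sh: "shape_condition \<Psi> \<psi>" and de: "1 < decay_exponent \<psi>"
  shows "\<exists>C>0. \<forall>\<^sub>F n in sequentially. \<exists>h\<in>admissible_scales n.
     class_risk n \<sigma> \<Psi> (two_scale_median n (fst h) (snd h)) (SEP_PLIP \<eta> \<beta> N) \<le> ennreal (C * real n powr (- 2 / 3))"
proof -
  obtain K where K: "symmetric_noise \<Psi> K" using shape_condition_consequences[OF pr sh] by blast
  interpret symmetric_noise \<Psi> K by (rule K)
  obtain c u\<^sub>0 C a where c: "0 < c" "0 < u\<^sub>0" "0 < C" "0 < a" and H: "half_tail c u\<^sub>0 C a tail"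
    using half_tail_noise[OF pr sh de K] by blast
  obtain \<kappa> \<mu> where k: "0 < \<kappa>" "0 < \<mu>" and P: "polynomial_profile \<kappa> \<mu> tail"
    using half_tail_imp_profile[OF c] H by blast
  obtain \<kappa>' \<mu>' where k': "0 < \<kappa>'" "0 < \<mu>'"
    and Q: "\<And>q. half_tail (c / 4) (min u\<^sub>0 (1 / (2 * c))) (4 / (\<mu> * \<kappa>)) 2 q \<Longrightarrow> polynomial_profile \<kappa>' \<mu>' q"
    using half_tail_imp_profile[of "c / 4" "min u\<^sub>0 (1 / (2 * c))" "4 / (\<mu> * \<kappa>)" 2] c k by auto
  define B where "B = max (1584 / (\<kappa> * \<mu>)\<^sup>2) (1584 / (\<kappa>' * \<mu>')\<^sup>2)"
  define D where "D = 4 * \<sigma>\<^sup>2 * (1 + B)"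
  have B0: "0 \<le> B" unfolding B_def by (rule max.coboundedI1) simp
  have D0: "0 < D" using B0 \<sigma> by (simp add: D_def)
  define C' where "C' = 144 * \<beta>\<^sup>2 + 5 * D + 3 * real N * (2 + D) + 4 * D * real N"
  have C': "0 < C'" unfolding C'_def using D0 by (intro add_pos_nonneg add_nonneg_pos mult_nonneg_nonneg) auto
  define Y where "Y = max 4 (max (6 / \<mu>) (max (6 / \<mu>') (12 / \<eta>)))"
  show ?thesis
  proof (intro exI conjI)
    show "\<forall>\<^sub>F n in sequentially. \<exists>h\<in>admissible_scales n.
       class_risk n \<sigma> \<Psi> (two_scale_median n (fst h) (snd h)) (SEP_PLIP \<eta> \<beta> N) \<le> ennreal (C' * real n powr (- 2 / 3))"
    proof (rule eventually_sequentiallyI)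
      fix n assume n: "nat \<lceil>Y ^ 3\<rceil> \<le> n"
      define y where "y = real n powr (1 / 3)"
      have Y4: "4 \<le> Y" "6 / \<mu> \<le> Y" "6 / \<mu>' \<le> Y" "12 / \<eta> \<le> Y" by (auto simp: Y_def)
      have Yn: "Y ^ 3 \<le> real n" using n by linarith
      moreover have "0 < Y ^ 3" using Y4 by (intro zero_less_power) linarith
      ultimately have n0: "0 < real n" by linarith
      have y3: "real n = y ^ 3" unfolding y_def using n0 by (simp add: powr_realpow[symmetric] powr_powr)
      have "Y ^ Suc 2 \<le> y ^ Suc 2" using Yn unfolding y3 by (simp add: eval_nat_numeral)
      then have Yy: "Y \<le> y" by (rule power_le_imp_le_base) (simp add: y_def)
      have y4: "4 \<le> y" using Yy Y4 by linarith
      define r where "r = nat \<lfloor>y\<rfloor>"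
      have ry: "real r \<le> y" "y - 1 < real r" using y4 unfolding r_def by linarith+
      define m where "m = 2 * r + 1"
      have mr: "y \<le> real m" "real m \<le> 3 * y" using ry y4 by (auto simp: m_def)
      have r2: "2 \<le> r" using ry y4 by linarith
      have rm: "real (r * m) \<le> y * (3 * y)" unfolding of_nat_mult using ry mr y4 by (intro mult_mono) auto
      have "y * (3 * y) < y * (y * y)" using y4 by simp
      then have "real (r * m) < real n" using rm y3 by (simp add: power3_eq_cube)
      then have rmn: "r * m < n" by (simp only: of_nat_less_iff)
      have "real ((2 * r + 2) * m) \<le> (4 * y) * (3 * y)" unfolding of_nat_mult using ry mr y4 by (intro mult_mono) auto
      also have "\<dots> \<le> \<eta> * real n"
      proof -
        have "12 / \<eta> \<le> y" using Y4(4) Yy by linarith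
        then have "12 \<le> \<eta> * y" using \<eta> by (simp add: field_simps)
        then have "12 * (y * y) \<le> (\<eta> * y) * (y * y)" by (rule mult_right_mono) simp
        then show ?thesis unfolding y3 by (simp add: power3_eq_cube mult_ac)
      qed
      finally have l5: "real ((2 * r + 2) * m) \<le> \<eta> * real n" .
      have "6 / \<mu> \<le> y" "6 / \<mu>' \<le> y" using Y4(2,3) Yy by linarith+
      then have \<mu>y: "6 \<le> \<mu> * y" "6 \<le> \<mu>' * y" using k k' by (simp_all add: field_simps)
      have "6 \<le> \<mu> * y" by (rule \<mu>y(1))
      also have "\<dots> \<le> \<mu> * real m" using mr k by simp
      finally have l1: "6 \<le> \<mu> * real m" .
      have "6 \<le> \<mu>' * y" by (rule \<mu>y(2))
      also have "\<dots> \<le> \<mu>' * real (2 * r + 1)" using mr k' unfolding m_def by simp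
      finally have l2: "6 \<le> \<mu>' * real (2 * r + 1)" .
      have Qm: "polynomial_profile \<kappa>' \<mu>' (\<lambda>u. binom_tail m (r + 1) (tail (u / sqrt (real m))))"
        using l1 by (intro Q half_tail_scaled_median[OF P k H c(1) m_def]) simp
      define h where "h = (real m / real n, real (r * m) / real n)"
      have adm: "h \<in> admissible_scales n" "\<And>Y i. i \<in> {1..n} \<Longrightarrow> two_scale_median n (fst h) (snd h) Y i = median_filter n m r Y i"
        using admissible_scales_of_integers[of m r n] r2 rmn by (auto simp: h_def m_def)
      have "class_risk n \<sigma> \<Psi> (two_scale_median n (fst h) (snd h)) (SEP_PLIP \<eta> \<beta> N) \<le> ennreal (C' * real n powr (- 2 / 3))"
        unfolding class_risk_def
      proof (rule SUP_least)
        fix f assume f: "f \<in> SEP_PLIP \<eta> \<beta> N"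
        have "risk n \<sigma> \<Psi> (two_scale_median n (fst h) (snd h)) f = risk n \<sigma> \<Psi> (median_filter n m r) f"
          by (rule risk_cong) (rule adm(2))
        also have "\<dots> \<le> ennreal ((2 * real n * (2 * (\<beta> * (real ((r + 1) * m) / real n))\<^sup>2 + D / (real m * real (2 * r + 1)))
            + real m * real N * (2 + D) + D * real (2 * r + 1) + 4 * D * real N * real r) / real n)"
          unfolding D_def
          by (rule median_filter_risk_upper[OF P k m_def Qm k' l1 l2 r2 rmn l5 \<sigma> _ \<eta> f]) (use \<beta> in \<open>auto simp: B_def\<close>)
        also have "\<dots> \<le> ennreal (C' * real n powr (- 2 / 3))"
          using tuned_bound_le[of y n r D \<beta> N] y4 D0 unfolding C'_def m_def by (intro ennreal_leI) (simp add: y_def r_def)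
        finally show "risk n \<sigma> \<Psi> (two_scale_median n (fst h) (snd h)) f \<le> ennreal (C' * real n powr (- 2 / 3))" .
      qed
      then show "\<exists>h\<in>admissible_scales n.
         class_risk n \<sigma> \<Psi> (two_scale_median n (fst h) (snd h)) (SEP_PLIP \<eta> \<beta> N) \<le> ennreal (C' * real n powr (- 2 / 3))"
        using adm(1) by blast
    qed
  qed (rule C')
qed

section \<open>Lower bounds: bias\<close>

lemma Median_reflect:
  assumes "finite A" "A \<noteq> {}"
  shows "Median A (\<lambda>a. c - y a) = c - Median A y"
  using Median_affine[OF assms, of 1 c "\<lambda>a. - y a"] Median_uminus[OF assms, of y] by simp

lemma sum_squares_ge:
  fixes a b d :: real
  assumes "0 \<le> d" "2 * d \<le> a + b \<or> a + b \<le> - (2 * d)"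
  shows "2 * d\<^sup>2 \<le> a\<^sup>2 + b\<^sup>2"
proof -
  have "(2 * d)\<^sup>2 \<le> \<bar>a + b\<bar>\<^sup>2" using assms by (intro power_mono) auto
  moreover have "0 \<le> (a - b)\<^sup>2" by simp
  ultimately show ?thesis by (simp add: power2_eq_square algebra_simps)
qed

lemma median_filter_measurable:
  assumes "1 \<le> n" "1 \<le> m" "i \<in> {1..n}" "\<And>j. j \<in> {1..n} \<Longrightarrow> (\<lambda>z. Y z j) \<in> borel_measurable M"
  shows "(\<lambda>z. median_filter n m w (Y z) i) \<in> borel_measurable M"
  unfolding median_filter_def
proof (intro borel_measurable_Median finite_window window_nonempty block_index_le assms(3) finite_pixels)
  fix k assume "k \<in> window n m w ((i - 1) div m)"
  then show "pixels n m k \<noteq> {}" by (intro pixels_nonempty assms) (auto simp: window_def)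
next
  fix k j assume "j \<in> pixels n m k"
  then show "(\<lambda>z. Y z j) \<in> borel_measurable M" using subsetD[OF pixels_subset] by (intro assms(4))
qed

context symmetric_noise
begin

lemma observation_measurable: "j \<in> {1..n} \<Longrightarrow> (\<lambda>z. observation n \<sigma> f z j) \<in> borel_measurable (noise {1..n})"
  unfolding observation_def
  by (intro borel_measurable_add borel_measurable_times borel_measurable_const coordinate_measurable)

text \<open>Suppose a block-respecting permutation of the pixels of the window pairs every pixel with one where
  the signal takes the value reflected at \<open>c\<close> (or something beyond it). Reflecting the noise along with the
  permutation reflects the output of the filter, so its law is symmetric about \<open>c\<close>, or shifted away from the
  signal; either way the mean squared error at a pixel is at least the squared distance of the signal from \<open>c\<close>.\<close>

lemma reflected_window_risk:
  assumes n: "1 \<le> n" "1 \<le> m" and \<sigma>: "0 < \<sigma>" and i: "i \<in> {1..n}"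
    and \<rho>: "bij_betw \<rho> {1..n} {1..n}" and \<pi>: "bij_betw \<pi> (window n m w ((i - 1) div m)) (window n m w ((i - 1) div m))"
    and blocks: "\<And>k. k \<in> window n m w ((i - 1) div m) \<Longrightarrow> bij_betw \<rho> (pixels n m k) (pixels n m (\<pi> k))"
    and c: "(f (real i / real n) \<le> c \<and> (\<forall>k\<in>window n m w ((i - 1) div m). \<forall>j\<in>pixels n m k. 2 * c \<le> f (real j / real n) + f (real (\<rho> j) / real n)))
          \<or> (c \<le> f (real i / real n) \<and> (\<forall>k\<in>window n m w ((i - 1) div m). \<forall>j\<in>pixels n m k. f (real j / real n) + f (real (\<rho> j) / real n) \<le> 2 * c))"
  shows "ennreal ((c - f (real i / real n))\<^sup>2) \<le> pixel_risk n \<sigma> \<Psi> m w f i"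
proof -
  define W where "W = window n m w ((i - 1) div m)"
  define P where "P = (noise {1..n})"
  interpret P: prob_space P unfolding P_def by (rule prob_space_product)
  define a where "a = f (real i / real n)"
  define X where "X = (\<lambda>z. median_filter n m w (observation n \<sigma> f z) i)"
  define R where "R = (\<lambda>z::nat \<Rightarrow> real. \<lambda>j\<in>{1..n}. - z (\<rho> j))"
  have W: "finite W" "W \<noteq> {}" unfolding W_def using window_nonempty[OF block_index_le[OF i]] by auto
  have ne: "pixels n m k \<noteq> {}" if "k \<in> W" for k
    using that by (intro pixels_nonempty n) (auto simp: W_def window_def)
  have \<pi>W: "\<pi> k \<in> W" if "k \<in> W" for k using \<pi> that by (auto simp: W_def bij_betw_def)
  have Xm: "X \<in> borel_measurable P" unfolding X_def P_def
    by (intro median_filter_measurable n i observation_measurable)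
  have Rm: "R \<in> P \<rightarrow>\<^sub>M P" unfolding R_def P_def by (rule reflect_permute_measurable[OF \<rho>])
  have X: "X z = Median W (\<lambda>k. Median (pixels n m k) (observation n \<sigma> f z))" for z
    by (simp add: X_def median_filter_def W_def)
  have obs: "Median (pixels n m k) (observation n \<sigma> f (R z)) = Median (pixels n m k) (\<lambda>j. f (real j / real n) - \<sigma> * z (\<rho> j))"
    for k z
    using pixels_subset[of n m k] by (intro Median_cong) (auto simp: observation_def R_def)
  have refl: "Median (pixels n m k) (\<lambda>j. 2 * c - f (real (\<rho> j) / real n) - \<sigma> * z (\<rho> j)) = 2 * c - Median (pixels n m (\<pi> k)) (observation n \<sigma> f z)"
    if k: "k \<in> W" for k z
  proof -
    have "Median (pixels n m k) (\<lambda>j. 2 * c - f (real (\<rho> j) / real n) - \<sigma> * z (\<rho> j))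
        = Median (pixels n m k) (\<lambda>j. (\<lambda>j. 2 * c - observation n \<sigma> f z j) (\<rho> j))"
      by (intro Median_cong) (simp add: observation_def)
    also have "\<dots> = Median (pixels n m (\<pi> k)) (\<lambda>j. 2 * c - observation n \<sigma> f z j)"
      using k by (intro Median_reindex blocks) (simp add: W_def)
    also have "\<dots> = 2 * c - Median (pixels n m (\<pi> k)) (observation n \<sigma> f z)"
      using ne[OF \<pi>W[OF k]] by (intro Median_reflect) auto
    finally show ?thesis .
  qed
  have reflW: "Median W (\<lambda>k. 2 * c - Median (pixels n m (\<pi> k)) (observation n \<sigma> f z)) = 2 * c - X z" for z
  proof -
    have "Median W (\<lambda>k. (\<lambda>k. 2 * c - Median (pixels n m k) (observation n \<sigma> f z)) (\<pi> k))
        = Median W (\<lambda>k. 2 * c - Median (pixels n m k) (observation n \<sigma> f z))"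
      using \<pi> by (intro Median_reindex) (simp add: W_def)
    then show ?thesis unfolding X by (simp add: Median_reflect[OF W])
  qed
  have sq: "2 * (c - a)\<^sup>2 \<le> (X z - a)\<^sup>2 + (X (R z) - a)\<^sup>2" for z
    using c unfolding W_def[symmetric] a_def[symmetric]
  proof
    assume A: "a \<le> c \<and> (\<forall>k\<in>W. \<forall>j\<in>pixels n m k. 2 * c \<le> f (real j / real n) + f (real (\<rho> j) / real n))"
    have "Median W (\<lambda>k. 2 * c - Median (pixels n m (\<pi> k)) (observation n \<sigma> f z))
        \<le> Median W (\<lambda>k. Median (pixels n m k) (observation n \<sigma> f (R z)))"
    proof (rule Median_mono[OF W])
      fix k assume k: "k \<in> W"
      show "2 * c - Median (pixels n m (\<pi> k)) (observation n \<sigma> f z) \<le> Median (pixels n m k) (observation n \<sigma> f (R z))"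
        unfolding obs refl[OF k, symmetric]
      proof (rule Median_mono)
        fix j assume "j \<in> pixels n m k"
        then have "2 * c \<le> f (real j / real n) + f (real (\<rho> j) / real n)" using A k by blast
        then show "2 * c - f (real (\<rho> j) / real n) - \<sigma> * z (\<rho> j) \<le> f (real j / real n) - \<sigma> * z (\<rho> j)" by linarith
      qed (use ne[OF k] in auto)
    qed
    then have "2 * c - X z \<le> X (R z)" by (simp only: reflW X[symmetric])
    then show ?thesis using A by (intro sum_squares_ge) auto
  next
    assume A: "c \<le> a \<and> (\<forall>k\<in>W. \<forall>j\<in>pixels n m k. f (real j / real n) + f (real (\<rho> j) / real n) \<le> 2 * c)"
    have "Median W (\<lambda>k. Median (pixels n m k) (observation n \<sigma> f (R z)))
        \<le> Median W (\<lambda>k. 2 * c - Median (pixels n m (\<pi> k)) (observation n \<sigma> f z))"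
    proof (rule Median_mono[OF W])
      fix k assume k: "k \<in> W"
      show "Median (pixels n m k) (observation n \<sigma> f (R z)) \<le> 2 * c - Median (pixels n m (\<pi> k)) (observation n \<sigma> f z)"
        unfolding obs refl[OF k, symmetric]
      proof (rule Median_mono)
        fix j assume "j \<in> pixels n m k"
        then have "f (real j / real n) + f (real (\<rho> j) / real n) \<le> 2 * c" using A k by blast
        then show "f (real j / real n) - \<sigma> * z (\<rho> j) \<le> 2 * c - f (real (\<rho> j) / real n) - \<sigma> * z (\<rho> j)" by linarith
      qed (use ne[OF k] in auto)
    qed
    then have "X (R z) \<le> 2 * c - X z" by (simp only: reflW X[symmetric])
    then have "2 * (a - c)\<^sup>2 \<le> (X z - a)\<^sup>2 + (X (R z) - a)\<^sup>2" using A by (intro sum_squares_ge) auto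
    then show ?thesis by (simp add: power2_commute)
  qed
  define r where "r = pixel_risk n \<sigma> \<Psi> m w f i"
  define g where "g = (\<lambda>z. ennreal ((X z - a)\<^sup>2))"
  have r: "r = (\<integral>\<^sup>+z. g z \<partial>P)" by (simp add: r_def pixel_risk_def X_def a_def P_def g_def)
  have gm: "g \<in> borel_measurable P" unfolding g_def
    by (intro measurable_compose[OF _ measurable_ennreal] borel_measurable_power borel_measurable_diff Xm borel_measurable_const)
  have gR: "(\<lambda>z. g (R z)) \<in> borel_measurable P" by (rule measurable_compose[OF Rm gm])
  have r': "(\<integral>\<^sup>+z. g (R z) \<partial>P) = r"
    unfolding r R_def P_def by (rule nn_integral_reflect_permute[OF _ \<rho>]) (use gm in \<open>auto simp: P_def\<close>)
  have "ennreal (2 * (c - a)\<^sup>2) = (\<integral>\<^sup>+z. ennreal (2 * (c - a)\<^sup>2) \<partial>P)" by (simp add: P.emeasure_space_1)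
  also have "\<dots> \<le> (\<integral>\<^sup>+z. g z + g (R z) \<partial>P)"
  proof (rule nn_integral_mono)
    fix z
    have "ennreal (2 * (c - a)\<^sup>2) \<le> ennreal ((X z - a)\<^sup>2 + (X (R z) - a)\<^sup>2)" by (rule ennreal_leI[OF sq])
    also have "\<dots> = g z + g (R z)" by (simp add: g_def)
    finally show "ennreal (2 * (c - a)\<^sup>2) \<le> g z + g (R z)" .
  qed
  also have "\<dots> = r + r" by (simp only: nn_integral_add[OF gm gR] r' r[symmetric])
  finally have *: "ennreal (2 * (c - a)\<^sup>2) \<le> r + r" .
  have "ennreal ((c - a)\<^sup>2) \<le> r"
  proof (cases r)
    case (real q)
    have "r + r = ennreal (q + q)" using real by (simp add: ennreal_plus[symmetric] del: ennreal_plus)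
    from *[unfolded this] have "2 * (c - a)\<^sup>2 \<le> q + q" using real by (subst (asm) ennreal_le_iff) auto
    then have "(c - a)\<^sup>2 \<le> q" by simp
    then show ?thesis using real by (simp add: ennreal_leI)
  qed simp
  then show ?thesis by (simp add: r_def a_def)
qed

end

text \<open>The permutation of pixels that permutes the blocks in \<open>W\<close> by \<open>\<pi>\<close> and reverses each of them.\<close>

definition block_reflection :: "nat \<Rightarrow> nat set \<Rightarrow> (nat \<Rightarrow> nat) \<Rightarrow> nat \<Rightarrow> nat" where
  "block_reflection m W \<pi> j =
     (if (j - 1) div m \<in> W then \<pi> ((j - 1) div m) * m + (m - (j - 1) mod m) else j)"

lemma block_reflection:
  assumes n: "1 \<le> n" "1 \<le> m" and W: "\<And>k. k \<in> W \<Longrightarrow> k < last_block n m"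
    and \<pi>: "\<And>k. k \<in> W \<Longrightarrow> \<pi> k \<in> W \<and> \<pi> (\<pi> k) = k"
  shows "bij_betw (block_reflection m W \<pi>) {1..n} {1..n}"
    and "k \<in> W \<Longrightarrow> bij_betw (block_reflection m W \<pi>) (pixels n m k) (pixels n m (\<pi> k))"
    and "k \<notin> W \<Longrightarrow> bij_betw (block_reflection m W \<pi>) (pixels n m k) (pixels n m k)"
    and "k \<in> W \<Longrightarrow> j \<in> pixels n m k \<Longrightarrow> j + block_reflection m W \<pi> j = (k + \<pi> k) * m + m + 1"
proof -
  let ?\<rho> = "block_reflection m W \<pi>"
  have key: "?\<rho> j \<in> pixels n m (\<pi> k) \<and> ?\<rho> (?\<rho> j) = j \<and> j + ?\<rho> j = (k + \<pi> k) * m + m + 1"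
    if k: "k \<in> W" and j: "j \<in> pixels n m k" for k j
  proof -
    have jd: "(j - 1) div m = k" "1 \<le> j" using j mem_pixels_iff[OF n(2)] by auto
    define u where "u = (j - 1) mod m"
    have u: "u < m" "j - 1 = k * m + u" using n jd(1) by (auto simp: u_def)
    have jm: "j = k * m + u + 1" using u(2) jd(2) by linarith
    have r: "?\<rho> j = \<pi> k * m + (m - u)" using k jd by (simp add: block_reflection_def u_def)
    define v where "v = m - u - 1"
    have v: "v < m" "?\<rho> j - 1 = \<pi> k * m + v" "1 \<le> ?\<rho> j" using u(1) unfolding r v_def by auto
    have dv: "(?\<rho> j - 1) div m = \<pi> k" "(?\<rho> j - 1) mod m = v" unfolding v(2) using v(1) by auto
    have pk: "\<pi> k \<in> W" "\<pi> (\<pi> k) = k" using \<pi>[OF k] by auto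
    have "?\<rho> j \<in> {\<pi> k * m + 1..(\<pi> k + 1) * m}" using u(1) unfolding r by auto
    then have 1: "?\<rho> j \<in> pixels n m (\<pi> k)" using pixels_full(1)[OF n(2,1) W[OF pk(1)]] by simp
    have "?\<rho> (?\<rho> j) = k * m + (m - v)" using pk dv by (simp add: block_reflection_def[of m W \<pi> "?\<rho> j"])
    then have 2: "?\<rho> (?\<rho> j) = j" using u(1) jm by (simp add: v_def)
    have "?\<rho> j + u = \<pi> k * m + m" using u(1) r by linarith
    then have 3: "j + ?\<rho> j = (k + \<pi> k) * m + m + 1" using jm add_mult_distrib[of k "\<pi> k" m] by linarith
    show ?thesis using 1 2 3 by blast
  qed
  show "k \<in> W \<Longrightarrow> j \<in> pixels n m k \<Longrightarrow> j + ?\<rho> j = (k + \<pi> k) * m + m + 1" using key by blast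
  have out: "?\<rho> j = j" if "k \<notin> W" "j \<in> pixels n m k" for k j
    using that mem_pixels_iff[OF n(2)] by (auto simp: block_reflection_def)
  show "k \<notin> W \<Longrightarrow> bij_betw ?\<rho> (pixels n m k) (pixels n m k)"
    using out by (intro bij_betw_byWitness[of _ ?\<rho>]) auto
  show "bij_betw ?\<rho> (pixels n m k) (pixels n m (\<pi> k))" if k: "k \<in> W"
  proof (rule bij_betw_byWitness[of _ ?\<rho>])
    have "\<pi> k \<in> W" "\<pi> (\<pi> k) = k" using \<pi>[OF k] by auto
    then show "\<forall>a\<in>pixels n m (\<pi> k). ?\<rho> (?\<rho> a) = a" "?\<rho> ` pixels n m (\<pi> k) \<subseteq> pixels n m k"
      using key[of "\<pi> k"] by auto
  qed (use key[OF k] in auto)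
  have all: "?\<rho> j \<in> {1..n} \<and> ?\<rho> (?\<rho> j) = j" if j: "j \<in> {1..n}" for j
  proof -
    have p: "j \<in> pixels n m ((j - 1) div m)" using j mem_pixels_iff[OF n(2)] by blast
    show ?thesis
    proof (cases "(j - 1) div m \<in> W")
      case True
      then show ?thesis using key[OF True p] pixels_subset by blast
    next
      case False
      then show ?thesis using out[OF False p] j by simp
    qed
  qed
  then show "bij_betw ?\<rho> {1..n} {1..n}" by (intro bij_betw_byWitness[of _ ?\<rho>]) auto
qed

lemma lipschitz_in_SEP_PLIP:
  assumes sep: "\<exists>x. well_separated \<eta> N x" and f01: "\<And>t. t \<in> {0..1} \<Longrightarrow> f t \<in> {0..1}"
    and L: "\<And>s t. \<bar>f s - f t\<bar> \<le> \<beta> * \<bar>s - t\<bar>"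
  shows "f \<in> SEP_PLIP \<eta> \<beta> N"
proof -
  have "local_lip f t \<le> ereal \<beta>" for t
    unfolding local_lip_def
  proof (intro Limsup_bounded always_eventually allI SUP_least)
    fix \<epsilon> y assume "y \<in> {y \<in> {0..1}. \<bar>y - t\<bar> \<le> \<epsilon> \<and> y \<noteq> t}"
    then show "ereal (\<bar>f y - f t\<bar> / \<bar>y - t\<bar>) \<le> ereal \<beta>" using L[of y t] by (simp add: field_simps)
  qed
  then show ?thesis using sep f01 unfolding SEP_PLIP_def by blast
qed

lemma risk_ge_of_pixels:
  assumes n: "1 \<le> n" and S: "S \<subseteq> {1..n}" and g: "\<And>i. i \<in> S \<Longrightarrow> 0 \<le> g i \<and> ennreal (g i) \<le> pixel_risk n \<sigma> \<Psi> m w f i"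
  shows "ennreal ((\<Sum>i\<in>S. g i) / real n) \<le> risk n \<sigma> \<Psi> (median_filter n m w) f"
proof -
  have "ennreal (\<Sum>i\<in>S. g i) = (\<Sum>i\<in>S. ennreal (g i))" using g by (subst sum_ennreal) auto
  also have "\<dots> \<le> (\<Sum>i\<in>S. pixel_risk n \<sigma> \<Psi> m w f i)" using g by (intro sum_mono) auto
  also have "\<dots> \<le> (\<Sum>i\<in>{1..n}. pixel_risk n \<sigma> \<Psi> m w f i)" using S by (intro sum_mono2) auto
  finally have "ennreal (\<Sum>i\<in>S. g i) / of_nat n \<le> risk n \<sigma> \<Psi> (median_filter n m w) f"
    unfolding risk_median_filter by (rule divide_right_mono_ennreal)
  moreover have "ennreal (\<Sum>i\<in>S. g i) / of_nat n = ennreal ((\<Sum>i\<in>S. g i) / real n)"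
    using n g by (subst divide_ennreal[symmetric]) (auto simp: ennreal_of_nat_eq_real_of_nat intro!: sum_nonneg)
  ultimately show ?thesis by simp
qed

context symmetric_noise
begin

text \<open>Near the left border the window is not centred at its pixel. For a linear signal the filter is then
  off by the distance between the pixel and the centre of the window.\<close>

lemma border_bias:
  assumes n: "1 \<le> n" "1 \<le> m" and \<sigma>: "0 < \<sigma>" and w: "w * m < n" and s: "0 \<le> s" and i: "1 \<le> i" "4 * i \<le> w * m"
  shows "ennreal ((s * real (w * m) / (4 * real n))\<^sup>2) \<le> pixel_risk n \<sigma> \<Psi> m w (\<lambda>x. s * x) i"
proof -
  define k where "k = (i - 1) div m"
  define F where "F = last_block n m"
  have im: "i - 1 < w * m" using i by linarith
  have iN: "i \<in> {1..n}" using i w by auto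
  have kw: "k < w" unfolding k_def using im n(2) by (simp add: div_less_iff_less_mult)
  have wF: "w \<le> F"
  proof -
    have "w * m \<le> n - 1" using w by linarith
    then show ?thesis using n unfolding F_def last_block_def by (simp add: less_eq_div_iff_mult_less_eq)
  qed
\<comment> \<open>The number of complete blocks in the window; reversing them leaves the last block of the interval in place.\<close>
  define e where "e = min (k + w + 1) F"
  have e: "w \<le> e" "0 < e" "e \<le> F" using wF kw by (auto simp: e_def)
  define \<pi>0 where "\<pi>0 b = e - 1 - b" for b
  define \<pi> where "\<pi> b = (if b < e then \<pi>0 b else b)" for b
  define W where "W = window n m w k"
  have W: "b \<in> W \<longleftrightarrow> b \<le> F \<and> b \<le> k + w" for b using kw by (auto simp: W_def window_def F_def)
  define \<rho> where "\<rho> = block_reflection m {..<e} \<pi>0"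
  have full: "b < last_block n m" if "b \<in> {..<e}" for b using that e(3) by (auto simp: F_def)
  have inv: "\<pi>0 b \<in> {..<e} \<and> \<pi>0 (\<pi>0 b) = b" if "b \<in> {..<e}" for b using that by (auto simp: \<pi>0_def)
  note refl = block_reflection[OF n full inv, folded \<rho>_def]
  define c where "c = s * ((real (e * m) + 1) / 2) / real n"
  have n0: "0 < real n" using n by simp
  have wm: "real (w * m) \<le> real (e * m)" using e(1) by (simp only: of_nat_le_iff mult_le_mono1)
  have i4: "4 * real i \<le> real (w * m)" using i(2) by (metis of_nat_le_iff of_nat_mult of_nat_numeral)
  have "x / 4 \<le> (y + 1) / 2 - z" if "x \<le> y" "4 * z \<le> x" for x y z :: real using that by argo
  from this[OF wm i4] have gap: "real (w * m) / 4 \<le> (real (e * m) + 1) / 2 - real i" .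
  have ci: "s * real (w * m) / (4 * real n) \<le> c - s * (real i / real n)"
  proof -
    have "s / real n * (real (w * m) / 4) \<le> s / real n * ((real (e * m) + 1) / 2 - real i)"
      using gap s n0 by (intro mult_left_mono) auto
    then show ?thesis by (simp add: c_def right_diff_distrib mult_ac)
  qed
  have pos: "0 \<le> s * real (w * m) / (4 * real n)" using s by simp
  have "ennreal ((s * real (w * m) / (4 * real n))\<^sup>2) \<le> ennreal ((c - s * (real i / real n))\<^sup>2)"
    using ci pos by (intro ennreal_leI power_mono) auto
  also have "\<dots> \<le> pixel_risk n \<sigma> \<Psi> m w (\<lambda>x. s * x) i"
  proof (rule reflected_window_risk[OF n \<sigma> iN])
    show "bij_betw \<rho> {1..n} {1..n}" by (rule refl(1))
    show "bij_betw \<pi> (window n m w ((i - 1) div m)) (window n m w ((i - 1) div m))"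
      unfolding k_def[symmetric] W_def[symmetric]
    proof (rule bij_betw_byWitness[of _ \<pi>])
      have \<pi>W: "\<pi> b \<in> W \<and> \<pi> (\<pi> b) = b" if b: "b \<in> W" for b
      proof (cases "b < e")
        case True
        then have "\<pi> b < e" "\<pi> b = e - 1 - b" by (auto simp: \<pi>_def \<pi>0_def)
        have "e \<le> F" "e \<le> Suc (k + w)" unfolding e_def by (rule min.cobounded2, metis Suc_eq_plus1 min.cobounded1)
        then have "\<pi> b \<in> W"
          unfolding W using less_le_trans[OF \<open>\<pi> b < e\<close>] by (meson less_Suc_eq_le less_imp_le)
        moreover have "\<pi> (\<pi> b) = b"
          using \<open>\<pi> b < e\<close> True unfolding \<open>\<pi> b = e - 1 - b\<close> by (simp add: \<pi>_def \<pi>0_def)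
        ultimately show ?thesis ..
      next
        case False
        then show ?thesis using b by (simp add: \<pi>_def)
      qed
      then show "\<forall>b\<in>W. \<pi> (\<pi> b) = b" "\<pi> ` W \<subseteq> W" "\<forall>b\<in>W. \<pi> (\<pi> b) = b" "\<pi> ` W \<subseteq> W" by auto
    qed
    show "bij_betw \<rho> (pixels n m b) (pixels n m (\<pi> b))" for b
      using refl(2)[of b] refl(3)[of b] by (cases "b < e") (auto simp: \<pi>_def)
    show "(s * (real i / real n) \<le> c \<and> (\<forall>k\<in>window n m w ((i - 1) div m). \<forall>j\<in>pixels n m k. 2 * c \<le> s * (real j / real n) + s * (real (\<rho> j) / real n)))
        \<or> (c \<le> s * (real i / real n) \<and> (\<forall>k\<in>window n m w ((i - 1) div m). \<forall>j\<in>pixels n m k. s * (real j / real n) + s * (real (\<rho> j) / real n) \<le> 2 * c))"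
    proof (intro disjI1 conjI ballI)
      show "s * (real i / real n) \<le> c" using ci pos by linarith
      fix b j assume b: "b \<in> window n m w ((i - 1) div m)" and j: "j \<in> pixels n m b"
      have "real (e * m) + 1 \<le> real j + real (\<rho> j)"
      proof (cases "b < e")
        case True
        have "j + \<rho> j = (b + \<pi>0 b) * m + m + 1" using True j by (intro refl(4)) auto
        also have "\<dots> = e * m + 1" using True by (cases e) (auto simp: \<pi>0_def)
        finally have "real (j + \<rho> j) = real (e * m + 1)" by simp
        then show ?thesis by simp
      next
        case False
        have "\<rho> j = j" using False j mem_pixels_iff[OF n(2)] by (auto simp: \<rho>_def block_reflection_def)
        moreover have "e * m + 1 \<le> j"
        proof -
          have "e * m + 1 \<le> b * m + 1" using False by (intro add_le_mono1 mult_le_mono1) auto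
          also have "\<dots> \<le> j" using j by (simp add: pixels_def)
          finally show ?thesis .
        qed
        then have "real (e * m + 1) \<le> real j" by (simp only: of_nat_le_iff)
        ultimately show ?thesis by simp
      qed
      then have "s / real n * (real (e * m) + 1) \<le> s / real n * (real j + real (\<rho> j))" using s n0 by (intro mult_left_mono) auto
      moreover have "2 * c = s / real n * (real (e * m) + 1)" unfolding c_def by (simp only: times_divide_eq_left times_divide_eq_right)
      moreover have "s / real n * (real j + real (\<rho> j)) = s * (real j / real n) + s * (real (\<rho> j) / real n)"
        by (simp add: distrib_left)
      ultimately show "2 * c \<le> s * (real j / real n) + s * (real (\<rho> j) / real n)" by simp
    qed
  qed
  finally show ?thesis .
qed

text \<open>The bias of \<open>border_bias\<close> is of order \<open>w m / n\<close> on a proportion of about \<open>w m / n\<close> of the pixels.\<close>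

lemma large_window_risk:
  assumes n: "1 \<le> n" "1 \<le> m" and \<sigma>: "0 < \<sigma>" and w: "w * m < n" "4 \<le> w * m" and s: "0 \<le> s"
  shows "ennreal (s\<^sup>2 / 128 * (real (w * m) / real n) ^ 3) \<le> risk n \<sigma> \<Psi> (median_filter n m w) (\<lambda>x. s * x)"
proof -
  define l where "l = w * m div 4"
  have "1 \<le> l" using w(2) unfolding l_def by (simp add: Suc_le_eq div_greater_zero_iff)
  then have l: "4 * l \<le> w * m" "w * m \<le> 8 * l" unfolding l_def by linarith+
  define q where "q = (s * real (w * m) / (4 * real n))\<^sup>2"
  have "ennreal ((\<Sum>i\<in>{1..l}. q) / real n) \<le> risk n \<sigma> \<Psi> (median_filter n m w) (\<lambda>x. s * x)"
  proof (rule risk_ge_of_pixels[OF n(1)])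
    fix i assume "i \<in> {1..l}"
    then have "1 \<le> i" "4 * i \<le> w * m" using l by auto
    then show "0 \<le> q \<and> ennreal q \<le> pixel_risk n \<sigma> \<Psi> m w (\<lambda>x. s * x) i"
      unfolding q_def by (intro conjI zero_le_power2 border_bias[OF n \<sigma> w(1) s])
  qed (use l w in auto)
  moreover have "s\<^sup>2 / 128 * (real (w * m) / real n) ^ 3 \<le> (\<Sum>i\<in>{1..l}. q) / real n"
  proof -
    have "real (w * m) \<le> real (8 * l)" using l(2) by (simp only: of_nat_le_iff)
    then have "real (w * m) / 8 * q / real n \<le> real l * q / real n" by (intro divide_right_mono mult_right_mono) (auto simp: q_def)
    moreover have "s\<^sup>2 / 128 * (real (w * m) / real n) ^ 3 = real (w * m) / 8 * q / real n"
      by (simp add: q_def power_divide power_mult_distrib power3_eq_cube power2_eq_square mult_ac)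
    moreover have "(\<Sum>i\<in>{1..l}. q) / real n = real l * q / real n" by simp
    ultimately show ?thesis by argo
  qed
  ultimately show ?thesis by (meson ennreal_leI order_trans)
qed

text \<open>A window of complete blocks contains every residue class of blocks modulo its length exactly once.
  For a sine wave whose period is the length of the window, the filter therefore sees as much of the signal
  above its mean as below, wherever the window is placed.\<close>

lemma sine_bias:
  assumes n: "1 \<le> n" "1 \<le> m" and \<sigma>: "0 < \<sigma>" and i: "i \<in> {1..n}" "w \<le> (i - 1) div m" "(i - 1) div m + w < last_block n m"
  defines "p \<equiv> real ((2 * w + 1) * m)" and "t \<equiv> (real m + 1) / 2"
  shows "ennreal ((A * sin (2 * pi * (real i - t) / p))\<^sup>2) \<le> pixel_risk n \<sigma> \<Psi> m w (\<lambda>x. 1 / 2 + A * sin (2 * pi * (real n * x - t) / p)) i"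
proof -
  define k where "k = (i - 1) div m"
  define q where "q = 2 * w + 1"
  define a where "a = k - w"
  have p0: "0 < p" using n by (simp add: p_def del: of_nat_mult)
  have wk: "w \<le> k" "k + w \<le> last_block n m" using i by (simp_all add: k_def)
  have "a + q = Suc (k + w)" using wk(1) by (simp add: a_def q_def)
  then have W: "window n m w ((i - 1) div m) = {a..<a + q}"
    unfolding k_def[symmetric] using window_interior(1)[OF wk] by (simp add: a_def atLeastLessThanSuc_atLeastAtMost)
\<comment> \<open>Modulo \<open>q\<close> this is \<open>b \<mapsto> - b\<close>, with representatives in the window, since \<open>2 * w\<close> is \<open>- 1\<close> modulo \<open>q\<close>.\<close>
  define \<pi> where "\<pi> = (\<lambda>b. a + (2 * w * (a + b)) mod q)"
  have \<pi>in: "\<pi> b \<in> {a..<a + q}" for b by (simp add: \<pi>_def q_def)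
  have \<pi>dvd: "q dvd b + \<pi> b" for b
  proof -
    have "(b + \<pi> b) mod q = ((a + b) + (2 * w * (a + b)) mod q) mod q" by (simp add: \<pi>_def ac_simps)
    also have "\<dots> = ((a + b) + 2 * w * (a + b)) mod q" by (rule mod_add_right_eq)
    also have "(a + b) + 2 * w * (a + b) = (a + b) * q" by (simp add: q_def algebra_simps)
    finally show ?thesis by (simp add: mod_eq_0_iff_dvd)
  qed
  have uniq: "u \<le> v" if uv: "u \<in> {a..<a + q}" "v \<in> {a..<a + q}" "q dvd x + u" "q dvd x + v" for u v x
  proof (rule ccontr)
    assume "\<not> u \<le> v"
    then have "q dvd (x + u) - (x + v)" using uv by (intro dvd_diff_nat)
    then have "q dvd u - v" by simp
    moreover have "0 < u - v" "u - v < q" using uv \<open>\<not> u \<le> v\<close> by auto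
    ultimately show False by (auto dest: dvd_imp_le)
  qed
  have inv: "\<pi> b \<in> {a..<a + q} \<and> \<pi> (\<pi> b) = b" if b: "b \<in> {a..<a + q}" for b
  proof -
    have d: "q dvd \<pi> b + b" using \<pi>dvd[of b] by (simp add: add.commute)
    have "\<pi> (\<pi> b) \<le> b" by (rule uniq[OF \<pi>in b \<pi>dvd d])
    moreover have "b \<le> \<pi> (\<pi> b)" by (rule uniq[OF b \<pi>in d \<pi>dvd])
    ultimately show ?thesis using \<pi>in by auto
  qed
  have full: "b < last_block n m" if "b \<in> {a..<a + q}" for b
    using that i by (auto simp: a_def q_def k_def)
  define \<rho> where "\<rho> = block_reflection m {a..<a + q} \<pi>"
  note refl = block_reflection[OF n full inv, folded \<rho>_def]
  define f where "f = (\<lambda>x. 1 / 2 + A * sin (2 * pi * (real n * x - t) / p))"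
  have fj: "f (real j / real n) = 1 / 2 + A * sin (2 * pi * (real j - t) / p)" for j
    using n by (simp add: f_def)
  have sym: "f (real j / real n) + f (real (\<rho> j) / real n) = 1" if b: "b \<in> {a..<a + q}" and j: "j \<in> pixels n m b" for b j
  proof -
    obtain z where z: "b + \<pi> b = q * z" using \<pi>dvd by blast
    have "j + \<rho> j = (b + \<pi> b) * m + m + 1" by (rule refl(4)) (use b j in auto)
    then have "j + \<rho> j = q * z * m + m + 1" unfolding z .
    then have "real (j + \<rho> j) = real (q * z * m + m + 1)" by simp
    then have s: "real (\<rho> j) - t = p * real z - (real j - t)" by (simp add: p_def q_def t_def algebra_simps)
    have "2 * pi * (real (\<rho> j) - t) / p = - (2 * pi * (real j - t) / p) + real z * (2 * pi)"
      unfolding s using p0 by (simp add: field_simps)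
    then have "sin (2 * pi * (real (\<rho> j) - t) / p) = sin (- (2 * pi * (real j - t) / p) + real z * (2 * pi))" by simp
    also have "\<dots> = sin (- (2 * pi * (real j - t) / p))"
    proof -
      have "real z * (2 * pi) = 2 * real z * pi" by simp
      then show ?thesis by (simp only: sin_add cos_2npi sin_2npi mult_zero_right mult_1_right add_0_right)
    qed
    finally show ?thesis unfolding fj by simp
  qed
  have "ennreal ((1 / 2 - f (real i / real n))\<^sup>2) \<le> pixel_risk n \<sigma> \<Psi> m w f i"
  proof (rule reflected_window_risk[OF n \<sigma> i(1)])
    show "bij_betw \<rho> {1..n} {1..n}" by (rule refl(1))
    show "bij_betw \<pi> (window n m w ((i - 1) div m)) (window n m w ((i - 1) div m))"
      unfolding W using inv by (intro bij_betw_byWitness[of _ \<pi>]) auto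
    show "bij_betw \<rho> (pixels n m b) (pixels n m (\<pi> b))" if "b \<in> window n m w ((i - 1) div m)" for b
      using that unfolding W by (intro refl(2))
    show "(f (real i / real n) \<le> 1 / 2 \<and> (\<forall>k\<in>window n m w ((i - 1) div m). \<forall>j\<in>pixels n m k. 2 * (1 / 2) \<le> f (real j / real n) + f (real (\<rho> j) / real n)))
        \<or> (1 / 2 \<le> f (real i / real n) \<and> (\<forall>k\<in>window n m w ((i - 1) div m). \<forall>j\<in>pixels n m k. f (real j / real n) + f (real (\<rho> j) / real n) \<le> 2 * (1 / 2)))"
      unfolding W using sym by (cases "f (real i / real n) \<le> 1 / 2") auto
  qed
  moreover have "(1 / 2 - f (real i / real n))\<^sup>2 = (A * sin (2 * pi * (real i - t) / p))\<^sup>2" unfolding fj by simp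
  ultimately show ?thesis by (simp add: f_def)
qed

end

lemma abs_sin_diff_le: "\<bar>sin a - sin b\<bar> \<le> \<bar>a - b\<bar>" for a b :: real
proof -
  have "\<bar>sin a - sin b\<bar> = 2 * (\<bar>sin ((a - b) / 2)\<bar> * \<bar>cos ((a + b) / 2)\<bar>)"
    by (simp add: sin_diff_sin abs_mult)
  also have "\<dots> \<le> 2 * (\<bar>(a - b) / 2\<bar> * 1)"
    by (intro mult_left_mono mult_mono abs_sin_x_le_abs_x abs_cos_le_one) auto
  finally show ?thesis by simp
qed

lemma sin_sq_quarter_shift:
  fixes x d :: real
  assumes "\<bar>d\<bar> \<le> 1 / 4"
  shows "1 / 2 \<le> (sin x)\<^sup>2 + (sin (x + (pi / 2 + d)))\<^sup>2"
proof -
  have "sin (x + (pi / 2 + d)) = cos (x + d)"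
    using sin_add[of "x + d" "pi / 2"] by (simp add: add_ac)
  then have e: "(sin x)\<^sup>2 + (sin (x + (pi / 2 + d)))\<^sup>2 = 1 - (sin (x + d) - sin x) * (sin (x + d) + sin x)"
    using sin_cos_squared_add[of "x + d"] by (simp add: power2_eq_square algebra_simps)
  have "\<bar>sin (x + d) - sin x\<bar> \<le> 1 / 4" using abs_sin_diff_le[of "x + d" x] assms by simp
  moreover have "\<bar>sin (x + d) + sin x\<bar> \<le> 2"
    using abs_triangle_ineq[of "sin (x + d)" "sin x"] abs_sin_le_one[of x] abs_sin_le_one[of "x + d"] by linarith
  ultimately have "\<bar>sin (x + d) - sin x\<bar> * \<bar>sin (x + d) + sin x\<bar> \<le> (1 / 4) * 2"
    by (intro mult_mono) auto
  then have "(sin (x + d) - sin x) * (sin (x + d) + sin x) \<le> 1 / 2"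
    unfolding abs_mult[symmetric] by linarith
  then show ?thesis unfolding e by simp
qed

lemma (in symmetric_noise) small_window_risk:
  assumes n: "1 \<le> n" "1 \<le> m" and \<sigma>: "0 < \<sigma>" and p: "p = (2 * w + 1) * m" "32 \<le> p" "4 * p \<le> n"
  shows "ennreal (A\<^sup>2 / 8) \<le> risk n \<sigma> \<Psi> (median_filter n m w)
           (\<lambda>x. 1 / 2 + A * sin (2 * pi * (real n * x - (real m + 1) / 2) / real p))"
proof -
  define F where "F = last_block n m"
  define g where "g = (\<lambda>i. (A * sin (2 * pi * (real i - (real m + 1) / 2) / real p))\<^sup>2)"
  define a b where "a = w * m + 1" and "b = (F - w) * m"
  have g0: "0 \<le> g i" for i by (simp add: g_def)
  have Fm: "F * m < n" "n \<le> F * m + m" using last_block_bounds[OF n(2,1)] by (auto simp: F_def)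
  have pm: "p = 2 * (w * m) + m" by (simp add: p(1) algebra_simps)
  have bF: "b + w * m = F * m"
  proof -
    have "w * m \<le> F * m" using Fm pm p by linarith
    then have "w \<le> F" using n by simp
    then show ?thesis unfolding b_def by (metis add_mult_distrib le_add_diff_inverse2)
  qed
  have S: "ennreal (g i) \<le> pixel_risk n \<sigma> \<Psi> m w (\<lambda>x. 1 / 2 + A * sin (2 * pi * (real n * x - (real m + 1) / 2) / real p)) i"
    if i: "i \<in> {a..b}" for i
  proof -
    have 1: "i \<in> {1..n}" using i bF Fm by (auto simp: a_def)
    have "w * m \<le> i - 1" using i by (auto simp: a_def)
    then have 2: "w \<le> (i - 1) div m" using n by (simp add: less_eq_div_iff_mult_less_eq)
    have "i - 1 < (F - w) * m" using i by (auto simp: a_def b_def)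
    then have "(i - 1) div m < F - w" using n by (simp add: div_less_iff_less_mult)
    then have 3: "(i - 1) div m + w < last_block n m" by (simp add: F_def)
    show ?thesis using sine_bias[OF n \<sigma> 1 2 3, of A] by (simp only: g_def p(1))
  qed
  have "ennreal ((\<Sum>i\<in>{a..b}. g i) / real n) \<le> risk n \<sigma> \<Psi> (median_filter n m w)
           (\<lambda>x. 1 / 2 + A * sin (2 * pi * (real n * x - (real m + 1) / 2) / real p))"
    using n S g0 bF Fm by (intro risk_ge_of_pixels) (auto simp: a_def)
  moreover have "A\<^sup>2 / 8 \<le> (\<Sum>i\<in>{a..b}. g i) / real n"
  proof -
    \<comment> \<open>Shifting by a quarter of the period turns squared sines into squared cosines, up to rounding.\<close>
    define r where "r = p div 4 + 1"
    have "4 * r = 4 * (p div 4) + 4" by (simp add: r_def)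
    moreover have "p = 4 * (p div 4) + p mod 4" "p mod 4 < 4" by simp_all
    ultimately have "p \<le> 4 * r" "4 * r \<le> p + 4" by linarith+
    then have "real p \<le> real (4 * r)" "real (4 * r) \<le> real (p + 4)" by (simp_all only: of_nat_le_iff)
    then have r: "real p \<le> 4 * real r" "4 * real r \<le> real p + 4" by simp_all
    have p32: "32 \<le> real p" using p(2) by simp
    then have p0: "0 < real p" by linarith
    define d where "d = 2 * pi * real r / real p - pi / 2"
    have d_eq: "d = (pi / 2) * ((4 * real r - real p) / real p)" using p0 by (simp add: d_def field_simps)
    have d: "\<bar>d\<bar> \<le> 1 / 4"
    proof -
      have x: "0 \<le> (4 * real r - real p) / real p" "(4 * real r - real p) / real p \<le> 1 / 8"
        using r p32 p0 by (auto simp: field_simps)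
      have "(pi / 2) * ((4 * real r - real p) / real p) \<le> 2 * (1 / 8)"
        using x pi_less_4 by (intro mult_mono) auto
      moreover have "0 \<le> (pi / 2) * ((4 * real r - real p) / real p)" using x pi_gt_zero by (intro mult_nonneg_nonneg) auto
      ultimately show ?thesis unfolding d_eq by simp
    qed
    have pair: "A\<^sup>2 / 2 \<le> g i + g (i + r)" for i
    proof -
      define x where "x = 2 * pi * (real i - (real m + 1) / 2) / real p"
      have "2 * pi * (real (i + r) - (real m + 1) / 2) / real p = x + (pi / 2 + d)"
        unfolding x_def d_def by (simp add: add_divide_distrib diff_divide_distrib algebra_simps)
      then have "g i + g (i + r) = A\<^sup>2 * ((sin x)\<^sup>2 + (sin (x + (pi / 2 + d)))\<^sup>2)"
        by (simp only: g_def x_def[symmetric] power_mult_distrib distrib_left)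
      moreover have "A\<^sup>2 * (1 / 2) \<le> A\<^sup>2 * ((sin x)\<^sup>2 + (sin (x + (pi / 2 + d)))\<^sup>2)"
        by (rule mult_left_mono[OF sin_sq_quarter_shift[OF d]]) simp
      ultimately show ?thesis by simp
    qed
    have r4: "4 * r \<le> p + 4" by fact
    have cnt: "n \<le> 2 * (b + 1 - r - a)" "a + r \<le> b + 1"
      using bF Fm pm p(2,3) r4 unfolding a_def by linarith+
    have "real n / 2 * (A\<^sup>2 / 2) \<le> real (b + 1 - r - a) * (A\<^sup>2 / 2)"
    proof (rule mult_right_mono)
      have "real n \<le> real (2 * (b + 1 - r - a))" using cnt(1) by (simp only: of_nat_le_iff)
      then show "real n / 2 \<le> real (b + 1 - r - a)" by simp
    qed simp
    also have "\<dots> = (\<Sum>i\<in>{a..<b + 1 - r}. A\<^sup>2 / 2)" by simp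
    also have "\<dots> \<le> (\<Sum>i\<in>{a..<b + 1 - r}. g i + g (i + r))" using pair by (intro sum_mono)
    also have "\<dots> = (\<Sum>i\<in>{a..<b + 1 - r}. g i) + (\<Sum>i\<in>{a..<b + 1 - r}. g (i + r))" by (rule sum.distrib)
    also have "(\<Sum>i\<in>{a..<b + 1 - r}. g i) \<le> (\<Sum>i\<in>{a..b}. g i)" using g0 by (intro sum_mono2) auto
    also have "(\<Sum>i\<in>{a..<b + 1 - r}. g (i + r)) = (\<Sum>i\<in>(\<lambda>i. i + r) ` {a..<b + 1 - r}. g i)"
      by (subst sum.reindex) auto
    also have "\<dots> \<le> (\<Sum>i\<in>{a..b}. g i)" using g0 by (intro sum_mono2) auto
    finally have "real n * (A\<^sup>2 / 4) \<le> 2 * (\<Sum>i\<in>{a..b}. g i)" by simp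
    then show ?thesis using n by (simp add: field_simps)
  qed
  ultimately show ?thesis by (meson ennreal_leI order_trans)
qed

section \<open>Lower bounds: variance\<close>

lemma order_stat_mem:
  assumes "finite A" "j < card A"
  obtains a where "a \<in> A" "y a = order_stat A y j"
proof -
  have "order_stat A y j \<in> set (sorted_list_of_multiset (image_mset y (mset_set A)))"
    unfolding order_stat_def using assms by (intro nth_mem) (simp add: length_sample)
  then show ?thesis using that assms(1) by auto
qed

context symmetric_noise
begin

lemma noise_below_zero: "measure \<Psi> {..<0} = 1 / 2"
  using noise_less[of 0] tail_zero by simp

text \<open>If the signs in the sample are unbalanced, both central order statistics have the same sign, and the one closer to
  zero is within \<open>\<delta>\<close>. If they are balanced, the central order statistics have opposite signs and may both be far
  from zero; the upper one is then some \<open>z j\<close>, and the lower one does not depend on \<open>z j\<close>.\<close>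

lemma even_block_split:
  assumes A: "finite A" "card A = 2 * r" "1 \<le> r" and X: "\<bar>Median A z\<bar> \<le> \<delta>"
  shows "(r \<le> card {i \<in> A. z i \<in> {..\<delta>}} \<and> \<not> r \<le> card {i \<in> A. z i \<in> {..<0}})
    \<or> (r + 1 \<le> card {i \<in> A. z i \<in> {..<0}} \<and> \<not> r + 1 \<le> card {i \<in> A. z i \<in> {..<- \<delta>}})
    \<or> (\<exists>j\<in>A. card {i \<in> A - {j}. z i \<in> {..<0}} = r \<and> \<bar>z j + order_stat (A - {j}) z (r - 1)\<bar> \<le> 2 * \<delta>)"
proof -
  define N where "N = card {i \<in> A. z i < 0}"
  define lo hi where "lo = order_stat A z (r - 1)" and "hi = order_stat A z r"
  have ne: "A \<noteq> {}" using A by auto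
  have ix: "(card A - 1) div 2 = r - 1" "card A div 2 = r" "r - 1 < card A" "r < card A" using A by auto
  have med: "Median A z = (lo + hi) / 2" unfolding Median_order_stat[OF A(1)] ix(1,2) lo_def hi_def ..
  have b: "lo \<le> Median A z" "Median A z \<le> hi"
    using order_stat_le_Median[OF A(1) ne, of z] unfolding ix(1,2) lo_def hi_def .
  consider "N < r" | "r < N" | "N = r" by linarith
  then show ?thesis
  proof cases
    case 1
    have "lo \<le> \<delta>" using b X by linarith
    then have "r - 1 < card {i \<in> A. z i \<le> \<delta>}" unfolding lo_def order_stat_le_iff[OF A(1) ix(3)] .
    then show ?thesis using 1 A(3) by (auto simp: N_def)
  next
    case 2
    have "\<not> hi < - \<delta>" using b X by linarith
    then have "\<not> r < card {i \<in> A. z i < - \<delta>}" unfolding hi_def order_stat_less_iff[OF A(1) ix(4)] .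
    then show ?thesis using 2 by (auto simp: N_def)
  next
    case 3
    obtain j where j: "j \<in> A" "z j = hi" using order_stat_mem[OF A(1) ix(4), of z] unfolding hi_def by blast
    have "\<not> hi < 0" unfolding hi_def order_stat_less_iff[OF A(1) ix(4)] using 3 by (simp add: N_def)
    then have zj: "0 \<le> z j" using j by simp
    have fj: "finite (A - {j})" "r - 1 < card (A - {j})" using A j by auto
    have neg: "{i \<in> A - {j}. z i < u} = {i \<in> A. z i < u}" "{i \<in> A - {j}. z i \<le> v} = {i \<in> A. z i \<le> v}"
      if "u \<le> 0" "v < 0" for u v using zj that by auto
    have c: "card {i \<in> A - {j}. z i < 0} = r" using neg(1)[of 0 "-1"] 3 by (simp add: N_def)
    have "order_stat (A - {j}) z (r - 1) \<le> t \<longleftrightarrow> lo \<le> t" for t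
      unfolding lo_def order_stat_le_iff[OF A(1) ix(3)] order_stat_le_iff[OF fj]
    proof (cases "t < 0")
      case True
      then show "r - 1 < card {i \<in> A - {j}. z i \<le> t} \<longleftrightarrow> r - 1 < card {i \<in> A. z i \<le> t}" using neg(2)[of 0 t] by simp
    next
      case False
      have "r \<le> card {i \<in> A - {j}. z i \<le> t}" unfolding c[symmetric] using False A by (intro card_mono) auto
      moreover have "card {i \<in> A - {j}. z i \<le> t} \<le> card {i \<in> A. z i \<le> t}" using A by (intro card_mono) auto
      ultimately show "r - 1 < card {i \<in> A - {j}. z i \<le> t} \<longleftrightarrow> r - 1 < card {i \<in> A. z i \<le> t}" using A(3) by linarith
    qed
    then have "order_stat (A - {j}) z (r - 1) = lo" by (meson antisym order_refl)
    then have "\<bar>z j + order_stat (A - {j}) z (r - 1)\<bar> \<le> 2 * \<delta>" using X j unfolding med by (simp add: abs_le_iff field_simps)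
    then show ?thesis using c j(1) by (auto intro!: bexI[of _ j])
  qed
qed

text \<open>If a block of even size has as many negative as nonnegative observations, its median is the midpoint of
  two order statistics. Conditionally on all observations but the smallest nonnegative one, the latter still
  has a bounded density.\<close>

lemma pivot_small_ball:
  assumes I: "finite I" "A \<subseteq> I" "j \<in> A" "card A = 2 * r" "1 \<le> r" and \<delta>: "0 \<le> \<delta>"
  defines "E \<equiv> {z \<in> space (noise I). card {i \<in> A - {j}. z i \<in> {..<0}} = r \<and> \<bar>z j + order_stat (A - {j}) z (r - 1)\<bar> \<le> 2 * \<delta>}"
  shows "E \<in> sets (noise I)" and "measure (noise I) E \<le> 4 * K * \<delta> / sqrt (real (card A))"
proof -
  interpret P: prob_space "noise I" by (rule prob_space_product)
  define I' where "I' = I - {j}"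
  interpret P': prob_space "noise I'" by (rule prob_space_product)
  interpret pp: product_sigma_finite "\<lambda>_::'a. \<Psi>" by (intro product_sigma_finite.intro) (simp add: sigma_finite_measure_axioms)
  define A' where "A' = A - {j}"
  have jI: "insert j I' = I" "j \<notin> I'" "finite I'" using I by (auto simp: I'_def)
  have A': "A' \<subseteq> I'" "finite A'" "A' \<subseteq> I" "card A' = 2 * r - 1" "r - 1 < card A'"
    using I finite_subset[OF I(2,1)] by (auto simp: A'_def I'_def)
  have cnt: "{z \<in> space (noise L). card {i \<in> A'. z i \<in> {..<0}} = r} \<in> sets (noise L)"
    "measure (noise L) {z \<in> space (noise L). card {i \<in> A'. z i \<in> {..<0}} = r}
      = real (card A' choose r) * (1 / 2) ^ r * (1 - 1 / 2) ^ (card A' - r)" if L: "A' \<subseteq> L" for L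
  proof -
    interpret L: prob_space "noise L" by (rule prob_space_product)
    have ind: "L.indep_vars (\<lambda>_. borel) (\<lambda>i z. z i) A'" by (rule L.indep_vars_subset[OF coordinates_indep L])
    have p: "L.prob {z \<in> space (noise L). z i \<in> {..<0}} = 1 / 2" if "i \<in> A'" for i
      using coordinate_prob[of i L "{..<0}"] that L noise_below_zero by auto
    show "{z \<in> space (noise L). card {i \<in> A'. z i \<in> {..<0}} = r} \<in> sets (noise L)"
      "measure (noise L) {z \<in> space (noise L). card {i \<in> A'. z i \<in> {..<0}} = r}
        = real (card A' choose r) * (1 / 2) ^ r * (1 - 1 / 2) ^ (card A' - r)"
      using L.prob_count_eq[OF ind A'(2) _ p, of r] by auto
  qed
  have os: "(\<lambda>z. order_stat A' z (r - 1)) \<in> borel_measurable (noise I)"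
    using A' by (intro borel_measurable_order_stat[where y = "\<lambda>i z. z i"] coordinate_measurable) auto
  have zj: "(\<lambda>z. z j) \<in> borel_measurable (noise I)" using I by (intro coordinate_measurable) auto
  have V: "(\<lambda>z. \<bar>z j + order_stat A' z (r - 1)\<bar>) \<in> borel_measurable (noise I)"
    by (intro borel_measurable_abs borel_measurable_add zj os)
  have "{z \<in> space (noise I). \<bar>z j + order_stat A' z (r - 1)\<bar> \<le> 2 * \<delta>} \<in> sets (noise I)"
    using V by (rule borel_measurable_le) simp
  moreover have "E = {z \<in> space (noise I). card {i \<in> A'. z i \<in> {..<0}} = r}
      \<inter> {z \<in> space (noise I). \<bar>z j + order_stat A' z (r - 1)\<bar> \<le> 2 * \<delta>}" unfolding E_def A'_def by auto
  ultimately show Em: "E \<in> sets (noise I)" using cnt(1)[OF A'(3)] by (simp only: sets.Int)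
  define Q where "Q = {x \<in> space (noise I'). card {i \<in> A'. x i \<in> {..<0}} = r}"
  have "emeasure (noise I) E = (\<integral>\<^sup>+z. indicator E z \<partial>(noise (insert j I')))"
    using Em by (simp add: jI)
  also have "\<dots> = (\<integral>\<^sup>+x. (\<integral>\<^sup>+y. indicator E (x(j := y)) \<partial>\<Psi>) \<partial>(noise I'))"
    using Em jI by (intro pp.product_nn_integral_insert) (auto intro!: borel_measurable_indicator)
  also have "\<dots> \<le> (\<integral>\<^sup>+x. ennreal (4 * K * \<delta>) * indicator Q x \<partial>(noise I'))"
  proof (rule nn_integral_mono)
    fix x assume x: "x \<in> space (noise I')"
    define v where "v = order_stat A' x (r - 1)"
    have upd: "(x(j := y)) i = x i" if "i \<in> A'" for i y using that by (auto simp: A'_def)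
    have osu: "order_stat A' (x(j := y)) (r - 1) = v" for y
    proof -
      have "image_mset (x(j := y)) (mset_set A') = image_mset x (mset_set A')"
        using upd A'(2) by (intro image_mset_cong) auto
      then show ?thesis unfolding v_def order_stat_def by simp
    qed
    have cu: "{i \<in> A'. (x(j := y)) i \<in> {..<0}} = {i \<in> A'. x i \<in> {..<0}}" for y
    proof -
      have "j \<notin> A'" by (simp add: A'_def)
      then show ?thesis by auto
    qed
    have "(\<integral>\<^sup>+y. indicator E (x(j := y)) \<partial>\<Psi>) \<le> (\<integral>\<^sup>+y. indicator Q x * indicator {- v - 2 * \<delta>..- v + 2 * \<delta>} y \<partial>\<Psi>)"
    proof (rule nn_integral_mono)
      fix y
      show "(indicator E (x(j := y)) :: ennreal) \<le> indicator Q x * indicator {- v - 2 * \<delta>..- v + 2 * \<delta>} y"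
      proof (cases "x(j := y) \<in> E")
        case True
        then have "card {i \<in> A'. (x(j := y)) i \<in> {..<0}} = r" "\<bar>(x(j := y)) j + order_stat A' (x(j := y)) (r - 1)\<bar> \<le> 2 * \<delta>"
          unfolding E_def A'_def by auto
        then have "x \<in> Q" "\<bar>y + v\<bar> \<le> 2 * \<delta>" using x unfolding cu osu Q_def by auto
        then have "x \<in> Q" "y \<in> {- v - 2 * \<delta>..- v + 2 * \<delta>}" by auto
        then show ?thesis by (simp add: indicator_def)
      qed simp
    qed
    also have "\<dots> = indicator Q x * emeasure \<Psi> {- v - 2 * \<delta>..- v + 2 * \<delta>}"
      by (subst nn_integral_cmult) (auto simp: sets_noise intro!: borel_measurable_indicator)
    also have "emeasure \<Psi> {- v - 2 * \<delta>..- v + 2 * \<delta>} \<le> ennreal (4 * K * \<delta>)"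
      using noise_density[of "- v - 2 * \<delta>" "- v + 2 * \<delta>"] \<delta> by (simp add: emeasure_eq_measure ennreal_leI)
    then have "indicator Q x * emeasure \<Psi> {- v - 2 * \<delta>..- v + 2 * \<delta>} \<le> ennreal (4 * K * \<delta>) * indicator Q x"
      by (subst mult.commute) (rule mult_right_mono, auto)
    finally show "(\<integral>\<^sup>+y. indicator E (x(j := y)) \<partial>\<Psi>) \<le> ennreal (4 * K * \<delta>) * indicator Q x" .
  qed
  also have "\<dots> = ennreal (4 * K * \<delta>) * emeasure (noise I') Q"
    using cnt(1)[OF A'(1)] by (intro nn_integral_cmult_indicator) (simp add: Q_def)
  also have "\<dots> = ennreal (4 * K * \<delta> * measure (noise I') Q)"
    unfolding P'.emeasure_eq_measure by (rule ennreal_mult''[symmetric]) simp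
  finally have 1: "measure (noise I) E \<le> 4 * K * \<delta> * measure (noise I') Q"
    using K_nonneg \<delta> by (simp add: P.emeasure_eq_measure ennreal_le_iff)
  have "measure (noise I') Q \<le> 1 / sqrt (real (card A))"
  proof -
    have "card A' = r + (r - 1)" using A'(4) I(5) by linarith
    then have e: "(1 / 2 :: real) ^ r * (1 - 1 / 2) ^ (card A' - r) = 1 / 2 ^ card A'"
      by (simp add: power_add[symmetric] power_divide)
    have "real (card A') + 1 = real (card A)" using A'(4) I(4,5) by (simp add: of_nat_diff)
    then have "real (card A' choose r) * sqrt (real (card A)) \<le> 2 ^ card A'" using binomial_sqrt_le[of "card A'" r] by simp
    moreover have "0 < sqrt (real (card A))" using I(4,5) by simp
    ultimately have "real (card A' choose r) * (1 / 2 ^ card A') \<le> 1 / sqrt (real (card A))" by (simp add: field_simps)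
    then show ?thesis using cnt(2)[OF A'(1)] e by (simp add: Q_def mult.assoc)
  qed
  then have "4 * K * \<delta> * measure (noise I') Q \<le> 4 * K * \<delta> * (1 / sqrt (real (card A)))"
    using K_nonneg \<delta> by (intro mult_left_mono) auto
  then show "measure (noise I) E \<le> 4 * K * \<delta> / sqrt (real (card A))" using 1 by simp
qed

text \<open>For odd size the law of the median is a binomial tail. For even size the unbalanced case is similar; in the balanced
  case there are \<open>card A\<close> candidates for the smallest nonnegative observation, and each event has probability of order
  \<open>\<delta> / \<surd>(card A)\<close> because the signs of the others have to be balanced.\<close>

lemma block_small_ball:
  assumes I: "finite I" "A \<subseteq> I" "A \<noteq> {}" and \<delta>: "0 \<le> \<delta>"
  shows "measure (noise I) {z \<in> space (noise I). \<bar>Median A z\<bar> \<le> \<delta>} \<le> 8 * K * sqrt (real (card A)) * \<delta>"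
proof -
  define P where "P = (noise I)"
  interpret P: prob_space P unfolding P_def by (rule prob_space_product)
  have finA: "finite A" using I finite_subset by blast
  have Mm: "(\<lambda>z. Median A z) \<in> borel_measurable P" unfolding P_def using I finA by (intro block_Median_measurable)
  have half: "1 / 2 - K * \<delta> \<le> tail \<delta>"
  proof -
    have "tail 0 = measure \<Psi> {0<..\<delta>} + tail \<delta>" by (rule noise_split[OF \<delta>])
    moreover have "measure \<Psi> {0<..\<delta>} \<le> measure \<Psi> {0..\<delta>}" by (intro finite_measure_mono) (auto simp: sets_noise)
    moreover have "measure \<Psi> {0..\<delta>} \<le> K * \<delta>" using noise_density[of 0 \<delta>] \<delta> by simp
    ultimately show ?thesis using tail_zero by linarith
  qed
  have tail: "0 \<le> tail \<delta>" "tail \<delta> \<le> 1 / 2" using tail_nonneg tail_antimono[OF \<delta>] tail_zero by auto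
  have K\<delta>: "0 \<le> K * \<delta>" using K_nonneg \<delta> by simp
  have "measure P {z \<in> space P. \<bar>Median A z\<bar> \<le> \<delta>} \<le> 8 * (sqrt (real (card A)) * (K * \<delta>))"
  proof (cases "odd (card A)")
    case True
    then obtain r where r: "card A = 2 * r + 1" by (elim oddE)
    define G where "G = binom_tail (2 * r + 1) (r + 1)"
    have S: "{z \<in> space P. \<delta> < Median A z} \<in> sets P" "{z \<in> space P. Median A z < - \<delta>} \<in> sets P"
      using Mm by (auto intro!: borel_measurable_less)
    have "{z \<in> space P. \<bar>Median A z\<bar> \<le> \<delta>} = space P - ({z \<in> space P. \<delta> < Median A z} \<union> {z \<in> space P. Median A z < - \<delta>})" by auto
    then have "measure P {z \<in> space P. \<bar>Median A z\<bar> \<le> \<delta>} = 1 - measure P ({z \<in> space P. \<delta> < Median A z} \<union> {z \<in> space P. Median A z < - \<delta>})"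
      using S by (simp add: P.prob_compl)
    also have "measure P ({z \<in> space P. \<delta> < Median A z} \<union> {z \<in> space P. Median A z < - \<delta>}) = G (tail \<delta>) + G (tail \<delta>)"
      unfolding G_def block_Median_prob(1)[OF I(2) r \<delta>, symmetric, folded P_def]
      by (subst P.finite_measure_Union[OF S])
        (use \<delta> block_Median_prob[OF I(2) r \<delta>, folded P_def] in auto)
    also have "1 - (G (tail \<delta>) + G (tail \<delta>)) = 2 * (G (1 / 2) - G (tail \<delta>))"
      unfolding G_def binom_tail_majority_half by simp
    also have "\<dots> \<le> 2 * (2 * sqrt (real (2 * r + 1)) * (1 / 2 - tail \<delta>))"
      unfolding G_def using tail by (intro mult_left_mono binom_tail_central_lipschitz) auto
    also have "\<dots> \<le> 2 * (2 * sqrt (real (2 * r + 1)) * (K * \<delta>))" using half by (intro mult_left_mono) auto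
    also have "\<dots> \<le> 8 * (sqrt (real (card A)) * (K * \<delta>))"
    proof -
      have "0 \<le> sqrt (real (card A)) * (K * \<delta>)" using K\<delta> by simp
      then show ?thesis unfolding r[symmetric] by argo
    qed
    finally show ?thesis .
  next
    case False
    then obtain r where r: "card A = 2 * r" by auto
    have r1: "1 \<le> r" using r I(3) finA by (cases r) auto
    have ind: "P.indep_vars (\<lambda>_. borel) (\<lambda>i z. z i) A"
      unfolding P_def by (rule prob_space.indep_vars_subset[OF prob_space_product coordinates_indep I(2)])
    define C where "C = (\<lambda>s B. {z \<in> space P. s \<le> card {i \<in> A. z i \<in> B}})"
    have C: "C s B \<in> sets P" "measure P (C s B) = binom_tail (2 * r) s (measure \<Psi> B)" if B: "B \<in> sets borel" for s B
    proof -
      have p: "P.prob {z \<in> space P. z i \<in> B} = measure \<Psi> B" if "i \<in> A" for i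
        unfolding P_def using that I(2) B by (intro coordinate_prob) auto
      show "C s B \<in> sets P" "measure P (C s B) = binom_tail (2 * r) s (measure \<Psi> B)"
        using P.prob_count_ge[OF ind finA B p, of s] unfolding C_def r by auto
    qed
    have Cdiff: "measure P (C s B - C s B') \<le> 2 * sqrt (real (2 * r)) * (K * \<delta>)"
      if B: "B \<in> sets borel" "B' \<in> sets borel" "B' \<subseteq> B" "measure \<Psi> B - measure \<Psi> B' \<le> K * \<delta>" and s: "s = r \<or> s = r + 1" for s B B'
    proof -
      have "card {i \<in> A. z i \<in> B'} \<le> card {i \<in> A. z i \<in> B}" for z using B(3) finA by (intro card_mono) auto
      then have "C s B' \<subseteq> C s B" unfolding C_def by (auto intro: order_trans)
      then have "measure P (C s B - C s B') = binom_tail (2 * r) s (measure \<Psi> B) - binom_tail (2 * r) s (measure \<Psi> B')"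
        using C[OF B(1)] C[OF B(2)] by (simp add: P.finite_measure_Diff)
      also have "\<dots> \<le> 2 * sqrt (real (2 * r)) * (measure \<Psi> B - measure \<Psi> B')"
        using s r1 B by (intro binom_tail_central_lipschitz finite_measure_mono) (auto simp: sets_noise)
      also have "\<dots> \<le> 2 * sqrt (real (2 * r)) * (K * \<delta>)" using B(4) by (intro mult_left_mono) auto
      finally show ?thesis .
    qed
    define E where "E = (\<lambda>j. {z \<in> space P. card {i \<in> A - {j}. z i \<in> {..<0}} = r \<and> \<bar>z j + order_stat (A - {j}) z (r - 1)\<bar> \<le> 2 * \<delta>})"
    have E: "E j \<in> sets P" "measure P (E j) \<le> 4 * K * \<delta> / sqrt (real (card A))" if "j \<in> A" for j
      using pivot_small_ball[OF I(1,2) that r r1 \<delta>] unfolding E_def P_def by auto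
    have EU: "measure P (\<Union>j\<in>A. E j) \<le> 4 * (sqrt (real (card A)) * (K * \<delta>))"
    proof -
      have "measure P (\<Union>j\<in>A. E j) \<le> (\<Sum>j\<in>A. measure P (E j))"
        using E finA by (intro P.finite_measure_subadditive_finite) auto
      also have "\<dots> \<le> (\<Sum>j\<in>A. 4 * K * \<delta> / sqrt (real (card A)))" using E by (intro sum_mono)
      also have "\<dots> = real (card A) / sqrt (real (card A)) * (4 * K * \<delta>)" by simp
      also have "real (card A) / sqrt (real (card A)) = sqrt (real (card A))" by (rule real_div_sqrt) simp
      finally show ?thesis by (simp add: mult_ac)
    qed
    have d1: "measure \<Psi> {..\<delta>} - measure \<Psi> {..<0} \<le> K * \<delta>"
    proof -
      have "{..\<delta>} = {..<0} \<union> {0..\<delta>}" using \<delta> by auto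
      then have "measure \<Psi> {..\<delta>} \<le> measure \<Psi> {..<0} + measure \<Psi> {0..\<delta>}" by (simp add: measure_Un_le sets_noise)
      then show ?thesis using noise_density[of 0 \<delta>] \<delta> by simp
    qed
    have d2: "measure \<Psi> {..<0} - measure \<Psi> {..<- \<delta>} \<le> K * \<delta>" using noise_below_zero noise_less[of \<delta>] half by simp
    have S1: "C r {..\<delta>} - C r {..<0} \<in> sets P" "C (r + 1) {..<0} - C (r + 1) {..<- \<delta>} \<in> sets P" using C by auto
    have S2: "(\<Union>j\<in>A. E j) \<in> sets P" using E finA by (intro sets.finite_UN)
    have "{z \<in> space P. \<bar>Median A z\<bar> \<le> \<delta>} \<subseteq> (C r {..\<delta>} - C r {..<0}) \<union> ((C (r + 1) {..<0} - C (r + 1) {..<- \<delta>}) \<union> (\<Union>j\<in>A. E j))"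
    proof
      fix z assume "z \<in> {z \<in> space P. \<bar>Median A z\<bar> \<le> \<delta>}"
      then have z: "z \<in> space P" "\<bar>Median A z\<bar> \<le> \<delta>" by auto
      show "z \<in> (C r {..\<delta>} - C r {..<0}) \<union> ((C (r + 1) {..<0} - C (r + 1) {..<- \<delta>}) \<union> (\<Union>j\<in>A. E j))"
        using even_block_split[OF finA r r1 z(2)] z(1) unfolding C_def E_def by blast
    qed
    then have "measure P {z \<in> space P. \<bar>Median A z\<bar> \<le> \<delta>} \<le> measure P ((C r {..\<delta>} - C r {..<0}) \<union> ((C (r + 1) {..<0} - C (r + 1) {..<- \<delta>}) \<union> (\<Union>j\<in>A. E j)))"
      using S1 S2 by (intro P.finite_measure_mono sets.Un)
    also have "\<dots> \<le> measure P (C r {..\<delta>} - C r {..<0}) + measure P ((C (r + 1) {..<0} - C (r + 1) {..<- \<delta>}) \<union> (\<Union>j\<in>A. E j))"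
      using S1 S2 by (intro measure_Un_le sets.Un)
    also have "\<dots> \<le> measure P (C r {..\<delta>} - C r {..<0}) + (measure P (C (r + 1) {..<0} - C (r + 1) {..<- \<delta>}) + measure P (\<Union>j\<in>A. E j))"
      using S1 S2 by (intro add_left_mono measure_Un_le)
    also have "\<dots> \<le> 2 * sqrt (real (2 * r)) * (K * \<delta>) + (2 * sqrt (real (2 * r)) * (K * \<delta>) + 4 * (sqrt (real (card A)) * (K * \<delta>)))"
      using \<delta> d1 d2 EU by (intro add_mono Cdiff) auto
    finally show ?thesis unfolding r by (simp add: mult_ac)
  qed
  then show ?thesis by (simp add: P_def mult_ac)
qed

lemma block_Median_positive:
  assumes I: "finite I" "A \<subseteq> I" "A \<noteq> {}"
  shows "measure (noise I) {z \<in> space (noise I). Median A z \<in> {0<..}} = 1 / 2"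
proof -
  define P where "P = (noise I)"
  interpret P: prob_space P unfolding P_def by (rule prob_space_product)
  have finA: "finite A" using I finite_subset by blast
  have Mm: "(\<lambda>z. Median A z) \<in> borel_measurable P" unfolding P_def using I finA by (intro block_Median_measurable)
  define S T Z where "S = {z \<in> space P. 0 < Median A z}" and "T = {z \<in> space P. Median A z < 0}"
    and "Z = {z \<in> space P. \<bar>Median A z\<bar> \<le> 0}"
  have m: "S \<in> sets P" "T \<in> sets P" "Z \<in> sets P"
    unfolding S_def T_def Z_def using Mm by (auto intro!: borel_measurable_less borel_measurable_le)
  have "measure P Z \<le> 0" using block_small_ball[OF I order_refl] by (simp add: Z_def P_def)
  then have Z0: "measure P Z = 0" using measure_nonneg[of P Z] by linarith
  have ST: "measure P T = measure P S"
    using block_Median_symmetric[OF I(2,3,1), of "{0<..}"] by (simp add: S_def T_def P_def)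
  have "space P = S \<union> (T \<union> Z)" by (auto simp: S_def T_def Z_def)
  then have "1 = measure P (S \<union> (T \<union> Z))" using P.prob_space by simp
  also have "\<dots> = measure P S + measure P (T \<union> Z)" using m by (intro P.finite_measure_Union) (auto simp: S_def T_def Z_def)
  also have "measure P (T \<union> Z) = measure P T + measure P Z" using m by (intro P.finite_measure_Union) (auto simp: S_def T_def Z_def)
  finally show ?thesis using Z0 ST by (simp add: S_def P_def)
qed

end

lemma card_near_le:
  fixes u x :: real
  assumes "0 \<le> x"
  shows "finite {j::nat. \<bar>real j - u\<bar> < x}" "real (card {j::nat. \<bar>real j - u\<bar> < x}) \<le> 2 * x + 1"
proof -
  let ?T = "{j::nat. \<bar>real j - u\<bar> < x}"
  have "?T \<subseteq> {..nat \<lceil>u + x\<rceil>}"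
  proof
    fix j assume "j \<in> ?T"
    then have "real j < u + x" by (auto simp: abs_less_iff)
    then show "j \<in> {..nat \<lceil>u + x\<rceil>}" by (simp add: le_nat_iff) linarith
  qed
  then show fin: "finite ?T" by (rule finite_subset) simp
  show "real (card ?T) \<le> 2 * x + 1"
  proof (cases "?T = {}")
    case True then show ?thesis using assms by simp
  next
    case False
    define a b where "a = Min ?T" and "b = Max ?T"
    have ab: "a \<in> ?T" "b \<in> ?T" "a \<le> b" using Min_in[OF fin False] Max_in[OF fin False] Min_le[OF fin] by (auto simp: a_def b_def)
    have "?T \<subseteq> {a..b}" using fin by (auto simp: a_def b_def)
    then have "card ?T \<le> card {a..b}" by (intro card_mono) auto
    then have "real (card ?T) \<le> real (b + 1 - a)" by simp
    also have "\<dots> = real b - real a + 1" using ab(3) by (simp add: of_nat_diff)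
    also have "\<dots> \<le> 2 * x + 1" using ab(1,2) by (auto simp: abs_less_iff)
    finally show ?thesis .
  qed
qed

context symmetric_noise
begin

text \<open>The number of positive block medians in a window is binomial and fluctuates on the scale of the square root
  of the number of blocks. If it is that far from one half of the blocks, and fewer blocks than that have a median
  within \<open>\<delta>\<close> of zero, the window median is at distance at least \<open>\<delta>\<close> from zero.\<close>

lemma window_spread:
  assumes I: "finite I" and W: "finite W" "2 \<le> card W"
    and A: "\<And>k. k \<in> W \<Longrightarrow> A k \<subseteq> I \<and> A k \<noteq> {} \<and> card (A k) \<le> m" and dj: "disjoint_family_on A W"
    and \<delta>: "0 \<le> \<delta>" "640 * K * (sqrt (real (card W)) * sqrt (real m)) * \<delta> \<le> 1"
  shows "1 / 20 \<le> measure (noise I) {z \<in> space (noise I). \<delta> \<le> \<bar>Median W (\<lambda>k. Median (A k) z)\<bar>}"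
proof -
  define P where "P = (noise I)"
  interpret P: prob_space P unfolding P_def by (rule prob_space_product)
  define \<xi> where "\<xi> = (\<lambda>k (z::'a \<Rightarrow> real). Median (A k) z)"
  define B where "B = card W"
\<comment> \<open>Small enough that the binomial count is within \<open>x\<close> of its mean with probability at most \<open>17 / 20\<close>.\<close>
  define x where "x = sqrt (real B) / 8"
  have B0: "0 < sqrt (real B)" using W by (simp add: B_def)
  have x0: "0 < x" using B0 by (simp add: x_def)
  have finA: "finite (A k)" if "k \<in> W" for k using A[OF that] I finite_subset by blast
  have \<xi>m: "\<xi> k \<in> borel_measurable P" if "k \<in> W" for k
    unfolding \<xi>_def P_def using A[OF that] finA[OF that] by (intro block_Median_measurable) auto
  have neW: "W \<noteq> {}" using W by auto
  have Tm: "(\<lambda>z. Median W (\<lambda>k. \<xi> k z)) \<in> borel_measurable P" by (rule borel_measurable_Median[OF W(1) neW \<xi>m])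
  have ind: "P.indep_vars (\<lambda>_. borel) \<xi> W"
    unfolding \<xi>_def P_def using A finA dj by (intro block_Medians_indep) auto
  have pos: "P.prob {z \<in> space P. \<xi> k z \<in> {0<..}} = 1 / 2" if "k \<in> W" for k
    unfolding \<xi>_def P_def using A[OF that] I by (intro block_Median_positive) auto
  define N where "N = (\<lambda>z. card {k \<in> W. \<xi> k z \<in> {0<..}})"
  define T where "T = {j::nat. \<bar>real j - real B / 2\<bar> < x}"
  define near where "near = (\<Union>j\<in>T. {z \<in> space P. N z = j})"
  have Neq: "{z \<in> space P. N z = j} \<in> sets P" "P.prob {z \<in> space P. N z = j} \<le> 1 / sqrt (real B + 1)" for j
  proof -
    show "{z \<in> space P. N z = j} \<in> sets P" unfolding N_def using P.prob_count_eq(1)[OF ind W(1) _ pos, of j] by simp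
    have "P.prob {z \<in> space P. N z = j} = real (B choose j) * ((1 / 2) ^ j * (1 / 2) ^ (B - j))"
      unfolding N_def B_def using P.prob_count_eq(2)[OF ind W(1) _ pos, of j] by simp
    also have "\<dots> \<le> 1 / sqrt (real B + 1)"
    proof (cases "j \<le> B")
      case True
      then have e: "(1 / 2 :: real) ^ j * (1 / 2) ^ (B - j) = 1 / 2 ^ B" by (simp add: power_add[symmetric] power_divide)
      have "real (B choose j) * sqrt (real B + 1) \<le> 2 ^ B" by (rule binomial_sqrt_le)
      then show ?thesis unfolding e by (simp add: field_simps)
    qed (simp add: binomial_eq_0)
    finally show "P.prob {z \<in> space P. N z = j} \<le> 1 / sqrt (real B + 1)" .
  qed
  have T: "finite T" "real (card T) \<le> 2 * x + 1" unfolding T_def using card_near_le[of x "real B / 2"] x0 by auto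
  have near: "near \<in> sets P" "P.prob near \<le> 17 / 20"
  proof -
    show "near \<in> sets P" unfolding near_def using T Neq by (intro sets.finite_UN)
    have "P.prob near \<le> (\<Sum>j\<in>T. P.prob {z \<in> space P. N z = j})"
      unfolding near_def using T Neq by (intro P.finite_measure_subadditive_finite) auto
    also have "\<dots> \<le> (\<Sum>j\<in>T. 1 / sqrt (real B + 1))" using Neq by (intro sum_mono)
    also have "\<dots> = real (card T) * (1 / sqrt (real B + 1))" by simp
    also have "\<dots> \<le> (2 * x + 1) * (1 / sqrt (real B + 1))" using T by (intro mult_right_mono) auto
    also have "\<dots> \<le> 17 / 20"
    proof -
      define S where "S = sqrt (real B + 1)"
      have s1: "sqrt (real B) \<le> S" by (simp add: S_def)
      have "sqrt ((5 / 3)\<^sup>2) \<le> S" unfolding S_def using W by (intro real_sqrt_le_mono) (simp add: B_def power2_eq_square)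
      then have s2: "5 / 3 \<le> S" by simp
      have "2 * x + 1 \<le> 17 / 20 * S" using s1 s2 by (simp add: x_def)
      then show ?thesis using s2 unfolding S_def[symmetric] by (simp add: field_simps)
    qed
    finally show "P.prob near \<le> 17 / 20" .
  qed
  define D where "D = (\<lambda>k. {z \<in> space P. \<bar>\<xi> k z\<bar> \<le> \<delta>})"
  have D: "D k \<in> sets P" "P.prob (D k) \<le> 8 * K * sqrt (real m) * \<delta>" if "k \<in> W" for k
  proof -
    show "D k \<in> sets P" unfolding D_def using \<xi>m[OF that] by (intro borel_measurable_le borel_measurable_abs) auto
    have "P.prob (D k) \<le> 8 * K * sqrt (real (card (A k))) * \<delta>"
      unfolding D_def \<xi>_def P_def using A[OF that] I \<delta> by (intro block_small_ball) auto
    also have "\<dots> \<le> 8 * K * sqrt (real m) * \<delta>"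
      using A[OF that] K_nonneg \<delta> by (intro mult_right_mono mult_left_mono real_sqrt_le_mono) auto
    finally show "P.prob (D k) \<le> 8 * K * sqrt (real m) * \<delta>" .
  qed
  define C where "C = (\<lambda>z. real (card {k \<in> W. \<bar>\<xi> k z\<bar> \<le> \<delta>}))"
  have Cm: "C \<in> borel_measurable P" unfolding C_def using W D by (intro borel_measurable_card) (auto simp: D_def)
  define many where "many = {z \<in> space P. x \<le> C z}"
  have many: "many \<in> sets P" "P.prob many \<le> 1 / 10"
  proof -
    show m: "many \<in> sets P" unfolding many_def using Cm by (intro borel_measurable_le) auto
    have Cs: "C z = (\<Sum>k\<in>W. indicator (D k) z)" if "z \<in> space P" for z
      unfolding C_def D_def using W(1) that by (simp add: indicator_def sum.If_cases Int_def)
    have "x * P.prob many = (\<integral>z. x * indicator many z \<partial>P)" using m by simp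
    also have "\<dots> \<le> (\<integral>z. (\<Sum>k\<in>W. indicator (D k) z) \<partial>P)"
    proof (rule integral_mono)
      show "integrable P (\<lambda>z. x * indicator many z)"
        by (intro integrable_mult_right integrable_real_indicator m) (simp add: P.emeasure_eq_measure)
      show "integrable P (\<lambda>z. (\<Sum>k\<in>W. indicator (D k) z :: real))" using D
        by (intro Bochner_Integration.integrable_sum integrable_real_indicator) (auto simp: P.emeasure_eq_measure)
      fix z assume z: "z \<in> space P"
      show "x * indicator many z \<le> (\<Sum>k\<in>W. indicator (D k) z)"
        unfolding Cs[OF z, symmetric] by (cases "z \<in> many") (auto simp: many_def C_def)
    qed
    also have "\<dots> = (\<Sum>k\<in>W. P.prob (D k))"
      using D by (subst Bochner_Integration.integral_sum) (auto simp: P.emeasure_eq_measure)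
    also have "\<dots> \<le> (\<Sum>k\<in>W. 8 * K * sqrt (real m) * \<delta>)" using D by (intro sum_mono)
    also have "\<dots> = real B * (8 * K * sqrt (real m) * \<delta>)" by (simp add: B_def)
    also have "real B = sqrt (real B) * (8 * x)" by (simp add: x_def)
    also have "sqrt (real B) * (8 * x) * (8 * K * sqrt (real m) * \<delta>) = x * (64 * K * (sqrt (real B) * sqrt (real m)) * \<delta>)" by simp
    also have "\<dots> \<le> x * (1 / 10)" using \<delta>(2) x0 by (intro mult_left_mono) (auto simp: B_def)
    finally show "P.prob many \<le> 1 / 10" using x0 by (simp add: mult_le_cancel_left_pos)
  qed
  define Big where "Big = {z \<in> space P. \<delta> \<le> \<bar>Median W (\<lambda>k. \<xi> k z)\<bar>}"
  have Bigm: "Big \<in> sets P" unfolding Big_def using Tm by (intro borel_measurable_le borel_measurable_abs) auto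
  have "space P \<subseteq> near \<union> (many \<union> Big)"
  proof
    fix z assume z: "z \<in> space P"
    show "z \<in> near \<union> (many \<union> Big)"
    proof (rule ccontr)
      assume not: "z \<notin> near \<union> (many \<union> Big)"
      have n1: "x \<le> \<bar>real (N z) - real B / 2\<bar>" using not z by (auto simp: near_def T_def)
      have n2: "C z < x" using not z by (auto simp: many_def)
      have n3: "\<bar>Median W (\<lambda>k. \<xi> k z)\<bar> < \<delta>" using not z by (auto simp: Big_def)
      have sub: "real (card S) \<le> real (card S') + C z"
        if "S \<subseteq> S' \<union> {k \<in> W. \<bar>\<xi> k z\<bar> \<le> \<delta>}" "S' \<subseteq> W" for S S'
      proof -
        have "finite S'" using that W(1) finite_subset by blast
        then have "card S \<le> card (S' \<union> {k \<in> W. \<bar>\<xi> k z\<bar> \<le> \<delta>})" using that W(1) by (intro card_mono) auto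
        also have "\<dots> \<le> card S' + card {k \<in> W. \<bar>\<xi> k z\<bar> \<le> \<delta>}" by (rule card_Un_le)
        finally have "real (card S) \<le> real (card S' + card {k \<in> W. \<bar>\<xi> k z\<bar> \<le> \<delta>})" by (simp only: of_nat_le_iff)
        then show ?thesis by (simp add: C_def)
      qed
      have spl: "real (N z) + real (card {k \<in> W. \<xi> k z \<le> 0}) = real B"
        using card_split[OF W(1), of "\<lambda>k. \<xi> k z \<in> {0<..}"] unfolding N_def B_def
        by (simp add: not_less flip: of_nat_add)
      consider "real B / 2 + x \<le> real (N z)" | "real (N z) \<le> real B / 2 - x" using n1 by (auto simp: abs_if split: if_splits)
      then show False
      proof cases
        case 1
        have "real (N z) \<le> real (card {k \<in> W. \<delta> \<le> \<xi> k z}) + C z" unfolding N_def by (rule sub) auto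
        then have "real B < 2 * real (card {k \<in> W. \<delta> \<le> \<xi> k z})" using 1 n2 by argo
        then have "card W < 2 * card {k \<in> W. \<delta> \<le> \<xi> k z}" unfolding B_def by (simp flip: of_nat_less_iff[where 'a = real])
        then have "\<delta> \<le> Median W (\<lambda>k. \<xi> k z)" by (rule le_MedianI[OF W(1)])
        then show False using n3 by linarith
      next
        case 2
        have "real (card {k \<in> W. \<xi> k z \<le> 0}) \<le> real (card {k \<in> W. \<xi> k z \<le> - \<delta>}) + C z" by (rule sub) auto
        then have "real B < 2 * real (card {k \<in> W. \<xi> k z \<le> - \<delta>})" using 2 n2 spl by argo
        then have "card W < 2 * card {k \<in> W. \<xi> k z \<le> - \<delta>}" unfolding B_def by (simp flip: of_nat_less_iff[where 'a = real])
        then have "Median W (\<lambda>k. \<xi> k z) \<le> - \<delta>" by (rule Median_leI[OF W(1)])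
        then show False using n3 by linarith
      qed
    qed
  qed
  then have "measure P (space P) \<le> measure P (near \<union> (many \<union> Big))"
    using near many Bigm by (intro P.finite_measure_mono sets.Un)
  also have "\<dots> \<le> measure P near + measure P (many \<union> Big)" using near many Bigm by (intro measure_Un_le sets.Un)
  also have "\<dots> \<le> measure P near + (measure P many + measure P Big)" using many Bigm by (intro add_left_mono measure_Un_le)
  finally have "1 / 20 \<le> measure P Big" using near(2) many(2) P.prob_space by linarith
  then show ?thesis by (simp add: Big_def P_def \<xi>_def)
qed

text \<open>The output is \<open>1 / 2\<close> plus \<open>\<sigma>\<close> times a median of medians of pure noise, and \<open>window_spread\<close> applies with \<open>\<delta>\<close> of
  order \<open>1 / \<surd>(w m)\<close>. The constant is \<open>24576000 = 20 \<cdot> 3 \<cdot> 640\<^sup>2\<close>.\<close>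

lemma constant_signal_risk:
  assumes n: "1 \<le> n" "1 \<le> m" and w: "1 \<le> w" "w * m < n" and \<sigma>: "0 < \<sigma>"
  shows "ennreal (\<sigma>\<^sup>2 / (24576000 * (K + 1)\<^sup>2) / real (w * m)) \<le> risk n \<sigma> \<Psi> (median_filter n m w) (\<lambda>_. 1 / 2)"
proof -
  define L where "L = real (w * m)"
  have "1 * 1 \<le> w * m" using w n by (intro mult_le_mono) auto
  then have "real 1 \<le> real (w * m)" by (simp only: of_nat_le_iff mult_1)
  then have L: "1 \<le> L" by (simp only: L_def of_nat_1)
\<comment> \<open>A window has at most \<open>2 w + 1 \<le> 3 w\<close> blocks.\<close>
  define \<delta> where "\<delta> = 1 / (640 * (K + 1) * sqrt (3 * L))"
  have K1: "0 < K + 1" using K_nonneg by simp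
  have sL: "0 < sqrt (3 * L)" using L by simp
  have \<delta>: "0 < \<delta>" unfolding \<delta>_def using K1 sL by simp
  have wF: "w \<le> last_block n m"
  proof -
    have "w * m \<le> n - 1" using w by linarith
    then show ?thesis using n unfolding last_block_def by (simp add: less_eq_div_iff_mult_less_eq)
  qed
  define q where "q = \<sigma>\<^sup>2 / (24576000 * (K + 1)\<^sup>2) / L"
  have q: "q = (\<sigma> * \<delta>)\<^sup>2 * (1 / 20)"
  proof -
    have "(sqrt (3 * L))\<^sup>2 = 3 * L" using L by simp
    moreover define k where "k = K + 1"
    ultimately show ?thesis unfolding q_def \<delta>_def k_def[symmetric] by (simp add: power_mult_distrib power_divide)
  qed
  have px: "ennreal q \<le> pixel_risk n \<sigma> \<Psi> m w (\<lambda>_. 1 / 2) i" if i: "i \<in> {1..n}" for i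
  proof -
    define W where "W = window n m w ((i - 1) div m)"
    define Z where "Z = (\<lambda>z. Median W (\<lambda>k. Median (pixels n m k) z))"
    define P where "P = (noise {1..n})"
    interpret P: prob_space P unfolding P_def by (rule prob_space_product)
    have kF: "(i - 1) div m \<le> last_block n m" by (rule block_index_le[OF i])
    have W: "finite W" "2 \<le> card W" "card W \<le> 2 * w + 1"
      using card_window_ge[OF kF wF] card_window_le[of n m w "(i - 1) div m"] w(1) by (auto simp: W_def)
    have neW: "W \<noteq> {}" using W by auto
    have ne: "pixels n m k \<noteq> {}" if "k \<in> W" for k
      using that by (intro pixels_nonempty n) (auto simp: W_def window_def)
    have Zm: "Z \<in> borel_measurable P"
      unfolding Z_def P_def by (intro borel_measurable_Median[OF W(1) neW] block_Median_measurable pixels_subset finite_pixels ne)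
    have e: "median_filter n m w (observation n \<sigma> (\<lambda>_. 1 / 2) z) i = 1 / 2 + \<sigma> * Z z" for z
    proof -
      have "median_filter n m w (observation n \<sigma> (\<lambda>_. 1 / 2) z) i = Median W (\<lambda>k. 1 / 2 + \<sigma> * Median (pixels n m k) z)"
        unfolding median_filter_def observation_def W_def[symmetric]
        using ne by (intro Median_cong Median_affine \<sigma> finite_pixels)
      also have "\<dots> = 1 / 2 + \<sigma> * Z z" unfolding Z_def by (rule Median_affine[OF W(1) neW \<sigma>])
      finally show ?thesis .
    qed
    have spread: "1 / 20 \<le> measure P {z \<in> space P. \<delta> \<le> \<bar>Z z\<bar>}"
      unfolding P_def Z_def
    proof (rule window_spread[OF _ W(1,2)])
      show "pixels n m k \<subseteq> {1..n} \<and> pixels n m k \<noteq> {} \<and> card (pixels n m k) \<le> m" if "k \<in> W" for k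
        using ne[OF that] card_pixels_le pixels_subset by auto
      show "disjoint_family_on (pixels n m) W" by (rule disjoint_pixels[OF n(2)])
      have "card W \<le> 3 * w" using W(3) w(1) by linarith
      then have "real (card W) * real m \<le> real (3 * w) * real m" by (intro mult_right_mono) (auto simp only: of_nat_le_iff)
      then have "sqrt (real (card W) * real m) \<le> sqrt (3 * L)" by (intro real_sqrt_le_mono) (simp add: L_def)
      then have s: "sqrt (real (card W)) * sqrt (real m) \<le> sqrt (3 * L)" by (simp add: real_sqrt_mult)
      have "640 * K * (sqrt (real (card W)) * sqrt (real m)) * \<delta> \<le> 640 * (K + 1) * sqrt (3 * L) * \<delta>"
        using s K_nonneg \<delta> by (intro mult_right_mono mult_mono) auto
      also have "\<dots> = 1" unfolding \<delta>_def using K1 sL by simp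
      finally show "640 * K * (sqrt (real (card W)) * sqrt (real m)) * \<delta> \<le> 1" .
    qed (use \<delta> in auto)
    have S: "{z \<in> space P. \<delta> \<le> \<bar>Z z\<bar>} \<in> sets P" using Zm by (intro borel_measurable_le borel_measurable_abs) auto
    have "ennreal q \<le> ennreal ((\<sigma> * \<delta>)\<^sup>2) * emeasure P {z \<in> space P. \<delta> \<le> \<bar>Z z\<bar>}"
    proof -
      have "ennreal q = ennreal ((\<sigma> * \<delta>)\<^sup>2) * ennreal (1 / 20)" unfolding q by (rule ennreal_mult') simp
      also have "\<dots> \<le> ennreal ((\<sigma> * \<delta>)\<^sup>2) * emeasure P {z \<in> space P. \<delta> \<le> \<bar>Z z\<bar>}"
        unfolding P.emeasure_eq_measure using spread by (intro mult_left_mono ennreal_leI) auto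
      finally show ?thesis .
    qed
    also have "\<dots> = (\<integral>\<^sup>+z. ennreal ((\<sigma> * \<delta>)\<^sup>2) * indicator {z \<in> space P. \<delta> \<le> \<bar>Z z\<bar>} z \<partial>P)"
      using S by (rule nn_integral_cmult_indicator[symmetric])
    also have "\<dots> \<le> (\<integral>\<^sup>+z. ennreal ((\<sigma> * Z z)\<^sup>2) \<partial>P)"
    proof (rule nn_integral_mono)
      fix z
      show "ennreal ((\<sigma> * \<delta>)\<^sup>2) * indicator {z \<in> space P. \<delta> \<le> \<bar>Z z\<bar>} z \<le> ennreal ((\<sigma> * Z z)\<^sup>2)"
      proof (cases "\<delta> \<le> \<bar>Z z\<bar>")
        case True
        have "(\<sigma> * \<delta>)\<^sup>2 \<le> (\<sigma> * \<bar>Z z\<bar>)\<^sup>2" using True \<sigma> \<delta> by (intro power_mono mult_left_mono) auto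
        then have "ennreal ((\<sigma> * \<delta>)\<^sup>2) \<le> ennreal ((\<sigma> * Z z)\<^sup>2)" by (intro ennreal_leI) (simp add: power_mult_distrib)
        then show ?thesis by (simp add: indicator_def)
      qed simp
    qed
    also have "\<dots> = pixel_risk n \<sigma> \<Psi> m w (\<lambda>_. 1 / 2) i" unfolding pixel_risk_def e P_def by simp
    finally show ?thesis .
  qed
  have "ennreal ((\<Sum>i\<in>{1..n}. q) / real n) \<le> risk n \<sigma> \<Psi> (median_filter n m w) (\<lambda>_. 1 / 2)"
    using px L by (intro risk_ge_of_pixels[OF n(1)]) (auto simp: q_def)
  moreover have "(\<Sum>i\<in>{1..n}. q) / real n = q" using n(1) by simp
  ultimately show ?thesis by (simp add: q_def L_def)
qed

end

section \<open>The optimally tuned risk\<close>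

text \<open>Windows of at most \<open>n\<^sup>2\<^sup>/\<^sup>3\<close> pixels have too much variance. Larger windows have too much bias: on the sine wave
  while at least four of them fit into the interval, on a linear signal otherwise. The amplitude \<open>A\<close> is the largest
  for which the wave has Lipschitz constant \<open>s \<le> \<beta>\<close>; the bound on \<open>n\<close> gives the wave a period of at least \<open>32\<close> pixels,
  and \<open>221184 = 128 \<cdot> 12\<^sup>3\<close>.\<close>

lemma class_risk_lower_bound:
  assumes \<sigma>: "0 < \<sigma>" and \<beta>: "0 < \<beta>" and sep: "\<exists>x. well_separated \<eta> N x"
    and pr: "prob_space \<Psi>" and sh: "shape_condition \<Psi> \<psi>"
  shows "\<exists>c>0. \<forall>n\<ge>125. \<forall>h\<in>admissible_scales n.
     ennreal (c * real n powr (- 2 / 3)) \<le> class_risk n \<sigma> \<Psi> (two_scale_median n (fst h) (snd h)) (SEP_PLIP \<eta> \<beta> N)"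
proof -
  obtain K where K: "symmetric_noise \<Psi> K" using shape_condition_consequences[OF pr sh] by blast
  interpret symmetric_noise \<Psi> K by (rule K)
  define s where "s = min \<beta> 1"
  have s: "0 < s" "s \<le> 1" "s \<le> \<beta>" using \<beta> by (auto simp: s_def)
  define c\<^sub>1 where "c\<^sub>1 = \<sigma>\<^sup>2 / (24576000 * (K + 1)\<^sup>2)"
  define c where "c = min c\<^sub>1 (s\<^sup>2 / 221184)"
  have c1: "0 < c\<^sub>1" unfolding c\<^sub>1_def using \<sigma> K_nonneg by simp
  have c: "0 < c" "c \<le> c\<^sub>1" "c \<le> s\<^sup>2 / 221184" using c1 s by (auto simp: c_def)
  show ?thesis
  proof (intro exI[of _ c] conjI allI impI ballI c(1))
    fix n :: nat and h assume n125: "125 \<le> n" and h: "h \<in> admissible_scales n"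
    have n1: "1 \<le> n" using n125 by linarith
    obtain m w where mw: "1 \<le> m" "1 \<le> w" "w * m < n"
      and T: "\<And>Y i. i \<in> {1..n} \<Longrightarrow> two_scale_median n (fst h) (snd h) Y i = median_filter n m w Y i"
      using admissible_scales_integers[OF n1, of "fst h" "snd h"] h by auto
    define q where "q = real n powr (- 2 / 3)"
    define y where "y = real n powr (1 / 3)"
    have n0: "0 < real n" using n1 by simp
    have y3: "real n = y ^ 3" unfolding y_def using n0 by (simp add: powr_realpow[symmetric] powr_powr)
    have y0: "0 < y" unfolding y_def using n0 by simp
    have q: "q = 1 / y\<^sup>2" unfolding q_def y_def using n0
      by (simp add: powr_realpow[symmetric] powr_powr powr_minus_divide)
    have y5: "5 \<le> y"
    proof -
      have "(5::real) ^ Suc 2 \<le> y ^ Suc 2" using n125 y3 by (simp add: eval_nat_numeral)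
      then show ?thesis by (rule power_le_imp_le_base) (use y0 in simp)
    qed
    have q1: "0 < q" "q \<le> 1" using y5 by (auto simp: q power2_eq_square divide_le_eq)
        (metis mult_mono mult_1 order_trans zero_le_one one_le_numeral zero_le_numeral)
    define L where "L = real (w * m)"
    have Lpos: "0 < L" using mw unfolding L_def by simp
    have main: "ennreal (c * q) \<le> class_risk n \<sigma> \<Psi> (two_scale_median n (fst h) (snd h)) (SEP_PLIP \<eta> \<beta> N)"
      if f: "f \<in> SEP_PLIP \<eta> \<beta> N" and b: "c * q \<le> b" "ennreal b \<le> risk n \<sigma> \<Psi> (median_filter n m w) f" for f b
    proof -
      have "ennreal (c * q) \<le> risk n \<sigma> \<Psi> (median_filter n m w) f" using b by (meson ennreal_leI order_trans)
      also have "\<dots> = risk n \<sigma> \<Psi> (two_scale_median n (fst h) (snd h)) f" by (rule risk_cong) (rule T[symmetric])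
      also have "\<dots> \<le> class_risk n \<sigma> \<Psi> (two_scale_median n (fst h) (snd h)) (SEP_PLIP \<eta> \<beta> N)"
        unfolding class_risk_def using f by (rule SUP_upper)
      finally show ?thesis .
    qed
    consider (narrow) "L \<le> y\<^sup>2" | (medium) "y\<^sup>2 < L" "4 * ((2 * w + 1) * m) \<le> n" | (wide) "n < 4 * ((2 * w + 1) * m)"
      by linarith
    then have "ennreal (c * q) \<le> class_risk n \<sigma> \<Psi> (two_scale_median n (fst h) (snd h)) (SEP_PLIP \<eta> \<beta> N)"
    proof cases
      case narrow
      show ?thesis
      proof (rule main)
        show "(\<lambda>_. 1 / 2) \<in> SEP_PLIP \<eta> \<beta> N" using \<beta> by (intro lipschitz_in_SEP_PLIP[OF sep]) auto
        show "ennreal (c\<^sub>1 / L) \<le> risk n \<sigma> \<Psi> (median_filter n m w) (\<lambda>_. 1 / 2)"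
          unfolding c\<^sub>1_def L_def by (rule constant_signal_risk[OF n1 mw \<sigma>])
        have "c * q \<le> c\<^sub>1 * (1 / y\<^sup>2)" unfolding q using c by (intro mult_right_mono) auto
        also have "\<dots> = c\<^sub>1 / y\<^sup>2" by simp
        also have "\<dots> \<le> c\<^sub>1 / L" using narrow Lpos c1 y0 by (intro divide_left_mono) auto
        finally show "c * q \<le> c\<^sub>1 / L" .
      qed
    next
      case medium
      define p where "p = (2 * w + 1) * m"
      have "2 * (w * m) \<le> p" by (simp add: p_def)
      then have "real (2 * (w * m)) \<le> real p" by (simp only: of_nat_le_iff)
      then have pL: "2 * L \<le> real p" by (simp add: L_def)
      have "5 * 5 \<le> y * y" using y5 by (intro mult_mono) auto
      then have p32: "32 \<le> p" using pL medium(1) by (simp add: power2_eq_square)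
      have pn: "4 * p \<le> n" using medium(2) by (simp add: p_def)
      then have pn': "4 * real p \<le> real n" by (metis of_nat_le_iff of_nat_mult of_nat_numeral)
      have p0: "0 < real p" using p32 by simp
      define A where "A = s * real p / (2 * pi * real n)"
      have A0: "0 \<le> A" unfolding A_def using s by simp
      have A1: "A \<le> 1 / 2"
      proof -
        have "s * real p \<le> 1 * real n" using s pn' by (intro mult_mono) auto
        also have "\<dots> \<le> pi * real n" using pi_ge_two by (intro mult_right_mono) auto
        finally show ?thesis unfolding A_def using n0 pi_gt_zero by (simp add: field_simps)
      qed
      define f where "f = (\<lambda>x. 1 / 2 + A * sin (2 * pi * (real n * x - (real m + 1) / 2) / real p))"
      show ?thesis
      proof (rule main)
        show "f \<in> SEP_PLIP \<eta> \<beta> N"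
        proof (rule lipschitz_in_SEP_PLIP[OF sep])
          fix t :: real
          define u where "u = 2 * pi * (real n * t - (real m + 1) / 2) / real p"
          have "\<bar>A * sin u\<bar> \<le> (1 / 2) * 1" unfolding abs_mult using A0 A1 by (intro mult_mono abs_sin_le_one) auto
          then have "A * sin u \<le> 1 / 2" "- (A * sin u) \<le> 1 / 2" unfolding abs_le_iff by simp_all
          then show "f t \<in> {0..1}" unfolding f_def u_def[symmetric] by simp
        next
          fix t t' :: real
          define u u' where "u = 2 * pi * (real n * t - (real m + 1) / 2) / real p"
            and "u' = 2 * pi * (real n * t' - (real m + 1) / 2) / real p"
          have "\<bar>f t - f t'\<bar> = A * \<bar>sin u - sin u'\<bar>"
            using A0 by (simp add: f_def u_def[symmetric] u'_def[symmetric] abs_mult right_diff_distrib[symmetric])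
          also have "\<dots> \<le> A * \<bar>u - u'\<bar>" using A0 by (intro mult_left_mono abs_sin_diff_le)
          also have "u - u' = (2 * pi * real n / real p) * (t - t')"
            unfolding u_def u'_def using p0 by (simp add: field_simps)
          also have "A * \<bar>(2 * pi * real n / real p) * (t - t')\<bar> = s * \<bar>t - t'\<bar>"
            unfolding abs_mult A_def using p0 n0 pi_gt_zero by (simp add: abs_of_pos field_simps)
          also have "\<dots> \<le> \<beta> * \<bar>t - t'\<bar>" using s by (intro mult_right_mono) auto
          finally show "\<bar>f t - f t'\<bar> \<le> \<beta> * \<bar>t - t'\<bar>" .
        qed
        show "ennreal (A\<^sup>2 / 8) \<le> risk n \<sigma> \<Psi> (median_filter n m w) f"
          unfolding f_def by (rule small_window_risk[OF n1 mw(1) \<sigma> p_def p32 pn])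
        show "c * q \<le> A\<^sup>2 / 8"
        proof -
          have "s * (2 * y\<^sup>2) / (2 * 4 * y ^ 3) \<le> s * real p / (2 * pi * y ^ 3)"
            using s pL medium(1) y0 pi_less_4 pi_gt_zero
            by (intro frac_le mult_left_mono mult_right_mono mult_nonneg_nonneg mult_pos_pos) auto
          also have "\<dots> = A" by (simp add: A_def y3)
          also have "s * (2 * y\<^sup>2) / (2 * 4 * y ^ 3) = s / (4 * y)" using y0 by (simp add: power2_eq_square power3_eq_cube)
          finally have "(s / (4 * y))\<^sup>2 \<le> A\<^sup>2" using s y0 by (intro power_mono) auto
          then have "s\<^sup>2 / 16 * q \<le> A\<^sup>2" unfolding q by (simp add: power_divide power_mult_distrib)
          moreover have "c * q \<le> s\<^sup>2 / 221184 * q" using c q1 by (intro mult_right_mono) auto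
          moreover have "0 \<le> s\<^sup>2 * q" using q1 by simp
          ultimately show ?thesis by simp
        qed
      qed
    next
      case wide
      have "m \<le> w * m" using mw by simp
      moreover have "4 * ((2 * w + 1) * m) = 8 * (w * m) + 4 * m" by (simp add: algebra_simps)
      ultimately have "n < 12 * (w * m)" using wide by linarith
      then have "real n < real (12 * (w * m))" by (simp only: of_nat_less_iff)
      then have nL: "real n < 12 * L" by (simp add: L_def)
      have "4 \<le> w * m" using \<open>n < 12 * (w * m)\<close> n125 by linarith
      show ?thesis
      proof (rule main)
        show "(\<lambda>x. s * x) \<in> SEP_PLIP \<eta> \<beta> N"
        proof (rule lipschitz_in_SEP_PLIP[OF sep])
          show "s * t \<in> {0..1}" if "t \<in> {0..1}" for t using that s by (auto intro: mult_le_one)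
          show "\<bar>s * t - s * t'\<bar> \<le> \<beta> * \<bar>t - t'\<bar>" for t t'
          proof -
            have "\<bar>s * t - s * t'\<bar> = s * \<bar>t - t'\<bar>" using s by (simp add: abs_mult right_diff_distrib[symmetric])
            also have "\<dots> \<le> \<beta> * \<bar>t - t'\<bar>" using s by (intro mult_right_mono) auto
            finally show ?thesis .
          qed
        qed
        show "ennreal (s\<^sup>2 / 128 * (L / real n) ^ 3) \<le> risk n \<sigma> \<Psi> (median_filter n m w) (\<lambda>x. s * x)"
          unfolding L_def by (rule large_window_risk[OF n1 mw(1) \<sigma> mw(3) \<open>4 \<le> w * m\<close>]) (use s in simp)
        have "1 / 12 \<le> L / real n" using nL n0 by (simp add: field_simps)
        then have "(1 / 12) ^ 3 \<le> (L / real n) ^ 3" by (intro power_mono) auto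
        then have "s\<^sup>2 / 128 * (1 / 12) ^ 3 \<le> s\<^sup>2 / 128 * (L / real n) ^ 3" by (intro mult_left_mono) auto
        moreover have "c * q \<le> s\<^sup>2 / 221184 * 1" using c q1 by (intro mult_mono) auto
        moreover have "s\<^sup>2 / 221184 * 1 = s\<^sup>2 / 128 * (1 / 12) ^ 3" by (simp add: power3_eq_cube)
        ultimately show "c * q \<le> s\<^sup>2 / 128 * (L / real n) ^ 3" by linarith
      qed
    qed
    then show "ennreal (c * real n powr (- 2 / 3)) \<le> class_risk n \<sigma> \<Psi> (two_scale_median n (fst h) (snd h)) (SEP_PLIP \<eta> \<beta> N)"
      by (simp add: q_def)
  qed
qed

theorem theorem5p1:
  fixes \<sigma> \<eta> \<beta> :: real and N :: nat and \<Psi> :: "real measure" and \<psi> :: "real \<Rightarrow> real"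
  assumes "0 < \<sigma>" and "1 \<le> N" and "0 < \<beta>" and "0 < \<eta>"
    and "\<exists>x. well_separated \<eta> N x"
    and "prob_space \<Psi>"
    and "shape_condition \<Psi> \<psi>"
    and "1 < decay_exponent \<psi>"
  shows "same_order
    (\<lambda>n. INF (h\<^sub>1, h\<^sub>2)\<in>admissible_scales n.
       class_risk n \<sigma> \<Psi> (two_scale_median n h\<^sub>1 h\<^sub>2) (SEP_PLIP \<eta> \<beta> N))
    (\<lambda>n. ennreal (real n powr (- 2 / 3)))"
proof -
  define R where "R = (\<lambda>n h. class_risk n \<sigma> \<Psi> (two_scale_median n (fst h) (snd h)) (SEP_PLIP \<eta> \<beta> N))"
  obtain C where C: "0 < C" and up: "\<forall>\<^sub>F n in sequentially. \<exists>h\<in>admissible_scales n. R n h \<le> ennreal (C * real n powr (- 2 / 3))"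
    using class_risk_upper_bound[OF assms(1,3,4,6,7,8), of N] unfolding R_def by blast
  obtain c where c: "0 < c" and lo: "\<And>n h. 125 \<le> n \<Longrightarrow> h \<in> admissible_scales n \<Longrightarrow> ennreal (c * real n powr (- 2 / 3)) \<le> R n h"
    using class_risk_lower_bound[OF assms(1,3,5,6,7)] unfolding R_def by blast
  have eq: "(INF (h\<^sub>1, h\<^sub>2)\<in>admissible_scales n. class_risk n \<sigma> \<Psi> (two_scale_median n h\<^sub>1 h\<^sub>2) (SEP_PLIP \<eta> \<beta> N))
      = (INF h\<in>admissible_scales n. R n h)" for n
    by (simp add: R_def case_prod_beta')
  have "\<forall>\<^sub>F n in sequentially. ennreal c \<le> (INF h\<in>admissible_scales n. R n h) / ennreal (real n powr (- 2 / 3)) \<and>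
      (INF h\<in>admissible_scales n. R n h) / ennreal (real n powr (- 2 / 3)) \<le> ennreal C"
    using up eventually_ge_at_top[of "125 :: nat"]
  proof eventually_elim
    case (elim n)
    define q where "q = real n powr (- 2 / 3)"
    have q: "0 < q" using elim(2) by (simp add: q_def)
    have div: "ennreal (a * q) / ennreal q = ennreal a" if "0 < a" for a
      using that q by (subst divide_ennreal) auto
    have "ennreal (c * q) \<le> (INF h\<in>admissible_scales n. R n h)"
      using lo[OF elim(2)] unfolding q_def by (intro INF_greatest)
    from divide_right_mono_ennreal[OF this, of "ennreal q"] have 1: "ennreal c \<le> (INF h\<in>admissible_scales n. R n h) / ennreal q"
      by (simp only: div[OF c])
    obtain h where "h \<in> admissible_scales n" "R n h \<le> ennreal (C * q)" using elim(1) unfolding q_def by blast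
    then have "(INF h\<in>admissible_scales n. R n h) \<le> ennreal (C * q)" by (meson INF_lower order_trans)
    from divide_right_mono_ennreal[OF this, of "ennreal q"] have 2: "(INF h\<in>admissible_scales n. R n h) / ennreal q \<le> ennreal C"
      by (simp only: div[OF C])
    show ?case using 1 2 unfolding q_def by blast
  qed
  then show ?thesis unfolding same_order_def eq using c C by blast
qed

end
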